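(* Let $m\in\{1,2,\ldots\}$ and let $\alpha:[0,1]\to\mathbb{R}$ be $m$-times differentiable with $\alpha^{(m)}\in L^2([0,1])$. Let $C_0,C_1,C_2,p_1$ be the constants defined in the context. Then for all $n=1,2,\ldots$, all $p\ge p_1$, all $\rho>n^{-2m}$ and every $n\times p$ matrix of values $(X_i(t_j))_{i,j}$: $$\|\mathbb{E}_\varepsilon(\widehat{\boldsymbol\alpha})-\boldsymbol\alpha\|_{\Gamma_{n,p}}^2\le 2\rho\Big(\frac1p\boldsymbol\alpha^\tau\mathbf{P}_m\boldsymbol\alpha+C_1\Big)+\frac4n\sum_{i=1}^n(d_i-\overline d)^2\le 2\rho(C_2+C_1)+\frac4n\sum_{i=1}^n(d_i-\overline d)^2,$$ and $$\mathbb{E}_\varepsilon\big(\|\widehat{\boldsymbol\alpha}-\mathbb{E}_\varepsilon(\widehat{\boldsymbol\alpha})\|_{\Gamma_{n,p}}^2\big)\le\frac{\sigma_\varepsilon^2}{n}\Big(m+\big[\rho^{-1/(2m+2q+1)}\big](2+C\cdot C_0)\Big)$$ for any $C>0$ and $q\ge0$ with the property that $\sum_{j=k+1}^p\lambda_{x,j}\le C\cdot k^{-2q}$ holds for $k:=[\rho^{-1/(2m+2q+1)}]$.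
   Context: Model: $Y_i=\alpha_0+\int_0^1\alpha(t)X_i(t)\,dt+\varepsilon_i$, $i=1,\ldots,n$, where $\alpha_0\in\mathbb{R}$, the $X_i$ are identically distributed random functions on $[0,1]$ (not assumed independent) with the distribution of a generic $X$ satisfying $\mathbb{E}\int_0^1X^2(t)\,dt<\infty$, and the $\varepsilon_i$ are i.i.d. with $\mathbb{E}(\varepsilon_i)=0$, $\mathbb{E}(\varepsilon_i^2)=\sigma_\varepsilon^2$, independent of the $X_i$'s. The functions are observed at $t_1=\frac1{2p}$, $t_j-t_{j-1}=\frac1p$ ($j=2,\ldots,p$). $\mathbb{E}_\varepsilon$ denotes conditional expectation given $X_1,\ldots,X_n$. For real $x>0$, $[x]$ denotes the smallest integer larger than $x$. Bars denote averages over $i=1,\ldots,n$ ($\overline Y$, $\overline X(t)$, $\overline d$), $\|\cdot\|$ is the Euclidean norm and $^\tau$ is transposition. Estimator: $\mathbf{Y}=(Y_1-\overline Y,\ldots,Y_n-\overline Y)^\tau$; $\mathbf{X}$ is the $n\times p$ matrix with entries $X_i(t_j)-\overline X(t_j)$; $\boldsymbol\alpha=(\alpha(t_1),\ldots,\alpha(t_p))^\tau$. $\mathbf{P}_m$ is the $p\times p$ orthogonal projection matrix onto the space of vectors $\mathbf{w}\in\mathbb{R}^p$ with $w_j=\sum_{l=1}^m\theta_lt_j^{l-1}$. For $\mathbf{w}\in\mathbb{R}^p$, $s_{\mathbf{w}}$ is the unique natural spline of order $2m$ with knots $t_1,\ldots,t_p$ (piecewise polynomial of degree $2m-1$ between knots,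 $2m-2$ times continuously differentiable, polynomial of degree at most $m-1$ on $[0,t_1]$ and on $[t_p,1]$) with $s_{\mathbf{w}}(t_j)=w_j$, $j=1,\ldots,p$. $\mathbf{A}_m^*$ is the symmetric $p\times p$ matrix with $\mathbf{w}^\tau\mathbf{A}_m^*\mathbf{w}=\int_0^1s_{\mathbf{w}}^{(m)}(t)^2\,dt$ for all $\mathbf{w}$, and $\mathbf{A}_m=\mathbf{P}_m+p\mathbf{A}_m^*$ (positive definite). With smoothing parameter $\rho>0$, $$\widehat{\boldsymbol\alpha}=\frac1n\Big(\frac1{np}\mathbf{X}^\tau\mathbf{X}+\rho\mathbf{A}_m\Big)^{-1}\mathbf{X}^\tau\mathbf{Y}.$$ Semi-norm: $\|\mathbf{u}\|_{\Gamma_{n,p}}^2=\frac1p\mathbf{u}^\tau\big(\frac1{np}\mathbf{X}^\tau\mathbf{X}\big)\mathbf{u}$ for $\mathbf{u}\in\mathbb{R}^p$. $\lambda_{x,1}\ge\cdots\ge\lambda_{x,p}\ge0$ are the eigenvalues of $\frac1{np}\mathbf{X}^\tau\mathbf{X}$. Discretization errors: $d_i=\int_0^1\alpha(t)X_i(t)\,dt-\frac1p\sum_{j=1}^p\alpha(t_j)X_i(t_j)$. Constants: let $0=\mu_{1,p}=\cdots=\mu_{m,p}<\mu_{m+1,p}\le\cdots\le\mu_{p,p}$ be the eigenvalues of $p\mathbf{A}_m^*$. It is known that there are $0<C_0<\infty$ and $p_0$ ($p_0>m$) such that $k^{2m}/\mu_{k+m+1,p}\le C_0$ for all $p\ge p_0$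 and $k=0,\ldots,p-m-1$; fix such $C_0,p_0$. $C_1=\int_0^1\alpha^{(m)}(t)^2\,dt$, $C_2^*=\int_0^1\alpha(t)^2\,dt$, $C_2$ is an arbitrary constant with $C_2^*<C_2<\infty$, and $p_1\ge p_0$ is an integer such that $\frac1p\boldsymbol\alpha^\tau\mathbf{P}_m\boldsymbol\alpha\le C_2$ for all $p\ge p_1$. *)

theory Defs
  imports
    "HOL-Probability.Probability"
    "Jordan_Normal_Form.Char_Poly"
    "Jordan_Normal_Form.Gauss_Jordan_Elimination"
begin

unbundle no vec_syntax and no inner_syntax

section \<open>Functions on the unit interval\<close>

text \<open>All derivatives are taken within \<open>[0,1]\<close>, hence one-sided at the two end points.\<close>

definition nderiv :: "nat \<Rightarrow> (real \<Rightarrow> real) \<Rightarrow> real \<Rightarrow> real" where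
  "nderiv k f = ((\<lambda>g t. vector_derivative g (at t within {0..1})) ^^ k) f"

definition times_differentiable :: "nat \<Rightarrow> (real \<Rightarrow> real) \<Rightarrow> bool" where
  "times_differentiable k f \<longleftrightarrow> (\<forall>i<k. nderiv i f differentiable_on {0..1})"

definition times_cont_differentiable :: "nat \<Rightarrow> (real \<Rightarrow> real) \<Rightarrow> bool" where
  "times_cont_differentiable k f \<longleftrightarrow>
     times_differentiable k f \<and> continuous_on {0..1} (nderiv k f)"

definition square_integrable :: "(real \<Rightarrow> real) \<Rightarrow> bool" where
  "square_integrable f \<longleftrightarrow>
     set_borel_measurable lborel {0..1} f \<and> set_integrable lborel {0..1} (\<lambda>t. (f t)\<^sup>2)"

section \<open>Observation points and the penalty matrix\<close>

text \<open>Vectors and matrices are indexed from \<open>0\<close>, so the first observation point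
  \<open>1/(2p)\<close> is \<open>knot p 0\<close> and the last one is \<open>knot p (p - 1)\<close>.\<close>

definition knot :: "nat \<Rightarrow> nat \<Rightarrow> real" where
  "knot p j = 1 / (2 * real p) + real j / real p"

definition sample :: "nat \<Rightarrow> (real \<Rightarrow> real) \<Rightarrow> real vec" where
  "sample p f = vec p (\<lambda>j. f (knot p j))"

definition poly_space :: "nat \<Rightarrow> nat \<Rightarrow> real vec set" where
  "poly_space m p = {vec p (\<lambda>j. \<Sum>l<m. \<theta> l * knot p j ^ l) | \<theta> :: nat \<Rightarrow> real. True}"

definition orth_projection :: "nat \<Rightarrow> real vec set \<Rightarrow> real mat" where
  "orth_projection p V = (THE P. P \<in> carrier_mat p p \<and> transpose_mat P = P \<and> P * P = P \<and>
     (\<lambda>w. P *\<^sub>v w) ` carrier_vec p = V)"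

definition P_mat :: "nat \<Rightarrow> nat \<Rightarrow> real mat" where
  "P_mat m p = orth_projection p (poly_space m p)"

text \<open>Natural splines of order \<open>2 * m\<close> with knots \<open>knot p 0, \<dots>, knot p (p - 1)\<close>, for
  \<open>m \<ge> 1\<close>.\<close>

definition natural_spline :: "nat \<Rightarrow> nat \<Rightarrow> (real \<Rightarrow> real) \<Rightarrow> bool" where
  "natural_spline m p s \<longleftrightarrow>
     (\<forall>j. Suc j < p \<longrightarrow> (\<exists>u :: real poly. degree u \<le> 2 * m - 1 \<and>
        (\<forall>t\<in>{knot p j..knot p (Suc j)}. s t = poly u t))) \<and>
     times_cont_differentiable (2 * m - 2) s \<and>
     (\<exists>u :: real poly. degree u \<le> m - 1 \<and> (\<forall>t\<in>{0..knot p 0}. s t = poly u t)) \<and>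
     (\<exists>u :: real poly. degree u \<le> m - 1 \<and> (\<forall>t\<in>{knot p (p - 1)..1}. s t = poly u t))"

text \<open>The interpolating spline lives on \<open>[0,1]\<close> only; requiring it to be extensional makes
  it unique as a function on the reals.\<close>

definition interp_spline :: "nat \<Rightarrow> nat \<Rightarrow> real vec \<Rightarrow> real \<Rightarrow> real" where
  "interp_spline m p w = (THE s. s \<in> extensional {0..1} \<and> natural_spline m p s \<and>
     (\<forall>j<p. s (knot p j) = w $ j))"

text \<open>For \<open>m = 1\<close> the derivative of the spline does not exist at the knots; its arbitrary
  values there do not affect the integral.\<close>

definition A_star :: "nat \<Rightarrow> nat \<Rightarrow> real mat" where
  "A_star m p = (THE A. A \<in> carrier_mat p p \<and> transpose_mat A = A \<and>
     (\<forall>w\<in>carrier_vec p.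
        w \<bullet> (A *\<^sub>v w) = (LBINT t:{0..1}. (nderiv m (interp_spline m p w) t)\<^sup>2)))"

definition A_mat :: "nat \<Rightarrow> nat \<Rightarrow> real mat" where
  "A_mat m p = P_mat m p + real p \<cdot>\<^sub>m A_star m p"

section \<open>Ordered eigenvalues\<close>

text \<open>Real eigenvalues with algebraic multiplicity; the position \<open>j\<close> is counted from \<open>1\<close>.
  Both functions are only applied to real symmetric matrices, which have a full set of real
  eigenvalues.\<close>

definition eigenvalue_asc :: "real mat \<Rightarrow> nat \<Rightarrow> real" where
  "eigenvalue_asc A j = sorted_list_of_multiset (proots (char_poly A)) ! (j - 1)"

definition eigenvalue_desc :: "real mat \<Rightarrow> nat \<Rightarrow> real" where
  "eigenvalue_desc A j = rev (sorted_list_of_multiset (proots (char_poly A))) ! (j - 1)"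

section \<open>The estimator\<close>

text \<open>Throughout, \<open>x i\<close> is the curve and \<open>y i\<close> the response of individual \<open>i < n\<close>.\<close>

definition avg :: "nat \<Rightarrow> (nat \<Rightarrow> real) \<Rightarrow> real" where
  "avg n a = (\<Sum>i<n. a i) / real n"

definition X_mat :: "nat \<Rightarrow> nat \<Rightarrow> (nat \<Rightarrow> real \<Rightarrow> real) \<Rightarrow> real mat" where
  "X_mat n p x = mat n p (\<lambda>(i, j). x i (knot p j) - avg n (\<lambda>i'. x i' (knot p j)))"

definition Y_vec :: "nat \<Rightarrow> (nat \<Rightarrow> real) \<Rightarrow> real vec" where
  "Y_vec n y = vec n (\<lambda>i. y i - avg n y)"

definition gram :: "nat \<Rightarrow> nat \<Rightarrow> (nat \<Rightarrow> real \<Rightarrow> real) \<Rightarrow> real mat" where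
  "gram n p x = (1 / (real n * real p)) \<cdot>\<^sub>m (transpose_mat (X_mat n p x) * X_mat n p x)"

definition alpha_hat ::
  "nat \<Rightarrow> nat \<Rightarrow> nat \<Rightarrow> real \<Rightarrow> (nat \<Rightarrow> real \<Rightarrow> real) \<Rightarrow> (nat \<Rightarrow> real) \<Rightarrow> real vec" where
  "alpha_hat m n p \<rho> x y = (1 / real n) \<cdot>\<^sub>v
     (the (mat_inverse (gram n p x + \<rho> \<cdot>\<^sub>m A_mat m p)) *\<^sub>v
       (transpose_mat (X_mat n p x) *\<^sub>v Y_vec n y))"

text \<open>The square of the semi-norm.\<close>

definition Gamma_sq :: "nat \<Rightarrow> nat \<Rightarrow> (nat \<Rightarrow> real \<Rightarrow> real) \<Rightarrow> real vec \<Rightarrow> real" where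
  "Gamma_sq n p x u = (1 / real p) * (u \<bullet> (gram n p x *\<^sub>v u))"

definition disc_error :: "nat \<Rightarrow> (real \<Rightarrow> real) \<Rightarrow> (real \<Rightarrow> real) \<Rightarrow> real" where
  "disc_error p \<alpha> f =
     (LBINT t:{0..1}. \<alpha> t * f t) - (1 / real p) * (\<Sum>j<p. \<alpha> (knot p j) * f (knot p j))"

definition disc_variation ::
  "nat \<Rightarrow> nat \<Rightarrow> (real \<Rightarrow> real) \<Rightarrow> (nat \<Rightarrow> real \<Rightarrow> real) \<Rightarrow> real" where
  "disc_variation n p \<alpha> x =
     (\<Sum>i<n. (disc_error p \<alpha> (x i) - avg n (\<lambda>i'. disc_error p \<alpha> (x i')))\<^sup>2)"

text \<open>The smallest integer strictly larger than \<open>r > 0\<close>.\<close>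

definition next_int :: "real \<Rightarrow> nat" where
  "next_int r = nat (\<lfloor>r\<rfloor> + 1)"

section \<open>The model\<close>

text \<open>Random functions are jointly measurable processes on \<open>[0,1]\<close>; the distribution of a
  random function, and the information carried by it, refer to the product sigma algebra on
  \<open>\<real>\<^bsup>[0,1]\<^esup>\<close>.\<close>

definition curves :: "nat \<Rightarrow> (nat \<Rightarrow> 'w \<Rightarrow> real \<Rightarrow> real) \<Rightarrow> 'w \<Rightarrow> nat \<times> real \<Rightarrow> real" where
  "curves n X \<omega> = (\<lambda>a\<in>{..<n} \<times> {0..1}. X (fst a) \<omega> (snd a))"

definition curves_algebra :: "'w measure \<Rightarrow> nat \<Rightarrow> (nat \<Rightarrow> 'w \<Rightarrow> real \<Rightarrow> real) \<Rightarrow> 'w measure" where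
  "curves_algebra M n X =
     vimage_algebra (space M) (curves n X) (Pi\<^sub>M ({..<n} \<times> {0..1}) (\<lambda>_. borel))"

locale functional_linear_model = prob_space M
  for M :: "'w measure" +
  fixes n :: nat
    and X :: "nat \<Rightarrow> 'w \<Rightarrow> real \<Rightarrow> real"
    and \<epsilon> :: "nat \<Rightarrow> 'w \<Rightarrow> real"
    and \<sigma> :: real
  assumes X_measurable: "\<And>i. i < n \<Longrightarrow>
      (\<lambda>(\<omega>, t). X i \<omega> t) \<in> borel_measurable (M \<Otimes>\<^sub>M restrict_space borel {0..1})"
    and X_identically_distributed: "\<And>i j. i < n \<Longrightarrow> j < n \<Longrightarrow>
      distr M (Pi\<^sub>M {0..1} (\<lambda>_. borel)) (\<lambda>\<omega>. \<lambda>t\<in>{0..1}. X i \<omega> t) =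
      distr M (Pi\<^sub>M {0..1} (\<lambda>_. borel)) (\<lambda>\<omega>. \<lambda>t\<in>{0..1}. X j \<omega> t)"
    and X_second_moment: "\<And>i. i < n \<Longrightarrow>
      (\<integral>\<^sup>+\<omega>. (\<integral>\<^sup>+t\<in>{0..1}. ennreal ((X i \<omega> t)\<^sup>2) \<partial>lborel) \<partial>M) < \<infinity>"
    and \<epsilon>_independent: "indep_vars (\<lambda>_. borel) \<epsilon> {..<n}"
    and \<epsilon>_identically_distributed: "\<And>i j. i < n \<Longrightarrow> j < n \<Longrightarrow>
      distr M borel (\<epsilon> i) = distr M borel (\<epsilon> j)"
    and \<epsilon>_square_integrable: "\<And>i. i < n \<Longrightarrow> integrable M (\<lambda>\<omega>. (\<epsilon> i \<omega>)\<^sup>2)"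
    and \<epsilon>_mean: "\<And>i. i < n \<Longrightarrow> expectation (\<epsilon> i) = 0"
    and \<epsilon>_variance: "\<And>i. i < n \<Longrightarrow> expectation (\<lambda>\<omega>. (\<epsilon> i \<omega>)\<^sup>2) = \<sigma>\<^sup>2"
    and \<epsilon>_independent_of_X: "indep_set
      (sets (vimage_algebra (space M) (\<lambda>\<omega>. \<lambda>i\<in>{..<n}. \<epsilon> i \<omega>) (Pi\<^sub>M {..<n} (\<lambda>_. borel))))
      (sets (curves_algebra M n X))"

definition response ::
  "real \<Rightarrow> (real \<Rightarrow> real) \<Rightarrow> (nat \<Rightarrow> 'w \<Rightarrow> real \<Rightarrow> real) \<Rightarrow> (nat \<Rightarrow> 'w \<Rightarrow> real) \<Rightarrow> 'w \<Rightarrow> nat \<Rightarrow> real"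
  where
  "response \<alpha>\<^sub>0 \<alpha> X \<epsilon> \<omega> i = \<alpha>\<^sub>0 + (LBINT t:{0..1}. \<alpha> t * X i \<omega> t) + \<epsilon> i \<omega>"

definition cond_mean ::
  "'w measure \<Rightarrow> nat \<Rightarrow> (nat \<Rightarrow> 'w \<Rightarrow> real \<Rightarrow> real) \<Rightarrow> ('w \<Rightarrow> real) \<Rightarrow> 'w \<Rightarrow> real" where
  "cond_mean M n X f = real_cond_exp M (curves_algebra M n X) f"

definition cond_mean_vec ::
  "'w measure \<Rightarrow> nat \<Rightarrow> (nat \<Rightarrow> 'w \<Rightarrow> real \<Rightarrow> real) \<Rightarrow> nat \<Rightarrow> ('w \<Rightarrow> real vec) \<Rightarrow> 'w \<Rightarrow> real vec" where
  "cond_mean_vec M n X p Z \<omega> = vec p (\<lambda>j. cond_mean M n X (\<lambda>\<omega>'. Z \<omega>' $ j) \<omega>)"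

definition mean_vec :: "'w measure \<Rightarrow> nat \<Rightarrow> ('w \<Rightarrow> real vec) \<Rightarrow> real vec" where
  "mean_vec M p Z = vec p (\<lambda>j. \<integral>\<omega>. Z \<omega> $ j \<partial>M)"

end

theory Submission
  imports Defs
begin

text \<open>The estimator is a ridge estimator with the penalty matrix \<open>A_mat\<close>, and it is linear in the
  responses. For a given design it is the sum of its mean, which is the estimator computed from the
  noiseless signal, and of a linear combination of the errors.

  The mean minimizes a penalized least squares functional. Comparing it with the vector of
  true values of \<open>\<alpha>\<close> (\<open>bias_bound\<close>) leaves the discretization errors and \<open>\<rho>\<close> times the penalty of
  the true values. The latter is at most the projection term plus the energy of \<open>\<alpha>\<close>, because a
  natural spline has the smallest energy among the functions with given values at the knots
  (\<open>sample_penalty_le\<close>).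

  For the variance, let \<open>G\<close> be the Gram matrix, \<open>A\<close> the penalty matrix and \<open>B = G + \<rho> A\<close>. The mean
  squared deviation is \<open>\<sigma>\<^sup>2 / n\<close> times the trace of the square of \<open>B^{-1} G\<close>, hence at most
  \<open>\<sigma>\<^sup>2 / n\<close> times the trace of \<open>B^{-1} G\<close> (\<open>sum_influence_form_le_trace\<close>). This effective
  dimension is counted in \<open>ridge_trace_bound\<close>: the \<open>k\<close> leading directions of \<open>G\<close> and the \<open>m + k\<close> weakly penalized
  directions of \<open>A\<close> contribute at most 1 each, and in the other directions the tail of the spectrum
  of \<open>G\<close> is divided by \<open>\<rho>\<close> times an eigenvalue of \<open>A\<close>. The growth of these eigenvalues and the
  choice of \<open>k\<close> turn the quotient into a multiple of \<open>k\<close> (\<open>ridge_trace_le\<close>).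

  The penalty is defined by natural spline interpolation. Every natural spline is a
  polynomial plus truncated powers whose coefficients have vanishing moments
  (\<open>natural_spline_explicit\<close>), and for such splines Taylor's formula gives a duality
  (\<open>spline_energy_pairing\<close>): the pairing of the top derivatives of the spline and of another function
  is a combination of the values of that function at the knots. Unique interpolation, the
  existence and symmetry of the penalty matrix, its kernel and the minimality of the energy all
  follow from this duality.

  For random curves, the weights of the errors are functions of the curves that are bounded
  uniformly (\<open>influence_bounded\<close>, \<open>influence_form_bounded\<close>), so they can be taken out of conditional
  expectations, and the errors are independent of the curves. The signal is an integral over time
  and is not evidently measurable for the algebra generated by the curves, but it agrees almost
  surely with its conditional expectation (\<open>real_cond_exp_parametric_integral\<close>). Both parts of the
  theorem thus reduce to the same bounds for a fixed design.\<close>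

section \<open>Spectral theorem for real symmetric matrices\<close>

lemma symmetric_scalar_prod:
  fixes A :: "real mat"
  assumes "A \<in> carrier_mat n n" "transpose_mat A = A" "v \<in> carrier_vec n" "w \<in> carrier_vec n"
  shows "v \<bullet> (A *\<^sub>v w) = w \<bullet> (A *\<^sub>v v)"
  using transpose_vec_mult_scalar[of A n n w v] assms comm_scalar_prod[of "A *\<^sub>v v" n w] by auto

lemma scalar_prod_self_nonneg: "0 \<le> v \<bullet> (v :: real vec)"
  by (auto simp: scalar_prod_def intro: sum_nonneg)

lemma scalar_prod_self_eq_0_iff:
  assumes "v \<in> carrier_vec n" shows "v \<bullet> (v :: real vec) = 0 \<longleftrightarrow> v = 0\<^sub>v n"
  using conjugate_square_eq_0_vec[of v n] assms by (simp add: conjugate_vec_def)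

text \<open>Over the complex numbers the characteristic polynomial splits, and an eigenvalue of a real
  symmetric matrix is real, as one sees from the real and imaginary parts of an eigenvector.\<close>

lemma char_poly_symmetric_splits:
  fixes A :: "real mat"
  assumes A: "A \<in> carrier_mat n n" and sym: "transpose_mat A = A"
  shows "char_poly A = (\<Prod>e\<leftarrow>sorted_list_of_multiset (proots (char_poly A)). [:- e, 1:])"
proof -
  let ?A = "map_mat complex_of_real A"
  have A': "?A \<in> carrier_mat n n" using A by auto
  from char_poly_factorized[OF A'] obtain as where as: "char_poly ?A = (\<Prod>a\<leftarrow>as. [:- a, 1:])" by blast
  have real: "complex_of_real (Re a) = a" if "a \<in> set as" for a
  proof -
    have "poly (char_poly ?A) a = 0" unfolding as using that
      by (induct as) auto
    then obtain v where v: "v \<in> carrier_vec n" "v \<noteq> 0\<^sub>v n" "?A *\<^sub>v v = a \<cdot>\<^sub>v v"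
      using eigenvalue_root_char_poly[OF A', of a] A unfolding eigenvalue_def eigenvector_def by auto
    define x where "x = map_vec Re v"
    define y where "y = map_vec Im v"
    have xy: "x \<in> carrier_vec n" "y \<in> carrier_vec n" using v unfolding x_def y_def by auto
    have comp: "(\<Sum>j<n. complex_of_real (A $$ (i, j)) * v $ j) = a * v $ i" if "i < n" for i
      using arg_cong[OF v(3), of "\<lambda>u. u $ i"] that A v(1)
      by (simp add: scalar_prod_def atLeast0LessThan)
    have Ax: "A *\<^sub>v x = Re a \<cdot>\<^sub>v x - Im a \<cdot>\<^sub>v y"
    proof (rule eq_vecI)
      fix i assume "i < dim_vec (Re a \<cdot>\<^sub>v x - Im a \<cdot>\<^sub>v y)"
      then have i: "i < n" using xy by simp
      show "(A *\<^sub>v x) $ i = (Re a \<cdot>\<^sub>v x - Im a \<cdot>\<^sub>v y) $ i"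
        using arg_cong[OF comp[OF i], of Re] i A v(1)
        by (simp add: scalar_prod_def atLeast0LessThan x_def y_def)
    qed (use A xy in auto)
    have Ay: "A *\<^sub>v y = Re a \<cdot>\<^sub>v y + Im a \<cdot>\<^sub>v x"
    proof (rule eq_vecI)
      fix i assume "i < dim_vec (Re a \<cdot>\<^sub>v y + Im a \<cdot>\<^sub>v x)"
      then have i: "i < n" using xy by simp
      show "(A *\<^sub>v y) $ i = (Re a \<cdot>\<^sub>v y + Im a \<cdot>\<^sub>v x) $ i"
        using arg_cong[OF comp[OF i], of Im] i A v(1)
        by (simp add: scalar_prod_def atLeast0LessThan x_def y_def)
    qed (use A xy in auto)
    \<comment> \<open>Pairing the real part of the eigenvalue equation with \<open>y\<close> and the imaginary part
      with \<open>x\<close> makes the real parts cancel and leaves \<open>Im a * (|x|^2 + |y|^2) = 0\<close>.\<close>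
    have "x \<bullet> (A *\<^sub>v y) = y \<bullet> (A *\<^sub>v x)" by (rule symmetric_scalar_prod[OF A sym xy])
    then have "Im a * (x \<bullet> x + y \<bullet> y) = 0"
      using xy unfolding Ax Ay
      by (simp add: scalar_prod_add_distrib[of _ n] scalar_prod_minus_distrib[of _ n]
          comm_scalar_prod[of y n x] algebra_simps)
    moreover have "x \<bullet> x + y \<bullet> y \<noteq> 0"
    proof
      assume "x \<bullet> x + y \<bullet> y = 0"
      then have "x \<bullet> x = 0" "y \<bullet> y = 0"
        using scalar_prod_self_nonneg[of x] scalar_prod_self_nonneg[of y] by linarith+
      then have x0: "x = 0\<^sub>v n" and y0: "y = 0\<^sub>v n" using scalar_prod_self_eq_0_iff xy by auto
      have "v $ i = 0" if "i < n" for i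
        using arg_cong[OF x0, of "\<lambda>u. u $ i"] arg_cong[OF y0, of "\<lambda>u. u $ i"] that v(1)
        by (auto simp: x_def y_def complex_eq_iff)
      then have "v = 0\<^sub>v n" using v(1) by (intro eq_vecI) auto
      with v(2) show False by simp
    qed
    ultimately show ?thesis by (simp add: complex_eq_iff)
  qed
  interpret mp: map_poly_comm_ring_hom complex_of_real ..
  have "map_poly complex_of_real (char_poly A) = char_poly ?A"
    by (rule of_real_hom.char_poly_hom[OF A, symmetric])
  also have "\<dots> = map_poly complex_of_real (\<Prod>a\<leftarrow>as. [:- Re a, 1:])"
    unfolding as using real
  proof (induct as)
    case (Cons a as)
    have "map_poly complex_of_real ([:- Re a, 1:]) = [:- a, 1:]"
      using Cons(2)[of a] by (simp add: map_poly_pCons)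
    then show ?case using Cons by (simp only: list.map prod_list.Cons
       mp.hom_mult) auto
  qed simp
  finally have hom_eq: "map_poly complex_of_real (char_poly A) = map_poly complex_of_real (\<Prod>a\<leftarrow>as. [:- Re a, 1:])" .
  have "coeff (char_poly A) i = coeff (\<Prod>a\<leftarrow>as. [:- Re a, 1:]) i" for i
    using arg_cong[OF hom_eq, of "\<lambda>q. coeff q i"]
    by (simp only: coeff_map_poly of_real_0 of_real_eq_iff)
  then have eq: "char_poly A = (\<Prod>a\<leftarrow>map Re as. [:- a, 1:])"
    by (intro poly_eqI) (simp add: o_def)
  have roots: "proots (\<Prod>a\<leftarrow>bs. [:- a, 1:]) = mset bs" for bs :: "real list"
  proof (induct bs)
    case (Cons b bs)
    have "(\<Prod>a\<leftarrow>bs. [:- a, 1:]) \<noteq> 0"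
      by (auto simp: prod_list_zero_iff)
    then show ?case using Cons by (simp add: proots_mult del: mult_pCons_left)
  qed simp
  have "(\<Prod>a\<leftarrow>bs. [:- a, 1:]) = (\<Prod>a\<leftarrow>cs. [:- a, 1:])" if "mset bs = mset cs" for bs cs :: "real list"
    using that by (metis mset_map prod_mset_prod_list)
  then show ?thesis unfolding eq roots by (metis mset_sorted_list_of_multiset)
qed

definition diagonal :: "nat \<Rightarrow> (nat \<Rightarrow> real) \<Rightarrow> real mat" where
  "diagonal n d = mat n n (\<lambda>(i, j). if i = j then d i else 0)"

lemma diagonal_carrier [simp]: "diagonal n d \<in> carrier_mat n n"
  by (simp add: diagonal_def)

definition orthonormal_mat :: "nat \<Rightarrow> real mat \<Rightarrow> bool" where
  "orthonormal_mat n Q \<longleftrightarrow>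
     Q \<in> carrier_mat n n \<and> transpose_mat Q * Q = 1\<^sub>m n \<and> Q * transpose_mat Q = 1\<^sub>m n"

text \<open>An orthonormal basis starting with a given unit vector, in the form of a symmetric
  involution; this is what deflation in the spectral theorem needs.\<close>

lemma householder:
  fixes v :: "real vec"
  assumes v: "v \<in> carrier_vec n" "v \<bullet> v = 1" and n: "0 < n"
  obtains H where "H \<in> carrier_mat n n" "transpose_mat H = H" "H * H = 1\<^sub>m n" "col H 0 = v"
proof -
  \<comment> \<open>\<open>H\<close> reflects in the hyperplane orthogonal to \<open>w = v - e\<close>, where \<open>e\<close> is the first unit
    vector. If \<open>v = e\<close>, then \<open>S = 0\<close> and \<open>2 / S = 0\<close>, so that \<open>H\<close> is the identity.\<close>
  define w where "w = (\<lambda>i. v $ i - (if i = 0 then 1 else 0))"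
  define S where "S = (\<Sum>i<n. (w i)\<^sup>2)"
  define H where "H = mat n n (\<lambda>(i, j). (if i = j then 1 else 0) - 2 / S * w i * w j)"
  have vv: "(\<Sum>i<n. (v $ i)\<^sup>2) = 1"
    using v by (simp add: scalar_prod_def atLeast0LessThan power2_eq_square)
  have "S = (\<Sum>i<n. (v $ i)\<^sup>2 + (if i = 0 then 1 - 2 * v $ i else 0))"
    unfolding S_def w_def by (rule sum.cong) (auto simp: power2_eq_square algebra_simps)
  also have "\<dots> = 2 - 2 * v $ 0" using n by (simp add: sum.distrib vv)
  finally have S: "S = 2 - 2 * v $ 0" .
  have w0: "w i = 0" if "S = 0" "i < n" for i
    using that unfolding S_def by (simp add: sum_nonneg_eq_0_iff)
  have H: "H \<in> carrier_mat n n" by (simp add: H_def)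
  have sym: "transpose_mat H = H" unfolding H_def by (rule eq_matI) auto
  have inv: "H * H = 1\<^sub>m n"
  proof (rule eq_matI)
    fix i j assume "i < dim_row (1\<^sub>m n :: real mat)" "j < dim_col (1\<^sub>m n :: real mat)"
    then have ij: "i < n" "j < n" by auto
    have "(H * H) $$ (i, j) = (\<Sum>k<n. ((if i = k then 1 else 0) - 2 / S * w i * w k) *
        ((if k = j then 1 else 0) - 2 / S * w k * w j))"
      using ij by (simp add: H_def scalar_prod_def atLeast0LessThan)
    also have "\<dots> = (\<Sum>k<n. (if k = i then (if i = j then 1 else 0) - 2 / S * w i * w j else 0)
        + (if k = j then - 2 / S * w i * w j else 0) + (2 / S)\<^sup>2 * w i * w j * (w k)\<^sup>2)"
      by (rule sum.cong) (auto simp: algebra_simps power2_eq_square)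
    also have "\<dots> = (if i = j then 1 else 0) - 4 / S * w i * w j + (2 / S)\<^sup>2 * w i * w j * S"
      using ij by (simp add: sum.distrib S_def sum_distrib_left)
    also have "\<dots> = (if i = j then 1 else 0)"
      using ij w0 by (cases "S = 0") (auto simp: power2_eq_square field_simps)
    finally show "(H * H) $$ (i, j) = 1\<^sub>m n $$ (i, j)" using ij by simp
  qed (use H in auto)
  have "col H 0 = v"
  proof (rule eq_vecI)
    fix i assume "i < dim_vec v"
    then have i: "i < n" using v by simp
    have "2 / S * w i * w 0 = - w i"
    proof (cases "S = 0")
      case False
      have "w 0 = - S / 2" by (simp add: w_def S)
      then show ?thesis using False by simp
    qed (use w0 i in auto)
    then have "H $$ (i, 0) = (if i = 0 then 1 else 0) + w i"
      using i n by (simp add: H_def)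
    then show "col H 0 $ i = v $ i" using i n H by (auto simp: w_def)
  qed (use v H in auto)
  with H sym inv show thesis by (rule that)
qed

text \<open>The spectral theorem, by deflation: conjugating with a reflection that maps the first unit
  vector to a unit eigenvector splits off a one-dimensional block. Splitting off the eigenvalues
  in the order of the list \<open>es\<close> makes the diagonal equal to \<open>es\<close>, so that increasing and
  decreasing orderings are both instances.\<close>

theorem symmetric_diagonalization:
  fixes A :: "real mat"
  assumes "A \<in> carrier_mat n n" "transpose_mat A = A" "char_poly A = (\<Prod>e\<leftarrow>es. [:- e, 1:])"
  shows "length es = n \<and> (\<exists>Q. orthonormal_mat n Q \<and> A = Q * diagonal n (\<lambda>i. es ! i) * transpose_mat Q)"
  using assms
proof (induct es arbitrary: n A)
  case Nil
  have "n = 0" using degree_monic_char_poly[OF Nil(1)] Nil(3) by simp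
  then show ?case using Nil(1)
    by (auto simp: orthonormal_mat_def intro!: exI[of _ "1\<^sub>m 0"])
next
  case (Cons e es n A)
  note A = Cons(2)
  have cp: "char_poly A = [:-e, 1:] * (\<Prod>e\<leftarrow>es. [:- e, 1:])" using Cons(4) by simp
  have "monic (\<Prod>e\<leftarrow>es. [:- e, 1:])" by (rule monic_prod_list) auto
  then have "degree (char_poly A) = Suc (degree (\<Prod>e\<leftarrow>es. [:- e, 1:]))"
    unfolding cp by (subst degree_mult_eq) auto
  with degree_monic_char_poly[OF A] have n: "0 < n" by auto
  define k where "k = n - 1"
  have nk: "n = 1 + k" using n by (simp add: k_def)
  have "poly (char_poly A) e = 0" unfolding cp by simp
  then obtain u where u: "u \<in> carrier_vec n" "u \<noteq> 0\<^sub>v n" "A *\<^sub>v u = e \<cdot>\<^sub>v u"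
    using eigenvalue_root_char_poly[OF A, of e] A unfolding eigenvalue_def eigenvector_def by auto
  define v where "v = (1 / sqrt (u \<bullet> u)) \<cdot>\<^sub>v u"
  have uu: "u \<bullet> u > 0"
    using u scalar_prod_self_eq_0_iff[of u n] scalar_prod_self_nonneg[of u] by linarith
  have v: "v \<in> carrier_vec n" "v \<bullet> v = 1" "A *\<^sub>v v = e \<cdot>\<^sub>v v"
    using u uu A by (auto simp: v_def mult_mat_vec[of A n n] smult_smult_assoc mult.commute)
  obtain H where H: "H \<in> carrier_mat n n" "transpose_mat H = H" "H * H = 1\<^sub>m n" "col H 0 = v"
    using householder[OF v(1,2) n] .
  define B where "B = H * A * H"
  have B: "B \<in> carrier_mat n n" using H A by (simp add: B_def)
  have Bsym: "transpose_mat B = B"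
    unfolding B_def using H A Cons(3)
    by (simp add: transpose_mult[of _ n n _ n] assoc_mult_mat[of _ n n _ n _ n] mult_carrier_mat[of _ n n _ n])
  have HBH: "H * B * H = A"
  proof -
    have "H * B * H = (H * H) * A * (H * H)"
      using H(1) A unfolding B_def by (simp add: assoc_mult_mat[of _ n n _ n _ n] mult_carrier_mat[of _ n n _ n])
    then show ?thesis using H A by simp
  qed
  have "col B 0 = H *\<^sub>v (A *\<^sub>v v)"
    unfolding B_def using H(1,4) A n v(1) col_mult2[of "H * A" n n H n 0] assoc_mult_mat_vec[of H n n A n v]
    by simp
  also have "\<dots> = e \<cdot>\<^sub>v (H *\<^sub>v col H 0)" using v(3) H v(1) by (simp add: mult_mat_vec[of _ n n])
  also have "H *\<^sub>v col H 0 = col (H * H) 0" using H(1) n col_mult2[of H n n H n 0] by simp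
  finally have colB: "col B 0 = e \<cdot>\<^sub>v unit_vec n 0" using H(3) n by simp
  have B0: "B $$ (i, 0) = (if i = 0 then e else 0)" if "i < n" for i
  proof -
    have "B $$ (i, 0) = col B 0 $ i" using that B n by simp
    then show ?thesis unfolding colB using that by simp
  qed
  define D where "D = mat k k (\<lambda>(i, j). B $$ (Suc i, Suc j))"
  have D: "D \<in> carrier_mat k k" by (simp add: D_def)
  have symB: "B $$ (i, j) = B $$ (j, i)" if "i < n" "j < n" for i j
    using arg_cong[OF Bsym, of "\<lambda>M. M $$ (i, j)"] that B by auto
  have Dsym: "transpose_mat D = D"
    unfolding D_def by (rule eq_matI) (auto intro: symB simp: nk)
  define E where "E = mat 1 1 (\<lambda>_. e)"
  have E: "E \<in> carrier_mat 1 1" by (simp add: E_def)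
  \<comment> \<open>The first column of \<open>B\<close> is \<open>e\<close> times the first unit vector, and \<open>B\<close> is symmetric.\<close>
  have Bblock: "B = four_block_mat E (0\<^sub>m 1 k) (0\<^sub>m k 1) D"
  proof (rule eq_matI)
    fix i j assume "i < dim_row (four_block_mat E (0\<^sub>m 1 k) (0\<^sub>m k 1) D)"
      "j < dim_col (four_block_mat E (0\<^sub>m 1 k) (0\<^sub>m k 1) D)"
    then have ij: "i < n" "j < n" using D E by (auto simp: nk)
    have "B $$ (0, j) = (if j = 0 then e else 0)" using symB[OF n ij(2)] B0[OF ij(2)] by simp
    then show "B $$ (i, j) = four_block_mat E (0\<^sub>m 1 k) (0\<^sub>m k 1) D $$ (i, j)"
      using ij B0[OF ij(1)] D E by (auto simp: nk E_def D_def less_Suc_eq_0_disj)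
  qed (use B D E nk in auto)
  have "similar_mat B A"
    by (rule similar_matI[of _ _ H H n]) (use A B H in \<open>auto simp: B_def\<close>)
  then have "char_poly A = char_poly B" using char_poly_similar by metis
  also have "\<dots> = char_poly E * char_poly D"
    unfolding Bblock by (rule char_poly_four_block_zeros_col[OF E _ D]) simp
  also have "char_poly E = [:- e, 1:]"
    by (simp add: E_def char_poly_defs det_def sign_def)
  finally have "char_poly D = (\<Prod>e\<leftarrow>es. [:- e, 1:])"
    unfolding cp by (metis mult_cancel_left pCons_eq_0_iff zero_neq_one)
  from Cons(1)[OF D Dsym this] obtain P where len: "length es = k" and P: "orthonormal_mat k P"
    and DP: "D = P * diagonal k (\<lambda>i. es ! i) * transpose_mat P" by blast
  have Pc: "P \<in> carrier_mat k k" and PP: "transpose_mat P * P = 1\<^sub>m k" "P * transpose_mat P = 1\<^sub>m k"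
    using P by (auto simp: orthonormal_mat_def)
  define R where "R = four_block_mat (1\<^sub>m 1) (0\<^sub>m 1 k) (0\<^sub>m k 1) P"
  have R: "R \<in> carrier_mat n n" using four_block_carrier_mat[OF one_carrier_mat[of 1] Pc] unfolding R_def nk .
  have RT: "transpose_mat R = four_block_mat (1\<^sub>m 1) (0\<^sub>m 1 k) (0\<^sub>m k 1) (transpose_mat P)"
    unfolding R_def using Pc by (subst transpose_four_block_mat) auto
  have one: "four_block_mat (1\<^sub>m 1) (0\<^sub>m 1 k) (0\<^sub>m k 1) (1\<^sub>m k) = (1\<^sub>m n :: real mat)"
    by (simp add: nk)
  have bd: "four_block_mat F (0\<^sub>m 1 k) (0\<^sub>m k 1) M * four_block_mat F' (0\<^sub>m 1 k) (0\<^sub>m k 1) N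
      = four_block_mat (F * F') (0\<^sub>m 1 k) (0\<^sub>m k 1) (M * N)"
    if c: "F \<in> carrier_mat 1 1" "F' \<in> carrier_mat 1 1" "M \<in> carrier_mat k k" "N \<in> carrier_mat k k"
    for F F' M N :: "real mat"
  proof -
    have "F * F' \<in> carrier_mat 1 1" "M * N \<in> carrier_mat k k" using c by auto
    then show ?thesis
      unfolding mult_four_block_mat[OF c(1) zero_carrier_mat zero_carrier_mat c(3) c(2)
        zero_carrier_mat zero_carrier_mat c(4)] using c by simp
  qed
  have RR: "transpose_mat R * R = 1\<^sub>m n" "R * transpose_mat R = 1\<^sub>m n"
    unfolding RT unfolding R_def using Pc PP one by (subst bd; simp)+
  have dg: "diagonal n (\<lambda>i. (e # es) ! i) = four_block_mat E (0\<^sub>m 1 k) (0\<^sub>m k 1) (diagonal k (\<lambda>i. es ! i))"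
    by (rule eq_matI) (auto simp: diagonal_def E_def nk less_Suc_eq_0_disj)
  have BR: "B = R * diagonal n (\<lambda>i. (e # es) ! i) * transpose_mat R"
  proof -
    have RD: "R * diagonal n (\<lambda>i. (e # es) ! i) =
        four_block_mat E (0\<^sub>m 1 k) (0\<^sub>m k 1) (P * diagonal k (\<lambda>i. es ! i))"
      unfolding dg unfolding R_def using Pc E by (subst bd) auto
    show ?thesis unfolding RT Bblock DP RD using Pc E by (subst bd) auto
  qed
  define Q where "Q = H * R"
  have Q: "Q \<in> carrier_mat n n" using H R by (simp add: Q_def)
  have QT: "transpose_mat Q = transpose_mat R * H"
    unfolding Q_def using H R by (simp add: transpose_mult[of _ n n _ n])
  have "transpose_mat Q * Q = transpose_mat R * (H * H) * R"
    unfolding QT using H(1) R unfolding Q_def by (simp add: assoc_mult_mat[of _ n n _ n _ n] mult_carrier_mat[of _ n n _ n])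
  moreover have "Q * transpose_mat Q = H * (R * transpose_mat R) * H"
    unfolding QT using H(1) R unfolding Q_def by (simp add: assoc_mult_mat[of _ n n _ n _ n] mult_carrier_mat[of _ n n _ n])
  moreover have "A = Q * diagonal n (\<lambda>i. (e # es) ! i) * transpose_mat Q"
  proof -
    have "A = H * (R * diagonal n (\<lambda>i. (e # es) ! i) * transpose_mat R) * H"
      using HBH BR by simp
    also have "\<dots> = Q * diagonal n (\<lambda>i. (e # es) ! i) * transpose_mat Q"
      unfolding QT using H(1) R unfolding Q_def by (simp add: assoc_mult_mat[of _ n n _ n _ n] mult_carrier_mat[of _ n n _ n])
    finally show ?thesis .
  qed
  ultimately have "orthonormal_mat n Q \<and> A = Q * diagonal n (\<lambda>i. (e # es) ! i) * transpose_mat Q"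
    using H R RR Q by (auto simp: orthonormal_mat_def)
  then show ?case using len nk by auto
qed

section \<open>Traces and quadratic forms\<close>

definition mat_trace :: "real mat \<Rightarrow> real" where
  "mat_trace A = (\<Sum>i<dim_row A. A $$ (i, i))"

lemma mat_trace_comm:
  assumes "A \<in> carrier_mat n m" "B \<in> carrier_mat m n"
  shows "mat_trace (A * B) = mat_trace (B * A)"
proof -
  have "mat_trace (A * B) = (\<Sum>i<n. \<Sum>j<m. A $$ (i, j) * B $$ (j, i))"
    using assms by (simp add: mat_trace_def scalar_prod_def atLeast0LessThan)
  also have "\<dots> = (\<Sum>j<m. \<Sum>i<n. B $$ (j, i) * A $$ (i, j))"
    by (subst sum.swap) (simp add: mult.commute)
  also have "\<dots> = mat_trace (B * A)"
    using assms by (simp add: mat_trace_def scalar_prod_def atLeast0LessThan)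
  finally show ?thesis .
qed

lemma entry_as_scalar_prod:
  assumes "U \<in> carrier_mat n m" "M \<in> carrier_mat n n" "i < m" "j < m"
  shows "(transpose_mat U * M * U) $$ (i, j) = col U i \<bullet> (M *\<^sub>v col (U :: real mat) j)"
proof -
  have "(transpose_mat U * M * U) $$ (i, j) = (transpose_mat U * (M * U)) $$ (i, j)"
    using assms by (simp add: assoc_mult_mat[of _ m n _ n _ m])
  also have "\<dots> = col U i \<bullet> (M *\<^sub>v col U j)"
    using assms col_mult2[of M n n U m j] by simp
  finally show ?thesis .
qed

lemma diagonal_dims [simp]: "dim_row (diagonal n d) = n" "dim_col (diagonal n d) = n"
  by (simp_all add: diagonal_def)

lemma smult_mat_mult_vec:
  assumes "A \<in> carrier_mat n m" "v \<in> carrier_vec m"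
  shows "(c \<cdot>\<^sub>m A) *\<^sub>v v = c \<cdot>\<^sub>v (A *\<^sub>v (v :: real vec))"
  using assms by (intro eq_vecI) auto

lemma mult_diagonal_entry:
  assumes "A \<in> carrier_mat n n" "i < n" "j < n"
  shows "(A * diagonal n d) $$ (i, j) = A $$ (i, j) * d j"
proof -
  have "(A * diagonal n d) $$ (i, j) = (\<Sum>k<n. if k = j then A $$ (i, k) * d k else 0)"
    using assms by (simp add: scalar_prod_def atLeast0LessThan diagonal_def if_distrib cong: if_cong)
  then show ?thesis using assms by simp
qed

lemma mat_trace_mult_diagonalized:
  assumes M: "M \<in> carrier_mat n n" and U: "orthonormal_mat n U"
  shows "mat_trace (M * (U * diagonal n d * transpose_mat U)) = (\<Sum>i<n. d i * (col U i \<bullet> (M *\<^sub>v col U i)))"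
proof -
  have Uc: "U \<in> carrier_mat n n" using U by (simp add: orthonormal_mat_def)
  have "mat_trace (M * (U * diagonal n d * transpose_mat U)) = mat_trace ((M * U * diagonal n d) * transpose_mat U)"
    using M Uc diagonal_carrier[of n d] by (simp add: assoc_mult_mat[of _ n n _ n _ n] mult_carrier_mat[of _ n n _ n])
  also have "\<dots> = mat_trace (transpose_mat U * (M * U * diagonal n d))"
    by (rule mat_trace_comm[of _ n n]) (use M Uc in \<open>auto intro!: mult_carrier_mat[of _ n n]\<close>)
  also have "\<dots> = mat_trace (transpose_mat U * M * U * diagonal n d)"
    using M Uc diagonal_carrier[of n d] by (simp add: assoc_mult_mat[of _ n n _ n _ n] mult_carrier_mat[of _ n n _ n])
  also have "\<dots> = (\<Sum>i<n. (transpose_mat U * M * U * diagonal n d) $$ (i, i))"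
    using Uc by (simp add: mat_trace_def)
  also have "\<dots> = (\<Sum>i<n. (transpose_mat U * M * U) $$ (i, i) * d i)"
    using M Uc by (intro sum.cong refl mult_diagonal_entry) auto
  also have "\<dots> = (\<Sum>i<n. d i * (col U i \<bullet> (M *\<^sub>v col U i)))"
    using M Uc by (intro sum.cong refl) (simp only: entry_as_scalar_prod[OF Uc M] lessThan_iff mult.commute)
  finally show ?thesis .
qed

lemma diagonalized_one:
  assumes U: "orthonormal_mat n U"
  shows "U * diagonal n (\<lambda>_. 1) * transpose_mat U = 1\<^sub>m n"
proof -
  have "diagonal n (\<lambda>_. 1) = 1\<^sub>m n" by (rule eq_matI) (auto simp: diagonal_def)
  moreover have "U * 1\<^sub>m n = U"
    using U right_mult_one_mat[of U n n] by (simp add: orthonormal_mat_def del: right_mult_one_mat)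
  ultimately show ?thesis using U by (simp add: orthonormal_mat_def)
qed

lemma mat_trace_conjugation:
  assumes M: "M \<in> carrier_mat n n" and U: "orthonormal_mat n U"
  shows "mat_trace M = (\<Sum>i<n. col U i \<bullet> (M *\<^sub>v col U i))"
  using mat_trace_mult_diagonalized[OF M U, of "\<lambda>_. 1"] diagonalized_one[OF U] M by simp

lemma col_orthonormal:
  assumes U: "orthonormal_mat n U" and ij: "i < n" "j < n"
  shows "col U i \<bullet> col U j = (if i = j then 1 else 0)"
proof -
  have Uc: "U \<in> carrier_mat n n" and UU: "transpose_mat U * U = 1\<^sub>m n"
    using U by (simp_all add: orthonormal_mat_def)
  have "col U i \<bullet> col U j = (transpose_mat U * U) $$ (i, j)" using Uc ij by simp
  then show ?thesis unfolding UU using ij by simp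
qed

lemma diagonalized_mult_vec:
  assumes U: "orthonormal_mat n U" and i: "i < n"
  shows "(U * diagonal n d * transpose_mat U) *\<^sub>v col U i = d i \<cdot>\<^sub>v col U i"
proof -
  have Uc: "U \<in> carrier_mat n n" using U by (simp add: orthonormal_mat_def)
  have e: "transpose_mat U *\<^sub>v col U i = unit_vec n i"
    using Uc i col_orthonormal[OF U _ i] by (intro eq_vecI) (auto simp: unit_vec_def)
  have "(U * diagonal n d * transpose_mat U) *\<^sub>v col U i = (U * diagonal n d) *\<^sub>v unit_vec n i"
    using Uc i e by (simp add: assoc_mult_mat_vec[of _ n n _ n])
  also have "\<dots> = col (U * diagonal n d) i"
  proof (rule eq_vecI)
    fix j assume "j < dim_vec (col (U * diagonal n d) i)"
    then have j: "j < n" using Uc by simp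
    have "((U * diagonal n d) *\<^sub>v unit_vec n i) $ j = row (U * diagonal n d) j $ i"
      using j i Uc scalar_prod_right_unit[of i n "row (U * diagonal n d) j"] by simp
    then show "((U * diagonal n d) *\<^sub>v unit_vec n i) $ j = col (U * diagonal n d) i $ j"
      using i j Uc carrier_matD[OF diagonal_carrier[of n d]] by (simp del: index_mult_mat(1))
  qed (use Uc in simp)
  also have "\<dots> = d i \<cdot>\<^sub>v col U i"
    using Uc i by (intro eq_vecI) (auto simp: mult_diagonal_entry simp del: index_mult_mat(1))
  finally show ?thesis .
qed

lemma diagonalized_quadratic_form:
  assumes U: "orthonormal_mat n U" and v: "v \<in> carrier_vec n"
  shows "v \<bullet> ((U * diagonal n d * transpose_mat U) *\<^sub>v v) = (\<Sum>i<n. d i * (col U i \<bullet> v)\<^sup>2)"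
proof -
  have Uc: "U \<in> carrier_mat n n" using U by (simp add: orthonormal_mat_def)
  define z where "z = transpose_mat U *\<^sub>v v"
  have z: "z \<in> carrier_vec n" using Uc v by (simp add: z_def)
  have zi: "z $ i = col U i \<bullet> v" if "i < n" for i using that Uc by (simp add: z_def)
  have D: "diagonal n d *\<^sub>v z = vec n (\<lambda>i. d i * z $ i)"
  proof (rule eq_vecI)
    fix i assume "i < dim_vec (vec n (\<lambda>i. d i * z $ i))"
    then have i: "i < n" by simp
    have "(diagonal n d *\<^sub>v z) $ i = (\<Sum>k<n. if k = i then d i * z $ k else 0)"
      using i z unfolding diagonal_def
      by (simp add: scalar_prod_def atLeast0LessThan if_distrib[of "\<lambda>x. x * _"] eq_commute[of i] cong: if_cong)
    then show "(diagonal n d *\<^sub>v z) $ i = vec n (\<lambda>i. d i * z $ i) $ i" using i by simp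
  qed (simp add: diagonal_def)
  have "(U * diagonal n d * transpose_mat U) *\<^sub>v v = U *\<^sub>v (diagonal n d *\<^sub>v z)"
    using Uc v by (simp add: z_def assoc_mult_mat_vec[of _ n n _ n])
  also have "v \<bullet> (U *\<^sub>v (diagonal n d *\<^sub>v z)) = (diagonal n d *\<^sub>v z) \<bullet> z"
    using transpose_vec_mult_scalar[of U n n "diagonal n d *\<^sub>v z" v] Uc v
      comm_scalar_prod[of "diagonal n d *\<^sub>v z" n z] z mult_mat_vec_carrier[OF diagonal_carrier z, of d]
    by (simp add: z_def)
  also have "\<dots> = (\<Sum>i<n. d i * (z $ i)\<^sup>2)"
    unfolding D using z by (simp add: scalar_prod_def atLeast0LessThan power2_eq_square mult.assoc)
  also have "\<dots> = (\<Sum>i<n. d i * (col U i \<bullet> v)\<^sup>2)" by (simp add: zi)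
  finally show ?thesis .
qed

lemma diagonalized_symmetric:
  assumes U: "orthonormal_mat n U"
  shows "U * diagonal n d * transpose_mat U \<in> carrier_mat n n"
    "transpose_mat (U * diagonal n d * transpose_mat U) = U * diagonal n d * transpose_mat U"
proof -
  have Uc: "U \<in> carrier_mat n n" using U by (simp add: orthonormal_mat_def)
  show "U * diagonal n d * transpose_mat U \<in> carrier_mat n n" using Uc by auto
  have "transpose_mat (diagonal n d) = diagonal n d"
    by (rule eq_matI) (auto simp: diagonal_def)
  then show "transpose_mat (U * diagonal n d * transpose_mat U) = U * diagonal n d * transpose_mat U"
    using Uc diagonal_carrier[of n d]
    by (simp add: transpose_mult[of _ n n _ n] assoc_mult_mat[of _ n n _ n _ n] mult_carrier_mat[of _ n n _ n])
qed

lemma orthogonal_coordinates_eqI: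
  assumes Q: "orthonormal_mat n Q" and u: "u \<in> carrier_vec n" and v: "v \<in> carrier_vec n"
    and eq: "\<And>i. i < n \<Longrightarrow> col Q i \<bullet> u = col Q i \<bullet> v"
  shows "u = v"
proof -
  have Qc: "Q \<in> carrier_mat n n" "transpose_mat Q \<in> carrier_mat n n" "Q * transpose_mat Q = 1\<^sub>m n"
    using Q by (auto simp: orthonormal_mat_def)
  have "transpose_mat Q *\<^sub>v u = transpose_mat Q *\<^sub>v v" using Qc eq by (intro eq_vecI) auto
  then have "(Q * transpose_mat Q) *\<^sub>v u = (Q * transpose_mat Q) *\<^sub>v v"
    using assoc_mult_mat_vec[OF Qc(1,2) u] assoc_mult_mat_vec[OF Qc(1,2) v] by simp
  then show ?thesis unfolding Qc(3) using u v by simp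
qed

definition pos_def :: "nat \<Rightarrow> real mat \<Rightarrow> bool" where
  "pos_def n B \<longleftrightarrow> B \<in> carrier_mat n n \<and> transpose_mat B = B \<and>
     (\<forall>v\<in>carrier_vec n. v \<noteq> 0\<^sub>v n \<longrightarrow> 0 < v \<bullet> (B *\<^sub>v v))"

lemma pos_def_nonneg:
  assumes "pos_def n B" "v \<in> carrier_vec n" shows "0 \<le> v \<bullet> (B *\<^sub>v v)"
  using assms by (cases "v = 0\<^sub>v n") (auto simp: pos_def_def less_imp_le)

lemma diagonalized_pos_def:
  assumes Q: "orthonormal_mat n Q" and a: "\<And>i. i < n \<Longrightarrow> 0 < a i"
  shows "pos_def n (Q * diagonal n a * transpose_mat Q)"
  unfolding pos_def_def
proof (intro conjI ballI impI diagonalized_symmetric[OF Q])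
  fix v :: "real vec" assume v: "v \<in> carrier_vec n" "v \<noteq> 0\<^sub>v n"
  have "\<exists>i<n. col Q i \<bullet> v \<noteq> 0"
  proof (rule ccontr)
    assume z: "\<not> ?thesis"
    have "v = 0\<^sub>v n"
    proof (rule orthogonal_coordinates_eqI[OF Q v(1)])
      fix i assume i: "i < n"
      then have "col Q i \<in> carrier_vec n" using Q by (auto simp: orthonormal_mat_def)
      then show "col Q i \<bullet> v = col Q i \<bullet> 0\<^sub>v n" using z i by simp
    qed simp
    with v(2) show False by simp
  qed
  then obtain i where i: "i < n" "col Q i \<bullet> v \<noteq> 0" by blast
  have "0 < a i * (col Q i \<bullet> v)\<^sup>2" using i a by simp
  also have "\<dots> \<le> (\<Sum>i<n. a i * (col Q i \<bullet> v)\<^sup>2)"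
    by (rule member_le_sum) (use i a in \<open>auto intro!: mult_nonneg_nonneg simp: less_imp_le\<close>)
  finally show "0 < v \<bullet> ((Q * diagonal n a * transpose_mat Q) *\<^sub>v v)"
    unfolding diagonalized_quadratic_form[OF Q v(1)] .
qed

lemma pos_def_inverse:
  assumes B: "pos_def n B"
  obtains R where "mat_inverse B = Some R" "R \<in> carrier_mat n n" "B * R = 1\<^sub>m n" "R * B = 1\<^sub>m n"
proof -
  have Bc: "B \<in> carrier_mat n n" using B by (simp add: pos_def_def)
  have "det B \<noteq> 0"
  proof
    assume "det B = 0"
    then obtain v where v: "v \<in> carrier_vec n" "v \<noteq> 0\<^sub>v n" "B *\<^sub>v v = 0\<^sub>v n"
      using det_0_iff_vec_prod_zero[OF Bc] by blast
    then show False using B by (auto simp: pos_def_def)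
  qed
  then have "B \<in> Units (ring_mat TYPE(real) n ())" by (rule det_non_zero_imp_unit[OF Bc])
  then obtain R where R: "mat_inverse B = Some R"
    using mat_inverse(1)[OF Bc, of "()"] by (cases "mat_inverse B") auto
  then show thesis using mat_inverse(2)[OF Bc R] that by blast
qed

lemma inverse_mult_vec:
  assumes "B \<in> carrier_mat n n" "R \<in> carrier_mat n n" "B * R = 1\<^sub>m n" "v \<in> carrier_vec n"
  shows "B *\<^sub>v (R *\<^sub>v v) = (v :: real vec)"
  using assms assoc_mult_mat_vec[of B n n R n v] by simp

lemma quadratic_form_diff:
  assumes B: "B \<in> carrier_mat n n" "transpose_mat B = B"
    and u: "u \<in> carrier_vec n" and w: "w \<in> carrier_vec n"
  shows "(u - w) \<bullet> (B *\<^sub>v (u - w)) = u \<bullet> (B *\<^sub>v u) - 2 * (u \<bullet> (B *\<^sub>v w)) + w \<bullet> (B *\<^sub>v (w :: real vec))"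
proof -
  have "(u - w) \<bullet> (B *\<^sub>v (u - w)) = (u - w) \<bullet> (B *\<^sub>v u) - (u - w) \<bullet> (B *\<^sub>v w)"
    using B u w by (simp add: mult_minus_distrib_mat_vec[of _ n n] scalar_prod_minus_distrib[of _ n])
  also have "\<dots> = u \<bullet> (B *\<^sub>v u) - w \<bullet> (B *\<^sub>v u) - (u \<bullet> (B *\<^sub>v w) - w \<bullet> (B *\<^sub>v w))"
    using B u w by (simp add: minus_scalar_prod_distrib[of _ n])
  finally show ?thesis using symmetric_scalar_prod[OF B u w] by simp
qed

lemma inverse_form_pos:
  assumes B: "pos_def n B" and R: "R \<in> carrier_mat n n" "B * R = 1\<^sub>m n" and v: "v \<in> carrier_vec n"
  shows "v \<bullet> (R *\<^sub>v v) = (R *\<^sub>v v) \<bullet> (B *\<^sub>v (R *\<^sub>v v))"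
  using assms inverse_mult_vec[OF _ R v] comm_scalar_prod[of v n "R *\<^sub>v v"] by (auto simp: pos_def_def)

section \<open>Inverses of positive definite matrices\<close>

text \<open>With \<open>u = R v\<close> and \<open>w = R\<^sub>2 v\<close> the claim is what remains of
  \<open>0 \<le> (u - w) B\<^sub>2 (u - w)\<close> once \<open>u B\<^sub>2 u\<close> has been estimated by \<open>u B u = u v\<close>.\<close>

lemma inverse_antimono:
  assumes B: "pos_def n B" and B2: "pos_def n B\<^sub>2"
    and R: "R \<in> carrier_mat n n" "B * R = 1\<^sub>m n" and R2: "R\<^sub>2 \<in> carrier_mat n n" "B\<^sub>2 * R\<^sub>2 = 1\<^sub>m n"
    and le: "\<And>v. v \<in> carrier_vec n \<Longrightarrow> v \<bullet> (B\<^sub>2 *\<^sub>v v) \<le> v \<bullet> (B *\<^sub>v v)"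
    and v: "v \<in> carrier_vec n"
  shows "v \<bullet> (R *\<^sub>v v) \<le> v \<bullet> (R\<^sub>2 *\<^sub>v v)"
proof -
  define u where "u = R *\<^sub>v v"
  define w where "w = R\<^sub>2 *\<^sub>v v"
  have uw: "u \<in> carrier_vec n" "w \<in> carrier_vec n" using R R2 v by (auto simp: u_def w_def)
  have Bc: "B \<in> carrier_mat n n" "B\<^sub>2 \<in> carrier_mat n n" "transpose_mat B\<^sub>2 = B\<^sub>2"
    using B B2 by (auto simp: pos_def_def)
  have Bu: "B *\<^sub>v u = v" and Bw: "B\<^sub>2 *\<^sub>v w = v"
    unfolding u_def w_def by (rule inverse_mult_vec[OF Bc(1) R v], rule inverse_mult_vec[OF Bc(2) R2 v])
  have "0 \<le> (u - w) \<bullet> (B\<^sub>2 *\<^sub>v (u - w))" using pos_def_nonneg[OF B2] uw by simp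
  also have "\<dots> = u \<bullet> (B\<^sub>2 *\<^sub>v u) - 2 * (u \<bullet> v) + w \<bullet> v"
    using quadratic_form_diff[OF Bc(2,3) uw] Bw by simp
  also have "\<dots> \<le> u \<bullet> v - 2 * (u \<bullet> v) + w \<bullet> v" using le[OF uw(1)] Bu by simp
  finally have "u \<bullet> v \<le> w \<bullet> v" by simp
  then show ?thesis using comm_scalar_prod[OF v uw(1)] comm_scalar_prod[OF v uw(2)]
    by (simp add: u_def w_def)
qed

text \<open>For \<open>s = g R g\<close> the hypothesis at \<open>v = R g\<close> reads \<open>c s\<^sup>2 \<le> s\<close>.\<close>

lemma inverse_rank_one_bound:
  assumes B: "pos_def n B" and R: "R \<in> carrier_mat n n" "B * R = 1\<^sub>m n"
    and g: "g \<in> carrier_vec n"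
    and le: "\<And>v. v \<in> carrier_vec n \<Longrightarrow> c * (g \<bullet> v)\<^sup>2 \<le> v \<bullet> (B *\<^sub>v v)"
  shows "c * (g \<bullet> (R *\<^sub>v g)) \<le> 1"
proof -
  define s where "s = g \<bullet> (R *\<^sub>v g)"
  have u: "R *\<^sub>v g \<in> carrier_vec n" using R g by simp
  have s: "s = (R *\<^sub>v g) \<bullet> (B *\<^sub>v (R *\<^sub>v g))" unfolding s_def by (rule inverse_form_pos[OF B R g])
  then have "0 \<le> s" using pos_def_nonneg[OF B u] by simp
  moreover have "c * s * s \<le> 1 * s" using le[OF u] s unfolding s_def[symmetric] by (simp add: power2_eq_square mult.assoc)
  ultimately show ?thesis unfolding s_def[symmetric]
    by (cases "s = 0") (auto dest: mult_right_le_imp_le)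
qed

text \<open>The Cauchy-Schwarz inequality \<open>1 = (e e)\<^sup>2 \<le> (e B e) (e R e)\<close>, obtained from the
  nonnegativity of the form \<open>B\<close> at \<open>t e - R e\<close>.\<close>

lemma inverse_form_ge:
  assumes B: "pos_def n B" and R: "R \<in> carrier_mat n n" "B * R = 1\<^sub>m n"
    and e: "e \<in> carrier_vec n" "e \<bullet> e = 1"
  shows "1 / (e \<bullet> (B *\<^sub>v e)) \<le> e \<bullet> (R *\<^sub>v e)"
proof -
  have Bc: "B \<in> carrier_mat n n" "transpose_mat B = B" using B by (auto simp: pos_def_def)
  define t where "t = 1 / (e \<bullet> (B *\<^sub>v e))"
  have pos: "0 < e \<bullet> (B *\<^sub>v e)" using B e by (auto simp: pos_def_def)
  define u where "u = R *\<^sub>v e"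
  have u: "u \<in> carrier_vec n" using R e by (simp add: u_def)
  have te: "t \<cdot>\<^sub>v e \<in> carrier_vec n" using e by simp
  have "0 \<le> (t \<cdot>\<^sub>v e - u) \<bullet> (B *\<^sub>v (t \<cdot>\<^sub>v e - u))" using pos_def_nonneg[OF B] u te by simp
  also have "\<dots> = (t \<cdot>\<^sub>v e) \<bullet> (B *\<^sub>v (t \<cdot>\<^sub>v e)) - 2 * ((t \<cdot>\<^sub>v e) \<bullet> e) + u \<bullet> e"
    using quadratic_form_diff[OF Bc te u] inverse_mult_vec[OF Bc(1) R e(1)] by (simp add: u_def)
  also have "\<dots> = t * t * (e \<bullet> (B *\<^sub>v e)) - 2 * t + u \<bullet> e"
    using e Bc by (simp add: mult_mat_vec[of _ n n])
  also have "\<dots> = u \<bullet> e - t" using pos by (simp add: t_def field_simps)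
  finally show ?thesis using comm_scalar_prod[OF e(1) u] by (simp add: t_def u_def)
qed


lemma mat_trace_diagonalized:
  assumes U: "orthonormal_mat n U"
  shows "mat_trace (U * diagonal n d * transpose_mat U) = (\<Sum>i<n. d i)"
  using mat_trace_mult_diagonalized[OF one_carrier_mat U, of d] U diagonalized_symmetric(1)[OF U, of d] col_orthonormal[OF U]
  by (auto simp: orthonormal_mat_def intro!: sum.cong)

lemma pos_def_add_smult:
  assumes G: "G \<in> carrier_mat n n" "transpose_mat G = G" "\<And>v. v \<in> carrier_vec n \<Longrightarrow> 0 \<le> v \<bullet> (G *\<^sub>v v)"
    and A: "pos_def n A" and \<rho>: "0 < \<rho>"
  shows "pos_def n (G + \<rho> \<cdot>\<^sub>m A)"
    "v \<in> carrier_vec n \<Longrightarrow> v \<bullet> ((G + \<rho> \<cdot>\<^sub>m A) *\<^sub>v v) = v \<bullet> (G *\<^sub>v v) + \<rho> * (v \<bullet> (A *\<^sub>v v))"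
proof -
  have Ac: "A \<in> carrier_mat n n" "transpose_mat A = A" using A by (auto simp: pos_def_def)
  have form: "v \<bullet> ((G + \<rho> \<cdot>\<^sub>m A) *\<^sub>v v) = v \<bullet> (G *\<^sub>v v) + \<rho> * (v \<bullet> (A *\<^sub>v v))" if "v \<in> carrier_vec n" for v
  proof -
    have "(\<rho> \<cdot>\<^sub>m A) *\<^sub>v v = \<rho> \<cdot>\<^sub>v (A *\<^sub>v v)"
      by (rule smult_mat_mult_vec[OF Ac(1) that])
    then show ?thesis using that G(1) Ac
      by (simp add: add_mult_distrib_mat_vec[of _ n n] scalar_prod_add_distrib[of _ n])
  qed
  then show "v \<in> carrier_vec n \<Longrightarrow> v \<bullet> ((G + \<rho> \<cdot>\<^sub>m A) *\<^sub>v v) = v \<bullet> (G *\<^sub>v v) + \<rho> * (v \<bullet> (A *\<^sub>v v))" by blast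
  have "transpose_mat (\<rho> \<cdot>\<^sub>m A) = \<rho> \<cdot>\<^sub>m A"
    using Ac(1) arg_cong[OF Ac(2), of "\<lambda>M. \<rho> \<cdot>\<^sub>m M"] by (intro eq_matI) (auto simp: mat_eq_iff)
  then have "transpose_mat (G + \<rho> \<cdot>\<^sub>m A) = G + \<rho> \<cdot>\<^sub>m A"
    using G Ac transpose_add[of G n n "\<rho> \<cdot>\<^sub>m A"] by simp
  then show "pos_def n (G + \<rho> \<cdot>\<^sub>m A)"
    using A G \<rho> Ac form unfolding pos_def_def by (auto intro!: add_nonneg_pos)
qed

section \<open>The effective dimension of ridge regression\<close>

text \<open>The effective number of parameters of ridge regression. Here \<open>k\<close> directions are paid for by the
  leading eigenvectors of the Gram matrix \<open>G\<close>, \<open>r\<close> directions by the weakly penalized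
  eigenvectors of \<open>A\<close>, and in all other directions the penalty, which is at least \<open>\<rho> \<mu>\<close>,
  dominates the tail of the spectrum of \<open>G\<close>. Cutting off the leading part of \<open>G\<close> before
  passing to the eigenbasis of \<open>A\<close> avoids any inequality for eigenvalues of products.\<close>

theorem ridge_trace_bound:
  fixes g a :: "nat \<Rightarrow> real"
  assumes U: "orthonormal_mat n U" and G: "G = U * diagonal n g * transpose_mat U"
    and lam: "\<And>j. j < n \<Longrightarrow> 0 \<le> g j"
    and Q: "orthonormal_mat n Q" and A: "A = Q * diagonal n a * transpose_mat Q"
    and a: "\<And>j. j < n \<Longrightarrow> 0 < a j"
    and \<rho>: "0 < \<rho>" and R: "R \<in> carrier_mat n n" "(G + \<rho> \<cdot>\<^sub>m A) * R = 1\<^sub>m n"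
    and mu: "0 < \<mu>" "\<And>j. r \<le> j \<Longrightarrow> j < n \<Longrightarrow> \<mu> \<le> a j" and kn: "k \<le> n" and rn: "r \<le> n"
  shows "mat_trace (R * G) \<le> real k + real r + (\<Sum>j=k..<n. g j) / (\<rho> * \<mu>)"
proof -
  define g\<^sub>2 where "g\<^sub>2 = (\<lambda>j. if j < k then 0 else g j)"
  define G\<^sub>2 where "G\<^sub>2 = U * diagonal n g\<^sub>2 * transpose_mat U"
  have colU: "col U j \<in> carrier_vec n" and colQ: "col Q j \<in> carrier_vec n" if "j < n" for j
    using that U Q by (auto simp: orthonormal_mat_def)
  have Gc: "G \<in> carrier_mat n n" "transpose_mat G = G" unfolding G by (rule diagonalized_symmetric[OF U])+
  have G2c: "G\<^sub>2 \<in> carrier_mat n n" "transpose_mat G\<^sub>2 = G\<^sub>2" unfolding G\<^sub>2_def by (rule diagonalized_symmetric[OF U])+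
  have Ac: "A \<in> carrier_mat n n" "transpose_mat A = A" unfolding A by (rule diagonalized_symmetric[OF Q])+
  have Gq: "v \<bullet> (G *\<^sub>v v) = (\<Sum>i<n. g i * (col U i \<bullet> v)\<^sup>2)" if "v \<in> carrier_vec n" for v
    unfolding G by (rule diagonalized_quadratic_form[OF U that])
  have G2q: "v \<bullet> (G\<^sub>2 *\<^sub>v v) = (\<Sum>i<n. g\<^sub>2 i * (col U i \<bullet> v)\<^sup>2)" if "v \<in> carrier_vec n" for v
    unfolding G\<^sub>2_def by (rule diagonalized_quadratic_form[OF U that])
  have Aq: "v \<bullet> (A *\<^sub>v v) = (\<Sum>i<n. a i * (col Q i \<bullet> v)\<^sup>2)" if "v \<in> carrier_vec n" for v
    unfolding A by (rule diagonalized_quadratic_form[OF Q that])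
  have l2: "0 \<le> g\<^sub>2 j" "g\<^sub>2 j \<le> g j" if "j < n" for j using lam[OF that] by (auto simp: g\<^sub>2_def)
  have Gnn: "0 \<le> v \<bullet> (G *\<^sub>v v)" if "v \<in> carrier_vec n" for v
    unfolding Gq[OF that] using lam by (auto intro!: sum_nonneg)
  have G2nn: "0 \<le> v \<bullet> (G\<^sub>2 *\<^sub>v v)" if "v \<in> carrier_vec n" for v
    unfolding G2q[OF that] using l2 by (auto intro!: sum_nonneg)
  have A_pd: "pos_def n A" unfolding A by (rule diagonalized_pos_def[OF Q a])
  define B where "B = G + \<rho> \<cdot>\<^sub>m A"
  define B\<^sub>2 where "B\<^sub>2 = G\<^sub>2 + \<rho> \<cdot>\<^sub>m A"
  have B: "pos_def n B" and Bq: "\<And>v. v \<in> carrier_vec n \<Longrightarrow> v \<bullet> (B *\<^sub>v v) = v \<bullet> (G *\<^sub>v v) + \<rho> * (v \<bullet> (A *\<^sub>v v))"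
    unfolding B_def using pos_def_add_smult[OF Gc Gnn A_pd \<rho>] by auto
  have B2: "pos_def n B\<^sub>2" and B2q: "\<And>v. v \<in> carrier_vec n \<Longrightarrow> v \<bullet> (B\<^sub>2 *\<^sub>v v) = v \<bullet> (G\<^sub>2 *\<^sub>v v) + \<rho> * (v \<bullet> (A *\<^sub>v v))"
    unfolding B\<^sub>2_def using pos_def_add_smult[OF G2c G2nn A_pd \<rho>] by auto
  obtain R\<^sub>2 where R2: "R\<^sub>2 \<in> carrier_mat n n" "B\<^sub>2 * R\<^sub>2 = 1\<^sub>m n" "R\<^sub>2 * B\<^sub>2 = 1\<^sub>m n" using pos_def_inverse[OF B2] by metis
  have R': "B * R = 1\<^sub>m n" using R by (simp add: B_def)
  have Aform: "0 \<le> v \<bullet> (A *\<^sub>v v)" if "v \<in> carrier_vec n" for v using pos_def_nonneg[OF A_pd that] .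
  \<comment> \<open>Each of the \<open>k\<close> leading eigenvectors of \<open>G\<close> contributes at most 1 to the trace.\<close>
  have lead: "g j * (col U j \<bullet> (R *\<^sub>v col U j)) \<le> 1" if j: "j < n" for j
  proof (rule inverse_rank_one_bound[OF B R(1) R' colU[OF j]])
    fix v :: "real vec" assume v: "v \<in> carrier_vec n"
    have "g j * (col U j \<bullet> v)\<^sup>2 \<le> (\<Sum>i<n. g i * (col U i \<bullet> v)\<^sup>2)"
      by (rule member_le_sum) (use j lam in auto)
    then show "g j * (col U j \<bullet> v)\<^sup>2 \<le> v \<bullet> (B *\<^sub>v v)"
      using Bq[OF v] Gq[OF v] mult_nonneg_nonneg[OF less_imp_le[OF \<rho>] Aform[OF v]] by linarith
  qed
  \<comment> \<open>In the remaining directions the ridge matrix may be replaced by the smaller \<open>B\<^sub>2\<close>.\<close>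
  have tail: "g j * (col U j \<bullet> (R *\<^sub>v col U j)) \<le> g j * (col U j \<bullet> (R\<^sub>2 *\<^sub>v col U j))" if j: "j < n" for j
  proof (intro mult_left_mono lam j inverse_antimono[OF B B2 R(1) R' R2(1,2) _ colU[OF j]])
    fix v :: "real vec" assume v: "v \<in> carrier_vec n"
    have "v \<bullet> (G\<^sub>2 *\<^sub>v v) \<le> v \<bullet> (G *\<^sub>v v)"
      unfolding Gq[OF v] G2q[OF v] using l2 by (intro sum_mono mult_right_mono) auto
    then show "v \<bullet> (B\<^sub>2 *\<^sub>v v) \<le> v \<bullet> (B *\<^sub>v v)" using Bq[OF v] B2q[OF v] by simp
  qed
  have "mat_trace (R * G) = (\<Sum>j<n. g j * (col U j \<bullet> (R *\<^sub>v col U j)))"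
    unfolding G by (rule mat_trace_mult_diagonalized[OF R(1) U])
  also have "\<dots> \<le> (\<Sum>j<n. (if j < k then 1 else 0) + g\<^sub>2 j * (col U j \<bullet> (R\<^sub>2 *\<^sub>v col U j)))"
    using lead tail by (intro sum_mono) (auto simp: g\<^sub>2_def)
  also have "\<dots> = real k + (\<Sum>j<n. g\<^sub>2 j * (col U j \<bullet> (R\<^sub>2 *\<^sub>v col U j)))"
  proof -
    have "{..<n} \<inter> {j. j < k} = {..<k}" using kn by auto
    then show ?thesis by (simp add: sum.distrib sum.If_cases)
  qed
  also have "(\<Sum>j<n. g\<^sub>2 j * (col U j \<bullet> (R\<^sub>2 *\<^sub>v col U j))) = mat_trace (R\<^sub>2 * G\<^sub>2)"
    unfolding G\<^sub>2_def by (rule mat_trace_mult_diagonalized[OF R2(1) U, symmetric])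
  also have "mat_trace (R\<^sub>2 * G\<^sub>2) = (\<Sum>i<n. col Q i \<bullet> ((R\<^sub>2 * G\<^sub>2) *\<^sub>v col Q i))"
    by (rule mat_trace_conjugation[OF _ Q]) (use R2 G2c in auto)
  \<comment> \<open>The trace is now computed in the eigenbasis of \<open>A\<close>, using \<open>G\<^sub>2 = B\<^sub>2 - \<rho> A\<close>.\<close>
  also have "\<dots> = (\<Sum>i<n. 1 - \<rho> * a i * (col Q i \<bullet> (R\<^sub>2 *\<^sub>v col Q i)))"
  proof (intro sum.cong refl)
    fix i assume "i \<in> {..<n}"
    then have i: "i < n" by simp
    note e = colQ[OF i]
    have Ae: "A *\<^sub>v col Q i = a i \<cdot>\<^sub>v col Q i" unfolding A by (rule diagonalized_mult_vec[OF Q i])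
    have "(\<rho> \<cdot>\<^sub>m A) *\<^sub>v col Q i = \<rho> \<cdot>\<^sub>v (A *\<^sub>v col Q i)" by (rule smult_mat_mult_vec[OF Ac(1) e])
    then have "B\<^sub>2 *\<^sub>v col Q i = G\<^sub>2 *\<^sub>v col Q i + (\<rho> * a i) \<cdot>\<^sub>v col Q i"
      using G2c Ac e unfolding B\<^sub>2_def by (simp add: add_mult_distrib_mat_vec[of _ n n] Ae smult_smult_assoc)
    then have Ge: "G\<^sub>2 *\<^sub>v col Q i = B\<^sub>2 *\<^sub>v col Q i - (\<rho> * a i) \<cdot>\<^sub>v col Q i"
      using G2c e Q by (intro eq_vecI) (auto simp: orthonormal_mat_def)
    have B2c: "B\<^sub>2 \<in> carrier_mat n n" using B2 by (simp add: pos_def_def)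
    have "(R\<^sub>2 * G\<^sub>2) *\<^sub>v col Q i = R\<^sub>2 *\<^sub>v (B\<^sub>2 *\<^sub>v col Q i) - (\<rho> * a i) \<cdot>\<^sub>v (R\<^sub>2 *\<^sub>v col Q i)"
      using R2(1) G2c(1) e B2c unfolding assoc_mult_mat_vec[OF R2(1) G2c(1) e] Ge
      by (simp add: mult_minus_distrib_mat_vec[of _ n n] mult_mat_vec[of _ n n])
    also have "R\<^sub>2 *\<^sub>v (B\<^sub>2 *\<^sub>v col Q i) = col Q i" by (rule inverse_mult_vec[OF R2(1) B2c R2(3) e])
    finally have "col Q i \<bullet> ((R\<^sub>2 * G\<^sub>2) *\<^sub>v col Q i) = col Q i \<bullet> col Q i - \<rho> * a i * (col Q i \<bullet> (R\<^sub>2 *\<^sub>v col Q i))"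
      using R2(1) e by (simp add: scalar_prod_minus_distrib[of _ n])
    then show "col Q i \<bullet> ((R\<^sub>2 * G\<^sub>2) *\<^sub>v col Q i) = 1 - \<rho> * a i * (col Q i \<bullet> (R\<^sub>2 *\<^sub>v col Q i))"
      using col_orthonormal[OF Q i i] by simp
  qed
  \<comment> \<open>A summand is at most \<open>\<gamma> / (\<gamma> + \<rho> a i)\<close>, which is bounded by 1 for \<open>i < r\<close> and by
    \<open>\<gamma> / (\<rho> \<mu>)\<close> for the other indices; the numbers \<open>\<gamma>\<close> add up to the trace of \<open>G\<^sub>2\<close>.\<close>
  also have "\<dots> \<le> (\<Sum>i<n. (if i < r then 1 else 0) + (col Q i \<bullet> (G\<^sub>2 *\<^sub>v col Q i)) / (\<rho> * \<mu>))"
  proof (intro sum_mono)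
    fix i assume "i \<in> {..<n}"
    then have i: "i < n" by simp
    note e = colQ[OF i]
    define \<gamma> where "\<gamma> = col Q i \<bullet> (G\<^sub>2 *\<^sub>v col Q i)"
    have \<gamma>: "0 \<le> \<gamma>" unfolding \<gamma>_def by (rule G2nn[OF e])
    have "A *\<^sub>v col Q i = a i \<cdot>\<^sub>v col Q i" unfolding A by (rule diagonalized_mult_vec[OF Q i])
    then have Be: "col Q i \<bullet> (B\<^sub>2 *\<^sub>v col Q i) = \<gamma> + \<rho> * a i"
      using B2q[OF e] e col_orthonormal[OF Q i i] by (simp add: \<gamma>_def)
    have inv: "1 / (\<gamma> + \<rho> * a i) \<le> col Q i \<bullet> (R\<^sub>2 *\<^sub>v col Q i)"
      using inverse_form_ge[OF B2 R2(1,2) e] col_orthonormal[OF Q i i] Be by simp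
    have ra: "0 < \<rho> * a i" using \<rho> a[OF i] by simp
    have "1 - \<rho> * a i * (col Q i \<bullet> (R\<^sub>2 *\<^sub>v col Q i)) \<le> 1 - \<rho> * a i * (1 / (\<gamma> + \<rho> * a i))"
      using mult_left_mono[OF inv, of "\<rho> * a i"] ra by simp
    also have "\<dots> = \<gamma> / (\<gamma> + \<rho> * a i)" using ra \<gamma> by (simp add: field_simps)
    also have "\<dots> \<le> (if i < r then 1 else 0) + \<gamma> / (\<rho> * \<mu>)"
    proof (cases "i < r")
      case True
      have "\<gamma> / (\<gamma> + \<rho> * a i) \<le> 1" using ra \<gamma> by simp
      then show ?thesis using True \<gamma> \<rho> mu(1) by (simp add: add_increasing2)
    next
      case False
      have "\<rho> * \<mu> \<le> \<gamma> + \<rho> * a i" using mu(2)[of i] False i \<rho> \<gamma>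
        by (simp add: add_increasing)
      then show ?thesis using False \<gamma> \<rho> mu(1) by (simp add: frac_le)
    qed
    finally show "1 - \<rho> * a i * (col Q i \<bullet> (R\<^sub>2 *\<^sub>v col Q i)) \<le>
       (if i < r then 1 else 0) + (col Q i \<bullet> (G\<^sub>2 *\<^sub>v col Q i)) / (\<rho> * \<mu>)" by (simp add: \<gamma>_def)
  qed
  also have "\<dots> = real r + mat_trace G\<^sub>2 / (\<rho> * \<mu>)"
  proof -
    have "{..<n} \<inter> {i. i < r} = {..<r}" using rn by auto
    then show ?thesis
      by (simp add: sum.distrib sum.If_cases mat_trace_conjugation[OF G2c(1) Q] sum_divide_distrib)
  qed
  also have "mat_trace G\<^sub>2 = (\<Sum>j<n. g\<^sub>2 j)" unfolding G\<^sub>2_def by (rule mat_trace_diagonalized[OF U])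
  also have "\<dots> = (\<Sum>j=k..<n. g j)"
    by (rule sum.mono_neutral_cong_right) (auto simp: g\<^sub>2_def)
  finally show ?thesis by simp
qed

lemma pos_def_coercive:
  assumes A: "pos_def n A"
  obtains \<delta> where "0 < \<delta>" "\<And>v. v \<in> carrier_vec n \<Longrightarrow> \<delta> * (v \<bullet> v) \<le> v \<bullet> (A *\<^sub>v v)"
proof -
  have Ac: "A \<in> carrier_mat n n" "transpose_mat A = A" using A by (auto simp: pos_def_def)
  from symmetric_diagonalization[OF Ac char_poly_symmetric_splits[OF Ac]] obtain Q a
    where Q: "orthonormal_mat n Q" and AQ: "A = Q * diagonal n a * transpose_mat Q" by blast
  have a: "0 < a i" if i: "i < n" for i
  proof -
    have q: "col Q i \<in> carrier_vec n" "col Q i \<bullet> col Q i = 1"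
      using Q i col_orthonormal[OF Q i i] by (auto simp: orthonormal_mat_def)
    then have "col Q i \<noteq> 0\<^sub>v n" by auto
    then have "0 < col Q i \<bullet> (A *\<^sub>v col Q i)" using A q by (auto simp: pos_def_def)
    then show ?thesis unfolding AQ using diagonalized_mult_vec[OF Q i, of a] q by simp
  qed
  define \<delta> where "\<delta> = Min (insert 1 (a ` {..<n}))"
  have "0 < \<delta>" using a by (auto simp: \<delta>_def)
  moreover have "\<delta> * (v \<bullet> v) \<le> v \<bullet> (A *\<^sub>v v)" if v: "v \<in> carrier_vec n" for v
  proof -
    have vv: "v \<bullet> v = (\<Sum>i<n. (col Q i \<bullet> v)\<^sup>2)"
      using diagonalized_quadratic_form[OF Q v, of "\<lambda>_. 1"] diagonalized_one[OF Q] v by simp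
    have "\<delta> * (v \<bullet> v) \<le> (\<Sum>i<n. a i * (col Q i \<bullet> v)\<^sup>2)"
      unfolding vv sum_distrib_left by (intro sum_mono mult_right_mono) (auto simp: \<delta>_def)
    then show ?thesis unfolding AQ diagonalized_quadratic_form[OF Q v] .
  qed
  ultimately show thesis by (rule that)
qed

section \<open>The estimator as a linear function of the responses\<close>

definition centred_row :: "nat \<Rightarrow> nat \<Rightarrow> (nat \<Rightarrow> real \<Rightarrow> real) \<Rightarrow> nat \<Rightarrow> real vec" where
  "centred_row n p x i = row (X_mat n p x) i"

lemma X_mat_carrier [simp]: "X_mat n p x \<in> carrier_mat n p"
  by (simp add: X_mat_def)

lemma X_mat_dims [simp]: "dim_row (X_mat n p x) = n" "dim_col (X_mat n p x) = p"
  by (simp_all add: X_mat_def)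

lemma centred_row_carrier [simp]: "centred_row n p x i \<in> carrier_vec p"
  by (rule carrier_vecI) (simp add: centred_row_def)

lemma centred_row_dim [simp]: "dim_vec (centred_row n p x i) = p"
  by (simp add: centred_row_def)

lemma centred_row_index:
  "i < n \<Longrightarrow> j < p \<Longrightarrow> centred_row n p x i $ j = x i (knot p j) - avg n (\<lambda>i'. x i' (knot p j))"
  by (simp add: centred_row_def X_mat_def)

lemma sum_centred:
  assumes "0 < n" shows "(\<Sum>i<n. a i - avg n a) = 0"
  using assms by (simp add: avg_def sum_subtractf)

lemma gram_carrier [simp]: "gram n p x \<in> carrier_mat p p"
  by (rule carrier_matI) (simp_all add: gram_def)

lemma gram_dims [simp]: "dim_row (gram n p x) = p" "dim_col (gram n p x) = p"
  by (simp_all add: gram_def)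

lemma gram_mult_vec:
  assumes w: "w \<in> carrier_vec p"
  shows "gram n p x *\<^sub>v w = (1 / (real n * real p)) \<cdot>\<^sub>v (transpose_mat (X_mat n p x) *\<^sub>v (X_mat n p x *\<^sub>v w))"
proof -
  note Z = X_mat_carrier[of n p x]
  have ZT: "transpose_mat (X_mat n p x) \<in> carrier_mat p n" using Z by simp
  show ?thesis
    unfolding gram_def smult_mat_mult_vec[OF mult_carrier_mat[OF ZT Z] w] assoc_mult_mat_vec[OF ZT Z w] ..
qed

lemma transpose_X_mult:
  assumes v: "v \<in> carrier_vec p" and y: "y \<in> carrier_vec n"
  shows "v \<bullet> (transpose_mat (X_mat n p x) *\<^sub>v y) = (\<Sum>i<n. (centred_row n p x i \<bullet> v) * y $ i)"
proof -
  note Z = X_mat_carrier[of n p x]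
  have ZT: "transpose_mat (X_mat n p x) *\<^sub>v y \<in> carrier_vec p" by (rule carrier_vecI) simp
  have "v \<bullet> (transpose_mat (X_mat n p x) *\<^sub>v y) = y \<bullet> (X_mat n p x *\<^sub>v v)"
    using transpose_vec_mult_scalar[OF Z v y] comm_scalar_prod[OF v ZT] by simp
  also have "\<dots> = (\<Sum>i<n. y $ i * (centred_row n p x i \<bullet> v))"
    using y v Z by (simp add: scalar_prod_def[of y] atLeast0LessThan centred_row_def)
  finally show ?thesis by (simp add: mult.commute)
qed

lemma gram_form:
  assumes v: "v \<in> carrier_vec p" and w: "w \<in> carrier_vec p"
  shows "v \<bullet> (gram n p x *\<^sub>v w) =
    (\<Sum>i<n. (centred_row n p x i \<bullet> v) * (centred_row n p x i \<bullet> w)) / (real n * real p)"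
proof -
  note Z = X_mat_carrier[of n p x]
  have Zw: "X_mat n p x *\<^sub>v w \<in> carrier_vec n" by (rule carrier_vecI) simp
  have "transpose_mat (X_mat n p x) *\<^sub>v (X_mat n p x *\<^sub>v w) \<in> carrier_vec p" by (rule carrier_vecI) simp
  then have "v \<bullet> (gram n p x *\<^sub>v w) = (1 / (real n * real p)) * (v \<bullet> (transpose_mat (X_mat n p x) *\<^sub>v (X_mat n p x *\<^sub>v w)))"
    unfolding gram_mult_vec[OF w] using v by simp
  also have "\<dots> = (\<Sum>i<n. (centred_row n p x i \<bullet> v) * (X_mat n p x *\<^sub>v w) $ i) / (real n * real p)"
    unfolding transpose_X_mult[OF v Zw] by simp
  also have "(\<Sum>i<n. (centred_row n p x i \<bullet> v) * (X_mat n p x *\<^sub>v w) $ i)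
      = (\<Sum>i<n. (centred_row n p x i \<bullet> v) * (centred_row n p x i \<bullet> w))"
    using Z w by (intro sum.cong refl) (simp add: centred_row_def)
  finally show ?thesis .
qed

lemma gram_symmetric: "transpose_mat (gram n p x) = gram n p x"
proof -
  note Z = X_mat_carrier[of n p x]
  have "transpose_mat (transpose_mat (X_mat n p x) * X_mat n p x) = transpose_mat (X_mat n p x) * X_mat n p x"
    using transpose_mult[of "transpose_mat (X_mat n p x)" p n "X_mat n p x" p] Z by simp
  moreover have "transpose_mat (c \<cdot>\<^sub>m M) = c \<cdot>\<^sub>m transpose_mat M" for c and M :: "real mat"
    by (rule eq_matI) auto
  ultimately show ?thesis by (simp add: gram_def)
qed

lemma gram_nonneg:
  assumes v: "v \<in> carrier_vec p" shows "0 \<le> v \<bullet> (gram n p x *\<^sub>v v)"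
  unfolding gram_form[OF v v] by (auto intro!: divide_nonneg_nonneg sum_nonneg)

lemma gram_entry:
  assumes "j < p" "l < p"
  shows "gram n p x $$ (j, l) = (\<Sum>i<n. centred_row n p x i $ j * centred_row n p x i $ l) / (real n * real p)"
  using assms X_mat_carrier[of n p x]
  by (simp add: gram_def centred_row_def scalar_prod_def atLeast0LessThan)

definition ridge_inv :: "nat \<Rightarrow> nat \<Rightarrow> nat \<Rightarrow> real \<Rightarrow> (nat \<Rightarrow> real \<Rightarrow> real) \<Rightarrow> real mat" where
  "ridge_inv m n p \<rho> x = the (mat_inverse (gram n p x + \<rho> \<cdot>\<^sub>m A_mat m p))"

text \<open>The coefficient of the response of individual \<open>i\<close> in the estimator.\<close>

definition influence :: "nat \<Rightarrow> nat \<Rightarrow> nat \<Rightarrow> real \<Rightarrow> (nat \<Rightarrow> real \<Rightarrow> real) \<Rightarrow> nat \<Rightarrow> real vec" where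
  "influence m n p \<rho> x i = (1 / real n) \<cdot>\<^sub>v (ridge_inv m n p \<rho> x *\<^sub>v centred_row n p x i)"

text \<open>The coefficient of the product of the errors \<open>i\<close> and \<open>j\<close> in the squared semi-norm of the
  deviation of the estimator from its mean.\<close>

definition influence_form :: "nat \<Rightarrow> nat \<Rightarrow> nat \<Rightarrow> real \<Rightarrow> (nat \<Rightarrow> real \<Rightarrow> real) \<Rightarrow> nat \<Rightarrow> nat \<Rightarrow> real" where
  "influence_form m n p \<rho> x i j =
     (1 / real p) * (influence m n p \<rho> x i \<bullet> (gram n p x *\<^sub>v influence m n p \<rho> x j))"

locale ridge =
  fixes m n p :: nat and \<rho> :: real
  assumes n: "0 < n" and p: "0 < p" and rho: "0 < \<rho>" and A: "pos_def p (A_mat m p)"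
begin

abbreviation "ridge_mat x \<equiv> gram n p x + \<rho> \<cdot>\<^sub>m A_mat m p"

lemma ridge_mat_pos_def: "pos_def p (ridge_mat x)"
  by (rule pos_def_add_smult(1)[OF gram_carrier gram_symmetric gram_nonneg A rho])

lemma ridge_mat_form:
  "v \<in> carrier_vec p \<Longrightarrow> v \<bullet> (ridge_mat x *\<^sub>v v) = v \<bullet> (gram n p x *\<^sub>v v) + \<rho> * (v \<bullet> (A_mat m p *\<^sub>v v))"
  by (rule pos_def_add_smult(2)[OF gram_carrier gram_symmetric gram_nonneg A rho])

lemma ridge_inv:
  "ridge_inv m n p \<rho> x \<in> carrier_mat p p" "ridge_mat x * ridge_inv m n p \<rho> x = 1\<^sub>m p"
  "ridge_inv m n p \<rho> x * ridge_mat x = 1\<^sub>m p"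
  using pos_def_inverse[OF ridge_mat_pos_def[of x]] unfolding ridge_inv_def by (metis option.sel)+

lemma influence_carrier [simp]: "influence m n p \<rho> x i \<in> carrier_vec p"
  using ridge_inv(1)[of x] by (simp add: influence_def)

text \<open>The centred rows add up to zero, so a shift of all responses does not change the estimator.\<close>

lemma centred_sum:
  assumes j: "j < p"
  shows "(\<Sum>i<n. centred_row n p x i $ j * (y i - c)) = (\<Sum>i<n. centred_row n p x i $ j * y i)"
proof -
  have "(\<Sum>i<n. centred_row n p x i $ j) = 0"
    using sum_centred[OF n, of "\<lambda>i. x i (knot p j)"] j by (simp add: centred_row_index)
  then show ?thesis
    by (simp add: right_diff_distrib sum_subtractf flip: sum_distrib_right)
qed

lemma alpha_hat_carrier: "alpha_hat m n p \<rho> x y \<in> carrier_vec p"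
  using carrier_matD[OF ridge_inv(1)[of x]] by (intro carrier_vecI) (simp add: alpha_hat_def flip: ridge_inv_def)

lemma transpose_X_Y_vec:
  assumes "j < p"
  shows "(transpose_mat (X_mat n p x) *\<^sub>v Y_vec n y) $ j = (\<Sum>i<n. centred_row n p x i $ j * (y i - avg n y))"
  using assms X_mat_carrier[of n p x]
  by (simp add: scalar_prod_def atLeast0LessThan Y_vec_def centred_row_def)

lemma alpha_hat_linear:
  assumes j: "j < p"
  shows "alpha_hat m n p \<rho> x y $ j = (\<Sum>i<n. influence m n p \<rho> x i $ j * y i)"
proof -
  let ?R = "ridge_inv m n p \<rho> x" and ?w = "transpose_mat (X_mat n p x) *\<^sub>v Y_vec n y"
  note R = ridge_inv(1)[of x]
  have w: "?w \<in> carrier_vec p" by (rule carrier_vecI) simp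
  have "alpha_hat m n p \<rho> x y $ j = (1 / real n) * (\<Sum>l<p. ?R $$ (j, l) * ?w $ l)"
    using R w j by (simp add: alpha_hat_def scalar_prod_def atLeast0LessThan flip: ridge_inv_def)
  also have "\<dots> = (1 / real n) * (\<Sum>l<p. ?R $$ (j, l) * (\<Sum>i<n. centred_row n p x i $ l * y i))"
    by (intro arg_cong[where f="\<lambda>s. _ * s"] sum.cong refl, subst transpose_X_Y_vec) (simp_all add: centred_sum)
  also have "\<dots> = (\<Sum>i<n. (1 / real n) * (\<Sum>l<p. ?R $$ (j, l) * centred_row n p x i $ l) * y i)"
    by (subst (2) sum_distrib_left, subst sum_distrib_left, subst sum.swap)
      (simp add: sum_distrib_left sum_distrib_right sum_divide_distrib mult_ac)
  also have "\<dots> = (\<Sum>i<n. influence m n p \<rho> x i $ j * y i)"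
    using R j by (intro sum.cong refl) (simp add: influence_def scalar_prod_def atLeast0LessThan
      carrier_vecD[OF centred_row_carrier])
  finally show ?thesis .
qed

lemma Gamma_sq_influence:
  "Gamma_sq n p x (vec p (\<lambda>j. \<Sum>i<n. influence m n p \<rho> x i $ j * e i))
   = (\<Sum>i<n. \<Sum>i'<n. influence_form m n p \<rho> x i i' * (e i * e i'))"
proof -
  let ?u = "vec p (\<lambda>j. \<Sum>i<n. influence m n p \<rho> x i $ j * e i)"
  define a where "a = (\<lambda>l i. centred_row n p x l \<bullet> influence m n p \<rho> x i)"
  have u: "?u \<in> carrier_vec p" by simp
  have zu: "centred_row n p x l \<bullet> ?u = (\<Sum>i<n. a l i * e i)" for l
  proof -
    have "centred_row n p x l \<bullet> ?u = (\<Sum>j<p. \<Sum>i<n. centred_row n p x l $ j * influence m n p \<rho> x i $ j * e i)"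
      by (simp add: scalar_prod_def atLeast0LessThan sum_distrib_left mult_ac)
    also have "\<dots> = (\<Sum>i<n. a l i * e i)"
      by (subst sum.swap) (simp add: a_def scalar_prod_def atLeast0LessThan sum_distrib_right
          carrier_vecD[OF influence_carrier])
    finally show ?thesis .
  qed
  have "Gamma_sq n p x ?u = (1 / real p) * ((\<Sum>l<n. (\<Sum>i<n. a l i * e i) * (\<Sum>i<n. a l i * e i)) / (real n * real p))"
    by (simp add: Gamma_sq_def gram_form[OF u u] zu)
  also have "(\<Sum>l<n. (\<Sum>i<n. a l i * e i) * (\<Sum>i<n. a l i * e i))
      = (\<Sum>l<n. \<Sum>i<n. \<Sum>i'<n. a l i * a l i' * (e i * e i'))"
    by (simp add: sum_product mult_ac)
  also have "\<dots> = (\<Sum>i<n. \<Sum>l<n. \<Sum>i'<n. a l i * a l i' * (e i * e i'))"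
    by (rule sum.swap)
  also have "\<dots> = (\<Sum>i<n. \<Sum>i'<n. \<Sum>l<n. a l i * a l i' * (e i * e i'))"
    by (intro sum.cong refl sum.swap)
  also have "(1 / real p) * (\<dots> / (real n * real p)) = (\<Sum>i<n. \<Sum>i'<n. influence_form m n p \<rho> x i i' * (e i * e i'))"
    by (simp add: influence_form_def gram_form a_def sum_distrib_right sum_divide_distrib)
  finally show ?thesis .
qed

text \<open>The Gram matrix dominates the rank one matrix of each single row.\<close>

lemma leverage_le:
  assumes i: "i < n"
  shows "centred_row n p x i \<bullet> (ridge_inv m n p \<rho> x *\<^sub>v centred_row n p x i) \<le> real n * real p"
proof -
  have "1 / (real n * real p) * (centred_row n p x i \<bullet> (ridge_inv m n p \<rho> x *\<^sub>v centred_row n p x i)) \<le> 1"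
  proof (rule inverse_rank_one_bound[OF ridge_mat_pos_def[of x] ridge_inv(1,2)])
    fix v :: "real vec" assume v: "v \<in> carrier_vec p"
    have "(centred_row n p x i \<bullet> v) * (centred_row n p x i \<bullet> v)
        \<le> (\<Sum>i<n. (centred_row n p x i \<bullet> v) * (centred_row n p x i \<bullet> v))"
      by (rule member_le_sum) (use i in auto)
    then have "1 / (real n * real p) * (centred_row n p x i \<bullet> v)\<^sup>2 \<le> v \<bullet> (gram n p x *\<^sub>v v)"
      unfolding gram_form[OF v v] by (simp add: power2_eq_square divide_right_mono)
    then show "1 / (real n * real p) * (centred_row n p x i \<bullet> v)\<^sup>2 \<le> v \<bullet> (ridge_mat x *\<^sub>v v)"
      unfolding ridge_mat_form[OF v] using pos_def_nonneg[OF A v] rho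
      by (meson add_increasing2 less_imp_le mult_nonneg_nonneg)
  qed simp
  then show ?thesis using n p by (simp add: field_simps)
qed

lemma influence_ridge_form:
  "influence m n p \<rho> x i \<bullet> (ridge_mat x *\<^sub>v influence m n p \<rho> x i)
   = (centred_row n p x i \<bullet> (ridge_inv m n p \<rho> x *\<^sub>v centred_row n p x i)) / (real n)\<^sup>2"
proof -
  let ?z = "centred_row n p x i" and ?R = "ridge_inv m n p \<rho> x"
  have B: "ridge_mat x \<in> carrier_mat p p" using ridge_mat_pos_def[of x] by (simp add: pos_def_def)
  have u: "?R *\<^sub>v ?z \<in> carrier_vec p" using ridge_inv(1)[of x] by simp
  have Bu: "ridge_mat x *\<^sub>v (?R *\<^sub>v ?z) \<in> carrier_vec p" using B u by (rule mult_mat_vec_carrier)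
  have "influence m n p \<rho> x i \<bullet> (ridge_mat x *\<^sub>v influence m n p \<rho> x i)
     = (1 / real n) * ((1 / real n) * ((?R *\<^sub>v ?z) \<bullet> (ridge_mat x *\<^sub>v (?R *\<^sub>v ?z))))"
    unfolding influence_def mult_mat_vec[OF B u] using u Bu by simp
  also have "(?R *\<^sub>v ?z) \<bullet> (ridge_mat x *\<^sub>v (?R *\<^sub>v ?z)) = ?z \<bullet> (?R *\<^sub>v ?z)"
    by (rule inverse_form_pos[OF ridge_mat_pos_def ridge_inv(1,2), symmetric]) simp
  finally show ?thesis by (simp add: power2_eq_square)
qed

lemma influence_form_diag_le:
  "influence_form m n p \<rho> x i i \<le> (centred_row n p x i \<bullet> (ridge_inv m n p \<rho> x *\<^sub>v centred_row n p x i)) / (real p * (real n)\<^sup>2)"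
proof -
  let ?k = "influence m n p \<rho> x i"
  have "?k \<bullet> (gram n p x *\<^sub>v ?k) \<le> ?k \<bullet> (ridge_mat x *\<^sub>v ?k)"
    unfolding ridge_mat_form[OF influence_carrier]
    using pos_def_nonneg[OF A influence_carrier] rho by simp
  then have "(1 / real p) * (?k \<bullet> (gram n p x *\<^sub>v ?k)) \<le>
      (1 / real p) * ((centred_row n p x i \<bullet> (ridge_inv m n p \<rho> x *\<^sub>v centred_row n p x i)) / (real n)\<^sup>2)"
    unfolding influence_ridge_form by (rule mult_left_mono) simp
  then show ?thesis by (simp add: influence_form_def)
qed

lemma influence_form_bounded:
  assumes "i < n" "j < n"
  shows "\<bar>influence_form m n p \<rho> x i j\<bar> \<le> 1"
proof -
  have le1: "influence_form m n p \<rho> x i i \<le> 1" if i: "i < n" for i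
  proof -
    have "influence_form m n p \<rho> x i i \<le> (real n * real p) / (real p * (real n)\<^sup>2)"
      by (rule order.trans[OF influence_form_diag_le divide_right_mono[OF leverage_le[OF i]]]) simp
    also have "\<dots> \<le> 1" using n p by (simp add: power2_eq_square field_simps)
    finally show ?thesis .
  qed
  define a where "a = (\<lambda>l i. centred_row n p x l \<bullet> influence m n p \<rho> x i)"
  have c: "influence_form m n p \<rho> x i j = (1 / real p) * ((\<Sum>l<n. a l i * a l j) / (real n * real p))" for i j
    by (simp add: influence_form_def gram_form a_def)
  have "\<bar>a l i * a l j\<bar> \<le> (a l i * a l i + a l j * a l j) / 2" for l
    using sum_squares_bound[of "a l i" "a l j"] sum_squares_bound[of "a l i" "- a l j"]
    by (simp add: power2_eq_square abs_le_iff)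
  then have "\<bar>\<Sum>l<n. a l i * a l j\<bar> \<le> (\<Sum>l<n. (a l i * a l i + a l j * a l j) / 2)"
    by (intro order.trans[OF sum_abs] sum_mono)
  also have "\<dots> = ((\<Sum>l<n. a l i * a l i) + (\<Sum>l<n. a l j * a l j)) / 2"
    by (simp add: sum.distrib flip: sum_divide_distrib)
  finally have "(1 / real p) * (\<bar>\<Sum>l<n. a l i * a l j\<bar> / (real n * real p)) \<le>
      (1 / real p) * (((\<Sum>l<n. a l i * a l i) + (\<Sum>l<n. a l j * a l j)) / 2 / (real n * real p))"
    by (intro mult_left_mono divide_right_mono) auto
  also have "\<dots> = (influence_form m n p \<rho> x i i + influence_form m n p \<rho> x j j) / 2"
    unfolding c by (simp add: add_divide_distrib mult_ac)
  also have "\<dots> \<le> 1" using le1[OF assms(1)] le1[OF assms(2)] by simp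
  finally show ?thesis unfolding c by (simp add: abs_mult)
qed

text \<open>The bound does not depend on the curves \<open>x\<close>: large curves enlarge the Gram matrix inside the
  inverse as well. This is what makes the estimator integrable when the curves are random.\<close>

lemma influence_bounded:
  obtains K where "\<And>x i j. i < n \<Longrightarrow> j < p \<Longrightarrow> \<bar>influence m n p \<rho> x i $ j\<bar> \<le> K"
proof -
  obtain \<delta> where \<delta>: "0 < \<delta>" "\<And>v. v \<in> carrier_vec p \<Longrightarrow> \<delta> * (v \<bullet> v) \<le> v \<bullet> (A_mat m p *\<^sub>v v)"
    using pos_def_coercive[OF A] by blast
  define K where "K = sqrt (real p / (real n * \<rho> * \<delta>))"
  have "\<bar>influence m n p \<rho> x i $ j\<bar> \<le> K" if ij: "i < n" "j < p" for x i j
  proof -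
    let ?k = "influence m n p \<rho> x i"
    have "?k $ j * ?k $ j \<le> (\<Sum>j<p. ?k $ j * ?k $ j)"
      by (rule member_le_sum) (use ij in auto)
    then have "(?k $ j)\<^sup>2 \<le> ?k \<bullet> ?k"
      by (simp add: scalar_prod_def atLeast0LessThan carrier_vecD[OF influence_carrier] power2_eq_square)
    then have "\<rho> * \<delta> * (?k $ j)\<^sup>2 \<le> \<rho> * (\<delta> * (?k \<bullet> ?k))"
      using rho \<delta>(1) by simp
    also have "\<dots> \<le> \<rho> * (?k \<bullet> (A_mat m p *\<^sub>v ?k))" using \<delta>(2)[of ?k] rho by simp
    also have "\<dots> \<le> ?k \<bullet> (ridge_mat x *\<^sub>v ?k)"
      unfolding ridge_mat_form[OF influence_carrier] using gram_nonneg[of ?k p n x] by simp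
    also have "\<dots> \<le> (real n * real p) / (real n)\<^sup>2"
      unfolding influence_ridge_form by (rule divide_right_mono[OF leverage_le[OF ij(1)]]) simp
    also have "\<dots> = real p / real n" using n by (simp add: power2_eq_square)
    finally have "(?k $ j)\<^sup>2 \<le> real p / (real n * \<rho> * \<delta>)"
      using rho \<delta>(1) n by (simp add: field_simps)
    then have "sqrt ((?k $ j)\<^sup>2) \<le> K" unfolding K_def by (rule real_sqrt_le_mono)
    then show ?thesis by simp
  qed
  then show thesis by (rule that)
qed

text \<open>Since \<open>G \<le> G + \<rho> A\<close>, one of the two factors \<open>(G + \<rho> A)^{-1} G\<close> in the exact
  variance can be estimated by the identity.\<close>

lemma sum_influence_form_le_trace:
  "(\<Sum>i<n. influence_form m n p \<rho> x i i) \<le> mat_trace (ridge_inv m n p \<rho> x * gram n p x) / real n"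
proof -
  let ?R = "ridge_inv m n p \<rho> x" and ?z = "centred_row n p x"
  note R = ridge_inv(1)[of x]
  have lev: "?z i \<bullet> (?R *\<^sub>v ?z i) = (\<Sum>j<p. \<Sum>l<p. ?R $$ (j, l) * (?z i $ l * ?z i $ j))" for i
    using R by (simp add: scalar_prod_def atLeast0LessThan carrier_vecD[OF centred_row_carrier] sum_distrib_left mult_ac)
  have "(\<Sum>i<n. ?z i \<bullet> (?R *\<^sub>v ?z i)) = (\<Sum>j<p. \<Sum>l<p. ?R $$ (j, l) * (\<Sum>i<n. ?z i $ l * ?z i $ j))"
  proof -
    have "(\<Sum>i<n. ?z i \<bullet> (?R *\<^sub>v ?z i)) = (\<Sum>j<p. \<Sum>i<n. \<Sum>l<p. ?R $$ (j, l) * (?z i $ l * ?z i $ j))"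
      unfolding lev by (rule sum.swap)
    also have "\<dots> = (\<Sum>j<p. \<Sum>l<p. \<Sum>i<n. ?R $$ (j, l) * (?z i $ l * ?z i $ j))"
      by (intro sum.cong refl sum.swap)
    finally show ?thesis by (simp add: sum_distrib_left)
  qed
  also have "\<dots> = (\<Sum>j<p. \<Sum>l<p. ?R $$ (j, l) * (real n * real p * gram n p x $$ (l, j)))"
    using n p by (intro sum.cong refl) (simp add: gram_entry)
  also have "\<dots> = real n * real p * mat_trace (?R * gram n p x)"
    using R gram_carrier[of n p x]
    by (simp add: mat_trace_def scalar_prod_def atLeast0LessThan sum_distrib_left mult_ac)
  finally have tr: "(\<Sum>i<n. ?z i \<bullet> (?R *\<^sub>v ?z i)) = real n * real p * mat_trace (?R * gram n p x)" .
  have "(\<Sum>i<n. influence_form m n p \<rho> x i i) \<le> (\<Sum>i<n. (?z i \<bullet> (?R *\<^sub>v ?z i)) / (real p * (real n)\<^sup>2))"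
    by (intro sum_mono influence_form_diag_le)
  also have "\<dots> = (\<Sum>i<n. ?z i \<bullet> (?R *\<^sub>v ?z i)) / (real p * (real n)\<^sup>2)"
    by (simp add: sum_divide_distrib)
  also have "\<dots> = mat_trace (?R * gram n p x) / real n"
    unfolding tr using n p by (simp add: power2_eq_square)
  finally show ?thesis .
qed

section \<open>The bias for a given design\<close>

text \<open>The noiseless estimator \<open>b\<close> minimizes a penalized least squares functional. Pairing its normal
  equation with \<open>h = a - b\<close> expresses \<open>h G h\<close> by a penalty term and a discretization term, and
  the arithmetic-geometric mean inequality absorbs half of \<open>h G h\<close> from the latter.\<close>

lemma bias_bound:
  fixes \<alpha> :: "real \<Rightarrow> real" and \<alpha>\<^sub>0 :: real and x :: "nat \<Rightarrow> real \<Rightarrow> real"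
  defines "a \<equiv> sample p \<alpha>"
  defines "b \<equiv> alpha_hat m n p \<rho> x (\<lambda>i. \<alpha>\<^sub>0 + (LBINT t:{0..1}. \<alpha> t * x i t))"
  shows "Gamma_sq n p x (b - a) \<le> \<rho> * ((1 / real p) * (a \<bullet> (A_mat m p *\<^sub>v a))) + disc_variation n p \<alpha> x / real n"
proof -
  let ?z = "centred_row n p x" and ?A = "A_mat m p" and ?G = "gram n p x"
  define f where "f = (\<lambda>i. \<alpha>\<^sub>0 + (LBINT t:{0..1}. \<alpha> t * x i t))"
  define d where "d = (\<lambda>i. disc_error p \<alpha> (x i))"
  define \<delta> where "\<delta> = (\<lambda>i. d i - avg n d)"
  have a: "a \<in> carrier_vec p" by (simp add: a_def sample_def)
  have b: "b \<in> carrier_vec p" unfolding b_def by (rule alpha_hat_carrier)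
  have Ac: "?A \<in> carrier_mat p p" "transpose_mat ?A = ?A" using A by (auto simp: pos_def_def)
  have B: "ridge_mat x \<in> carrier_mat p p" using ridge_mat_pos_def[of x] by (simp add: pos_def_def)
  define h where "h = a - b"
  have h: "h \<in> carrier_vec p" using a b by (simp add: h_def)
  have fi: "f i - avg n f = (1 / real p) * (?z i \<bullet> a) + \<delta> i" if i: "i < n" for i
  proof -
    define S where "S = (\<lambda>i. (1 / real p) * (\<Sum>j<p. \<alpha> (knot p j) * x i (knot p j)))"
    have f: "f = (\<lambda>i. \<alpha>\<^sub>0 + (S i + d i))" by (auto simp: f_def d_def S_def disc_error_def)
    have av: "avg n f = \<alpha>\<^sub>0 + (avg n S + avg n d)"
      using n by (simp add: f avg_def sum.distrib add_divide_distrib)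
    have avS: "avg n S = (1 / real p) * (\<Sum>j<p. \<alpha> (knot p j) * avg n (\<lambda>i. x i (knot p j)))"
    proof -
      have "(\<Sum>i<n. S i) = (1 / real p) * (\<Sum>i<n. \<Sum>j<p. \<alpha> (knot p j) * x i (knot p j))"
        by (simp add: S_def sum_divide_distrib)
      also have "\<dots> = (1 / real p) * (\<Sum>j<p. \<Sum>i<n. \<alpha> (knot p j) * x i (knot p j))"
        by (subst sum.swap) (rule refl)
      finally show ?thesis by (simp add: avg_def sum_divide_distrib sum_distrib_left mult_ac)
    qed
    have "?z i \<bullet> a = (\<Sum>j<p. \<alpha> (knot p j) * (x i (knot p j) - avg n (\<lambda>i. x i (knot p j))))"
      using i by (simp add: a_def sample_def scalar_prod_def atLeast0LessThan centred_row_index mult.commute)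
    then have "(1 / real p) * (?z i \<bullet> a) = S i - avg n S"
      unfolding avS unfolding S_def by (simp add: right_diff_distrib sum_subtractf diff_divide_distrib)
    then show ?thesis unfolding av by (simp add: f \<delta>_def)
  qed
  have Bb: "ridge_mat x *\<^sub>v b = (1 / real n) \<cdot>\<^sub>v (transpose_mat (X_mat n p x) *\<^sub>v Y_vec n f)"
  proof -
    have w: "transpose_mat (X_mat n p x) *\<^sub>v Y_vec n f \<in> carrier_vec p"
      by (rule carrier_vecI) simp
    have Rw: "ridge_inv m n p \<rho> x *\<^sub>v (transpose_mat (X_mat n p x) *\<^sub>v Y_vec n f) \<in> carrier_vec p"
      using ridge_inv(1) w by (rule mult_mat_vec_carrier)
    have "b = (1 / real n) \<cdot>\<^sub>v (ridge_inv m n p \<rho> x *\<^sub>v (transpose_mat (X_mat n p x) *\<^sub>v Y_vec n f))"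
      by (simp add: b_def alpha_hat_def f_def ridge_inv_def)
    then show ?thesis
      using mult_mat_vec[OF B Rw] inverse_mult_vec[OF B ridge_inv(1,2) w] by simp
  qed
  have hBb: "h \<bullet> (ridge_mat x *\<^sub>v b) = h \<bullet> (?G *\<^sub>v a) + (1 / real n) * (\<Sum>i<n. (?z i \<bullet> h) * \<delta> i)"
  proof -
    have Yc: "Y_vec n f \<in> carrier_vec n" by (simp add: Y_vec_def)
    have w: "transpose_mat (X_mat n p x) *\<^sub>v Y_vec n f \<in> carrier_vec p"
      by (rule carrier_vecI) simp
    have "h \<bullet> (ridge_mat x *\<^sub>v b) = (1 / real n) * (\<Sum>i<n. (?z i \<bullet> h) * Y_vec n f $ i)"
      unfolding Bb using h w transpose_X_mult[OF h Yc] by simp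
    also have "\<dots> = (1 / real n) * (\<Sum>i<n. (?z i \<bullet> h) * ((1 / real p) * (?z i \<bullet> a)) + (?z i \<bullet> h) * \<delta> i)"
      by (intro arg_cong[where f="\<lambda>s. _ * s"] sum.cong refl)
        (simp add: Y_vec_def fi distrib_left del: times_divide_eq_left)
    also have "\<dots> = h \<bullet> (?G *\<^sub>v a) + (1 / real n) * (\<Sum>i<n. (?z i \<bullet> h) * \<delta> i)"
      unfolding gram_form[OF h a] by (simp add: sum.distrib sum_divide_distrib add_divide_distrib mult_ac)
    finally show ?thesis .
  qed
  have "ridge_mat x *\<^sub>v b = ?G *\<^sub>v b + \<rho> \<cdot>\<^sub>v (?A *\<^sub>v b)"
    using b Ac by (simp add: add_mult_distrib_mat_vec[OF gram_carrier _ b] smult_mat_mult_vec[OF Ac(1) b])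
  then have "h \<bullet> (ridge_mat x *\<^sub>v b) = h \<bullet> (?G *\<^sub>v b) + \<rho> * (h \<bullet> (?A *\<^sub>v b))"
    using h mult_mat_vec_carrier[OF gram_carrier[of n p x] b] mult_mat_vec_carrier[OF Ac(1) b]
    by (simp add: scalar_prod_add_distrib[of _ p])
  moreover have "h \<bullet> (?G *\<^sub>v a) - h \<bullet> (?G *\<^sub>v b) = h \<bullet> (?G *\<^sub>v h)"
    using h a b mult_mat_vec_carrier[OF gram_carrier[of n p x] a] mult_mat_vec_carrier[OF gram_carrier[of n p x] b]
    by (simp add: h_def mult_minus_distrib_mat_vec[of _ p p] scalar_prod_minus_distrib[of _ p])
  ultimately have key: "h \<bullet> (?G *\<^sub>v h) = \<rho> * (h \<bullet> (?A *\<^sub>v b)) - (1 / real n) * (\<Sum>i<n. (?z i \<bullet> h) * \<delta> i)"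
    using hBb by linarith
  \<comment> \<open>This is \<open>2 a A b \<le> a A a + b A b\<close>.\<close>
  have pen: "h \<bullet> (?A *\<^sub>v b) \<le> (a \<bullet> (?A *\<^sub>v a)) / 2"
  proof -
    have "h \<bullet> (?A *\<^sub>v b) = a \<bullet> (?A *\<^sub>v b) - b \<bullet> (?A *\<^sub>v b)"
      unfolding h_def using a b Ac by (simp add: minus_scalar_prod_distrib[of _ p])
    moreover have "0 \<le> (a - b) \<bullet> (?A *\<^sub>v (a - b))" using pos_def_nonneg[OF A] a b by simp
    moreover have "0 \<le> b \<bullet> (?A *\<^sub>v b)" using pos_def_nonneg[OF A b] .
    ultimately show ?thesis using quadratic_form_diff[OF Ac a b] by linarith
  qed
  have "- (\<Sum>i<n. (?z i \<bullet> h) * \<delta> i) = (\<Sum>i<n. - ((?z i \<bullet> h) * \<delta> i))" by (simp add: sum_negf)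
  also have "\<dots> \<le> (\<Sum>i<n. (?z i \<bullet> h) * (?z i \<bullet> h) / (2 * real p) + real p / 2 * (\<delta> i)\<^sup>2)"
  proof (intro sum_mono)
    fix i
    have "0 \<le> (?z i \<bullet> h + real p * \<delta> i)\<^sup>2 / (2 * real p)" using p by simp
    also have "\<dots> = (?z i \<bullet> h) * (?z i \<bullet> h) / (2 * real p) + (?z i \<bullet> h) * \<delta> i + real p / 2 * (\<delta> i)\<^sup>2"
      using p by (simp add: power2_eq_square field_simps)
    finally show "- ((?z i \<bullet> h) * \<delta> i) \<le> (?z i \<bullet> h) * (?z i \<bullet> h) / (2 * real p) + real p / 2 * (\<delta> i)\<^sup>2"
      by linarith
  qed
  also have "\<dots> = real n / 2 * (h \<bullet> (?G *\<^sub>v h)) + real p / 2 * disc_variation n p \<alpha> x"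
    unfolding gram_form[OF h h] disc_variation_def
    using n p by (simp add: sum.distrib \<delta>_def d_def flip: sum_divide_distrib sum_distrib_left)
  finally have "(1 / real n) * (- (\<Sum>i<n. (?z i \<bullet> h) * \<delta> i)) \<le>
      (1 / real n) * (real n / 2 * (h \<bullet> (?G *\<^sub>v h)) + real p / 2 * disc_variation n p \<alpha> x)"
    by (rule mult_left_mono) simp
  also have "\<dots> = (h \<bullet> (?G *\<^sub>v h)) / 2 + real p / 2 * disc_variation n p \<alpha> x / real n"
    using n by (simp add: field_simps)
  finally have "h \<bullet> (?G *\<^sub>v h) \<le> \<rho> * ((a \<bullet> (?A *\<^sub>v a)) / 2) + (h \<bullet> (?G *\<^sub>v h)) / 2
      + real p / 2 * disc_variation n p \<alpha> x / real n"
    using key mult_left_mono[OF pen less_imp_le[OF rho]] by linarith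
  then have "h \<bullet> (?G *\<^sub>v h) \<le> \<rho> * (a \<bullet> (?A *\<^sub>v a)) + real p * disc_variation n p \<alpha> x / real n"
    by (simp add: field_simps)
  then have "(1 / real p) * (h \<bullet> (?G *\<^sub>v h)) \<le> (1 / real p) * (\<rho> * (a \<bullet> (?A *\<^sub>v a)) + real p * disc_variation n p \<alpha> x / real n)"
    by (rule mult_left_mono) simp
  also have "\<dots> = \<rho> * ((1 / real p) * (a \<bullet> (?A *\<^sub>v a))) + disc_variation n p \<alpha> x / real n"
    using p by (simp add: field_simps)
  finally have "(1 / real p) * (h \<bullet> (?G *\<^sub>v h)) \<le> \<rho> * ((1 / real p) * (a \<bullet> (?A *\<^sub>v a))) + disc_variation n p \<alpha> x / real n" .
  moreover have "Gamma_sq n p x (b - a) = (1 / real p) * (h \<bullet> (?G *\<^sub>v h))"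
  proof -
    have c: "b - a \<in> carrier_vec p" using a b by simp
    have "?z i \<bullet> (b - a) = - (?z i \<bullet> h)" for i
      unfolding h_def using a b by (simp add: scalar_prod_minus_distrib[of _ p])
    then show ?thesis unfolding Gamma_sq_def gram_form[OF c c] gram_form[OF h h] by simp
  qed
  ultimately show ?thesis by simp
qed

end

section \<open>Taylor's formula and truncated powers\<close>

text \<open>The finite exceptional set admits piecewise linear \<open>F 0\<close>, which is the case \<open>m = 1\<close> for
  splines.\<close>

definition derivative_chain :: "nat \<Rightarrow> (nat \<Rightarrow> real \<Rightarrow> real) \<Rightarrow> bool" where
  "derivative_chain m F \<longleftrightarrow> (\<exists>S. finite S \<and> (\<forall>i<m. continuous_on {0..1} (F i) \<and>
     (\<forall>t\<in>{0<..<1} - S. (F i has_real_derivative F (Suc i) t) (at t))))"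

text \<open>Taylor's formula for functions whose derivatives of order below \<open>m\<close> are continuous and
  differentiable outside a finite set. The integral is a Henstock-Kurzweil
  integral, which recovers \<open>F (m - 1)\<close> from its derivative \<open>F m\<close> however irregular the latter
  is.\<close>

lemma taylor_integral_remainder:
  assumes F: "derivative_chain m F" and m: "1 \<le> m" and x: "0 \<le> x" "x \<le> 1"
  shows "((\<lambda>t. (x - t) ^ (m - 1) / fact (m - 1) * F m t) has_integral
    (F 0 x - (\<Sum>l<m. F l 0 * x ^ l / fact l))) {0..x}"
proof -
  obtain S where S: "finite S" "\<And>i. i < m \<Longrightarrow> continuous_on {0..1} (F i)"
    "\<And>i t. i < m \<Longrightarrow> t \<in> {0<..<1} - S \<Longrightarrow> (F i has_real_derivative F (Suc i) t) (at t)"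
    using F unfolding derivative_chain_def by blast
  \<comment> \<open>The Taylor polynomial at \<open>t\<close>, evaluated at \<open>x\<close>: as a function of \<open>t\<close> its derivative
    telescopes to the remainder integrand.\<close>
  define \<Phi> where "\<Phi> = (\<lambda>t. \<Sum>l<m. F l t * (x - t) ^ l / fact l)"
  have "((\<lambda>t. (x - t) ^ (m - 1) / fact (m - 1) * F m t) has_integral (\<Phi> x - \<Phi> 0)) {0..x}"
  proof (rule fundamental_theorem_of_calculus_interior_strong[OF S(1) x(1)])
    show "continuous_on {0..x} \<Phi>"
      unfolding \<Phi>_def
      by (intro continuous_intros continuous_on_subset[OF S(2)]) (use x(2) in auto)
  next
    fix t assume t: "t \<in> {0<..<x} - S"
    define g where "g = (\<lambda>l. F l t * (x - t) ^ (l - 1) * (real l / fact l))"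
    have D: "((\<lambda>t. F l t * (x - t) ^ l / fact l) has_real_derivative g (Suc l) - g l) (at t)" if l: "l < m" for l
    proof -
      have "(F l has_real_derivative F (Suc l) t) (at t)" using S(3)[OF l] t x by auto
      moreover have "((\<lambda>t. (x - t) ^ l / fact l) has_real_derivative - (real l * (x - t) ^ (l - 1)) / fact l) (at t)"
        by (auto intro!: derivative_eq_intros)
      ultimately have "((\<lambda>t. F l t * ((x - t) ^ l / fact l)) has_real_derivative
         F (Suc l) t * ((x - t) ^ l / fact l) + - (real l * (x - t) ^ (l - 1)) / fact l * F l t) (at t)"
        by (rule DERIV_mult)
      moreover have "g (Suc l) = F (Suc l) t * ((x - t) ^ l / fact l)"
        by (simp add: g_def del: of_nat_Suc)
      ultimately show ?thesis by (simp add: g_def mult_ac)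
    qed
    have "(\<Phi> has_real_derivative (\<Sum>l<m. g (Suc l) - g l)) (at t)"
      unfolding \<Phi>_def by (rule DERIV_sum) (use D in auto)
    also have "(\<Sum>l<m. g (Suc l) - g l) = g m" unfolding sum_lessThan_telescope by (simp add: g_def)
    also have "g m = (x - t) ^ (m - 1) / fact (m - 1) * F m t"
      using m by (cases m) (simp_all add: g_def del: of_nat_Suc)
    finally show "(\<Phi> has_vector_derivative (x - t) ^ (m - 1) / fact (m - 1) * F m t) (at t)"
      by (simp add: has_real_derivative_iff_has_vector_derivative)
  qed
  moreover have "\<Phi> x = F 0 x"
  proof -
    have "\<Phi> x = (\<Sum>l<m. if l = 0 then F 0 x else 0)" unfolding \<Phi>_def by (intro sum.cong) auto
    then show ?thesis using m by simp
  qed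
  moreover have "\<Phi> 0 = (\<Sum>l<m. F l 0 * x ^ l / fact l)" by (simp add: \<Phi>_def)
  ultimately show ?thesis by simp
qed

text \<open>The value 1 at 0 for \<open>k = 0\<close> makes all truncated powers continuous from the right.\<close>

definition trunc_power :: "nat \<Rightarrow> real \<Rightarrow> real" where
  "trunc_power k x = (if 0 \<le> x then x ^ k else 0)"

lemma moments_shift:
  fixes c \<tau> :: "nat \<Rightarrow> real" and p :: nat
  assumes mom: "\<And>l. l \<le> k \<Longrightarrow> (\<Sum>j<p. c j * \<tau> j ^ l) = (0::real)"
  shows "(\<Sum>j<p. c j * (t - \<tau> j) ^ k) = 0"
proof -
  have "(\<Sum>j<p. c j * (t - \<tau> j) ^ k) = (\<Sum>j<p. c j * (\<Sum>l\<le>k. of_nat (k choose l) * (- \<tau> j) ^ l * t ^ (k - l)))"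
    using binomial_ring[of "- \<tau> _" t k] by (intro sum.cong refl) simp
  also have "\<dots> = (\<Sum>l\<le>k. \<Sum>j<p. (of_nat (k choose l) * (-1) ^ l * t ^ (k - l)) * (c j * \<tau> j ^ l))"
    unfolding sum_distrib_left
    by (subst sum.swap) (intro sum.cong refl, simp add: power_minus[of "\<tau> _"] mult_ac)
  also have "\<dots> = 0" using mom by (simp flip: sum_distrib_left)
  finally show ?thesis .
qed

text \<open>A combination of point evaluations that annihilates polynomials of degree below \<open>m\<close> is the
  integral of the \<open>m\<close>-th derivative against a spline: apply Taylor's formula at every node. This
  replaces repeated integration by parts over the intervals between the knots.\<close>

lemma spline_duality:
  fixes c \<tau> :: "nat \<Rightarrow> real" and p :: nat
  assumes F: "derivative_chain m F" and m: "1 \<le> m"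
    and \<tau>: "\<And>j. j < p \<Longrightarrow> 0 \<le> \<tau> j \<and> \<tau> j \<le> 1"
    and mom: "\<And>l. l < m \<Longrightarrow> (\<Sum>j<p. c j * \<tau> j ^ l) = 0"
  shows "((\<lambda>t. (\<Sum>j<p. c j * trunc_power (m - 1) (t - \<tau> j)) * F m t) has_integral
    (-1) ^ m * fact (m - 1) * (\<Sum>j<p. c j * F 0 (\<tau> j))) {0..1}"
proof -
  define k where "k = m - 1"
  \<comment> \<open>The remainder kernels of Taylor's formula are truncated to the left of the nodes.\<close>
  define lp where "lp = (\<lambda>x t. if t \<in> {0..x} then (x - t) ^ k / fact k * F m t else 0)"
  have "(lp (\<tau> j) has_integral (F 0 (\<tau> j) - (\<Sum>l<m. F l 0 * \<tau> j ^ l / fact l))) {0..1}" if j: "j < p" for j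
    unfolding lp_def using taylor_integral_remainder[OF F m, of "\<tau> j"] \<tau>[OF j]
    by (subst has_integral_restrict) (auto simp: k_def)
  then have "((\<lambda>t. \<Sum>j<p. c j * lp (\<tau> j) t) has_integral
      (\<Sum>j<p. c j * (F 0 (\<tau> j) - (\<Sum>l<m. F l 0 * \<tau> j ^ l / fact l)))) {0..1}"
    by (intro has_integral_sum has_integral_mult_right) auto
  moreover have "(\<Sum>j<p. c j * (F 0 (\<tau> j) - (\<Sum>l<m. F l 0 * \<tau> j ^ l / fact l))) = (\<Sum>j<p. c j * F 0 (\<tau> j))"
  proof -
    have "(\<Sum>j<p. c j * (\<Sum>l<m. F l 0 * \<tau> j ^ l / fact l)) = (\<Sum>l<m. \<Sum>j<p. F l 0 / fact l * (c j * \<tau> j ^ l))"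
      unfolding sum_distrib_left by (subst sum.swap) (simp add: mult_ac)
    also have "\<dots> = 0"
      by (rule sum.neutral, rule ballI) (simp only: sum_distrib_left[symmetric] mom lessThan_iff mult_zero_right)
    finally show ?thesis by (simp add: right_diff_distrib sum_subtractf)
  qed
  ultimately have I: "((\<lambda>t. \<Sum>j<p. c j * lp (\<tau> j) t) has_integral (\<Sum>j<p. c j * F 0 (\<tau> j))) {0..1}" by simp
  have "((\<lambda>t. (-1) ^ m * fact k * (\<Sum>j<p. c j * lp (\<tau> j) t)) has_integral
      (-1) ^ m * fact k * (\<Sum>j<p. c j * F 0 (\<tau> j))) {0..1}"
    by (rule has_integral_mult_right[OF I])
  then show ?thesis
    unfolding k_def[symmetric]
  proof (rule has_integral_spike_finite[rotated 2, where S = "\<tau> ` {..<p}"])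
    fix t assume t: "t \<in> {0..1} - \<tau> ` {..<p}"
    have "c j * trunc_power k (t - \<tau> j) * F m t = c j * (t - \<tau> j) ^ k * F m t + (-1) ^ m * fact k * (c j * lp (\<tau> j) t)"
      if j: "j < p" for j
    proof (cases "t < \<tau> j")
      case True
      have "(\<tau> j - t) ^ k = (-1) ^ k * (t - \<tau> j) ^ k" by (metis minus_diff_eq power_minus)
      then show ?thesis using True t m by (cases m) (simp_all add: trunc_power_def lp_def k_def)
    next
      case False
      then have "\<tau> j < t" using t j by (metis DiffD2 imageI lessThan_iff linorder_neqE)
      then show ?thesis using t by (simp add: trunc_power_def lp_def)
    qed
    \<comment> \<open>Left and right truncation differ by the polynomial \<open>(t - \<tau> j)^k\<close>, which the moment
      conditions annihilate.\<close>
    then have "(\<Sum>j<p. c j * trunc_power k (t - \<tau> j) * F m t)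
        = (\<Sum>j<p. c j * (t - \<tau> j) ^ k * F m t + (-1) ^ m * fact k * (c j * lp (\<tau> j) t))"
      by (intro sum.cong) auto
    then have "(\<Sum>j<p. c j * trunc_power k (t - \<tau> j)) * F m t
        = (\<Sum>j<p. c j * (t - \<tau> j) ^ k) * F m t + (-1) ^ m * fact k * (\<Sum>j<p. c j * lp (\<tau> j) t)"
      by (simp add: sum.distrib sum_distrib_left sum_distrib_right)
    then show "(\<Sum>j<p. c j * trunc_power k (t - \<tau> j)) * F m t = (-1) ^ m * fact k * (\<Sum>j<p. c j * lp (\<tau> j) t)"
      using moments_shift[where k = k and p = p and c = c and \<tau> = \<tau> and t = t] mom m by (simp add: k_def)
  qed auto
qed

lemma knot_bounds:
  assumes "j < p" shows "0 < knot p j" "knot p j < 1"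
proof -
  have "0 < 1 / (2 * real p)" using assms by simp
  then show "0 < knot p j" by (simp add: knot_def add_pos_nonneg)
  have "knot p j = (1 + 2 * real j) / (2 * real p)" using assms by (simp add: knot_def field_simps)
  also have "\<dots> < 1" using assms by simp
  finally show "knot p j < 1" .
qed

lemma knot_less_iff: "0 < p \<Longrightarrow> knot p i < knot p j \<longleftrightarrow> i < j"
  by (simp add: knot_def divide_strict_right_mono_neg divide_less_cancel)

lemma knot_le_iff: "0 < p \<Longrightarrow> knot p i \<le> knot p j \<longleftrightarrow> i \<le> j"
  by (simp add: knot_def divide_le_cancel)

lemma trunc_power_has_derivative:
  assumes "t \<noteq> a \<or> 0 < k"
  shows "((\<lambda>t. trunc_power (Suc k) (t - a)) has_real_derivative real (Suc k) * trunc_power k (t - a)) (at t)"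
proof (cases "t = a")
  case False
  show ?thesis
  proof (cases "t < a")
    case True
    have "((\<lambda>t. 0) has_real_derivative 0) (at t)" by simp
    then have "((\<lambda>t. trunc_power (Suc k) (t - a)) has_real_derivative 0) (at t)"
      by (rule has_field_derivative_transform_within_open[of _ _ _ "{..<a}"]) (use True in \<open>auto simp: trunc_power_def\<close>)
    then show ?thesis using True by (simp add: trunc_power_def)
  next
    case False': False
    have "((\<lambda>t. (t - a) ^ Suc k) has_real_derivative real (Suc k) * (t - a) ^ k) (at t)"
      by (rule derivative_eq_intros | simp)+
    then have "((\<lambda>t. trunc_power (Suc k) (t - a)) has_real_derivative real (Suc k) * (t - a) ^ k) (at t)"
      by (rule has_field_derivative_transform_within_open[of _ _ _ "{a<..}"]) (use False False' in \<open>auto simp: trunc_power_def\<close>)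
    then show ?thesis using False False' by (simp add: trunc_power_def)
  qed
next
  case True
  then have k: "0 < k" using assms by simp
  have 1: "((\<lambda>t. trunc_power (Suc k) (t - a)) has_real_derivative 0) (at a within {..a})"
  proof (rule has_field_derivative_transform_within[where f = "\<lambda>_. 0" and d = 1])
    show "((\<lambda>_. 0) has_real_derivative 0) (at a within {..a})" by simp
  qed (auto simp: trunc_power_def)
  have 2: "((\<lambda>t. trunc_power (Suc k) (t - a)) has_real_derivative 0) (at a within {a..})"
  proof (rule has_field_derivative_transform_within[where f = "\<lambda>t. (t - a) ^ Suc k" and d = 1])
    show "((\<lambda>t. (t - a) ^ Suc k) has_real_derivative 0) (at a within {a..})"
      using k by (auto intro!: derivative_eq_intros)
  qed (auto simp: trunc_power_def)
  have "((\<lambda>t. trunc_power (Suc k) (t - a)) has_real_derivative 0) (at a within {..a} \<union> {a..})"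
    using 1 2 by (simp add: has_field_derivative_iff Lim_within_Un)
  moreover have "{..a} \<union> {a..} = UNIV" by auto
  ultimately show ?thesis using True k by (simp add: trunc_power_def power_0_left)
qed

section \<open>Natural splines in explicit form\<close>

lemma trunc_power_Suc_continuous: "continuous_on UNIV (trunc_power (Suc k))"
proof -
  have "trunc_power (Suc k) = (\<lambda>x. max 0 x ^ Suc k)" by (auto simp: trunc_power_def fun_eq_iff max_def)
  moreover have "continuous_on UNIV (\<lambda>x::real. max 0 x ^ Suc k)" by (intro continuous_intros)
  ultimately show ?thesis by metis
qed

lemma trunc_power_measurable [measurable]: "trunc_power k \<in> borel_measurable borel"
  unfolding trunc_power_def by measurable

lemma funpow_pderiv_eq_0:
  fixes q :: "real poly"
  assumes "degree q < m" shows "(pderiv ^^ m) q = 0"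
  using assms
proof (induct m arbitrary: q)
  case (Suc m)
  have "(pderiv ^^ m) (pderiv q) = 0"
  proof (cases "m = 0")
    case True
    then show ?thesis using Suc(2) by (simp add: pderiv_eq_0_iff)
  next
    case False
    then show ?thesis using Suc(2) by (intro Suc(1)) (auto simp: degree_pderiv)
  qed
  then show ?case by (simp add: funpow_swap1)
qed simp

text \<open>The derivative of order \<open>i\<close> of a polynomial plus truncated powers of degree \<open>2 * m - 1\<close>.\<close>

definition spline_deriv :: "nat \<Rightarrow> nat \<Rightarrow> real poly \<Rightarrow> (nat \<Rightarrow> real) \<Rightarrow> nat \<Rightarrow> real \<Rightarrow> real" where
  "spline_deriv m p q c i t = poly ((pderiv ^^ i) q) t +
     fact (2 * m - 1) / fact (2 * m - 1 - i) * (\<Sum>j<p. c j * trunc_power (2 * m - 1 - i) (t - knot p j))"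

text \<open>The vanishing moments lower the degree to the right of the last knot below \<open>m\<close>.\<close>

definition spline_coeffs :: "nat \<Rightarrow> nat \<Rightarrow> real poly \<Rightarrow> (nat \<Rightarrow> real) \<Rightarrow> bool" where
  "spline_coeffs m p q c \<longleftrightarrow> degree q < m \<and> (\<forall>l<m. (\<Sum>j<p. c j * knot p j ^ l) = 0)"

lemma spline_deriv_0:
  "spline_deriv m p q c 0 t = poly q t + (\<Sum>j<p. c j * trunc_power (2 * m - 1) (t - knot p j))"
  by (simp add: spline_deriv_def)

lemma spline_deriv_has_derivative:
  assumes i: "Suc i \<le> 2 * m - 1" and t: "Suc i < 2 * m - 1 \<or> t \<notin> knot p ` {..<p}"
  shows "(spline_deriv m p q c i has_real_derivative spline_deriv m p q c (Suc i) t) (at t)"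
proof -
  define k where "k = 2 * m - 1 - Suc i"
  have k: "2 * m - 1 - i = Suc k" using i by (simp add: k_def)
  have f: "fact (2 * m - 1) / fact (Suc k) * (real (Suc k) * y) = fact (2 * m - 1) / fact k * y" for y :: real
    by (simp del: of_nat_Suc)
  have D: "((\<lambda>t. trunc_power (Suc k) (t - knot p j)) has_real_derivative real (Suc k) * trunc_power k (t - knot p j)) (at t)"
    if j: "j < p" for j
    by (rule trunc_power_has_derivative) (use j t in \<open>auto simp: k_def\<close>)
  have "((\<lambda>t. \<Sum>j<p. c j * trunc_power (Suc k) (t - knot p j)) has_real_derivative
     (\<Sum>j<p. c j * (real (Suc k) * trunc_power k (t - knot p j)))) (at t)"
    by (intro DERIV_sum DERIV_cmult D) auto
  then have "((\<lambda>t. poly ((pderiv ^^ i) q) t + fact (2 * m - 1) / fact (Suc k) * (\<Sum>j<p. c j * trunc_power (Suc k) (t - knot p j)))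
     has_real_derivative poly (pderiv ((pderiv ^^ i) q)) t +
       fact (2 * m - 1) / fact (Suc k) * (\<Sum>j<p. c j * (real (Suc k) * trunc_power k (t - knot p j)))) (at t)"
    by (intro DERIV_add DERIV_cmult poly_DERIV)
  moreover have "(\<Sum>j<p. c j * (real (Suc k) * trunc_power k (t - knot p j))) = real (Suc k) * (\<Sum>j<p. c j * trunc_power k (t - knot p j))"
    by (simp add: sum_distrib_left mult_ac)
  ultimately show ?thesis
    unfolding spline_deriv_def[abs_def] k k_def[symmetric] by (simp only: f funpow.simps o_apply)
qed

lemma spline_deriv_continuous:
  assumes "i < 2 * m - 1" shows "continuous_on S (spline_deriv m p q c i)"
proof -
  obtain k where k: "2 * m - 1 - i = Suc k" using assms by (metis Suc_diff_Suc)
  have "continuous_on UNIV (\<lambda>t. trunc_power (Suc k) (t - a))" for a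
    by (rule continuous_on_compose2[OF trunc_power_Suc_continuous]) (auto intro!: continuous_intros)
  then have "continuous_on UNIV (spline_deriv m p q c i)"
    unfolding spline_deriv_def[abs_def] k by (intro continuous_intros) auto
  then show ?thesis by (rule continuous_on_subset) simp
qed

lemma spline_derivative_chain:
  assumes "1 \<le> m" shows "derivative_chain m (spline_deriv m p q c)"
  unfolding derivative_chain_def
  by (rule exI[of _ "knot p ` {..<p}"])
    (use assms in \<open>auto intro!: spline_deriv_continuous spline_deriv_has_derivative\<close>)

lemma spline_top_derivative:
  assumes "1 \<le> m" "spline_coeffs m p q c"
  shows "spline_deriv m p q c m t = fact (2 * m - 1) / fact (m - 1) * (\<Sum>j<p. c j * trunc_power (m - 1) (t - knot p j))"
proof -
  have "2 * m - 1 - m = m - 1" using assms by simp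
  then show ?thesis using assms by (simp add: spline_deriv_def spline_coeffs_def funpow_pderiv_eq_0)
qed

text \<open>The factor between jump coefficients and energies of splines.\<close>

definition duality_const :: "nat \<Rightarrow> real" where
  "duality_const m = (-1) ^ m * fact (2 * m - 1)"

text \<open>Natural splines enter only through the values of the other function at the knots; this gives
  the orthogonality behind their minimality, the symmetry of the penalty matrix and uniqueness of
  interpolation.\<close>

lemma spline_energy_pairing:
  assumes m: "1 \<le> m" and F: "derivative_chain m F" and c: "spline_coeffs m p q c"
  shows "((\<lambda>t. spline_deriv m p q c m t * F m t) has_integral
    duality_const m * (\<Sum>j<p. c j * F 0 (knot p j))) {0..1}"
proof -
  have "((\<lambda>t. fact (2 * m - 1) / fact (m - 1) * ((\<Sum>j<p. c j * trunc_power (m - 1) (t - knot p j)) * F m t)) has_integral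
     fact (2 * m - 1) / fact (m - 1) * ((-1) ^ m * fact (m - 1) * (\<Sum>j<p. c j * F 0 (knot p j)))) {0..1}"
    using knot_bounds[of _ p] c
    by (intro has_integral_mult_right spline_duality[OF F m]) (auto simp: spline_coeffs_def less_imp_le)
  then show ?thesis
    unfolding spline_top_derivative[OF m c] duality_const_def by (simp add: mult_ac)
qed

text \<open>The square of the top derivative is piecewise continuous, so it vanishes on every piece.\<close>

lemma zero_energy_spline:
  assumes m: "1 \<le> m" and c: "spline_coeffs m p q c"
    and E: "((\<lambda>t. (spline_deriv m p q c m t)\<^sup>2) has_integral 0) {0..1}" and j: "j < p"
  shows "c j = 0"
  using j
proof (induct j rule: less_induct)
  case (less j)
  define b where "b = (if Suc j < p then knot p (Suc j) else 1)"
  have p: "0 < p" using less(2) by simp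
  have ab: "knot p j < b" using knot_bounds(2)[OF less(2)] by (simp add: b_def knot_less_iff[OF p])
  have sub: "{knot p j..b} \<subseteq> {0..1}"
    using knot_bounds[OF less(2)] knot_bounds[of "Suc j" p] by (auto simp: b_def)
  define K where "K = (fact (2 * m - 1) / fact (m - 1) :: real)"
  \<comment> \<open>Immediately to the right of the knot the earlier coefficients vanish by induction and the
    later truncated powers have not started.\<close>
  have top: "spline_deriv m p q c m t = K * (c j * (t - knot p j) ^ (m - 1))" if t: "t \<in> {knot p j..<b}" for t
  proof -
    have "c i * trunc_power (m - 1) (t - knot p i) = (if i = j then c j * (t - knot p j) ^ (m - 1) else 0)"
      if i: "i < p" for i
    proof -
      consider "i < j" | "i = j" | "j < i" by linarith
      then show ?thesis
      proof cases
        case 3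
        then have "Suc j < p" using i by simp
        moreover have "knot p (Suc j) \<le> knot p i" using 3 by (simp add: knot_le_iff[OF p])
        ultimately have "t < knot p i" using t by (auto simp: b_def)
        then show ?thesis using 3 by (simp add: trunc_power_def)
      qed (use less(1) i t in \<open>auto simp: trunc_power_def\<close>)
    qed
    then have "(\<Sum>i<p. c i * trunc_power (m - 1) (t - knot p i)) = (\<Sum>i<p. if i = j then c j * (t - knot p j) ^ (m - 1) else 0)"
      by (intro sum.cong) auto
    also have "\<dots> = c j * (t - knot p j) ^ (m - 1)" using less(2) by simp
    finally show ?thesis unfolding spline_top_derivative[OF m c] K_def by simp
  qed
  have "(\<lambda>t. (spline_deriv m p q c m t)\<^sup>2) integrable_on {knot p j..b}"
    using E sub integrable_on_subinterval[of "\<lambda>t. (spline_deriv m p q c m t)\<^sup>2" "{0..1}" "knot p j" b]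
    by blast
  then obtain I where I: "((\<lambda>t. (spline_deriv m p q c m t)\<^sup>2) has_integral I) {knot p j..b}" by blast
  have "I \<le> 0" by (rule has_integral_subset_le[OF sub I E]) simp
  moreover have "0 \<le> I" by (rule has_integral_nonneg[OF I]) simp
  ultimately have "((\<lambda>t. (spline_deriv m p q c m t)\<^sup>2) has_integral 0) {knot p j..b}" using I by simp
  then have "((\<lambda>t. (K * (c j * (t - knot p j) ^ (m - 1)))\<^sup>2) has_integral 0) {knot p j..b}"
    by (rule has_integral_spike_finite[rotated 2, where S = "{b}"]) (auto simp: top)
  then have "(K * (c j * (b - knot p j) ^ (m - 1)))\<^sup>2 = 0"
    by (intro has_integral_0_cbox_imp_0[where a = "knot p j" and b = b and f = "\<lambda>t. (K * (c j * (t - knot p j) ^ (m - 1)))\<^sup>2"])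
      (use ab in \<open>auto intro!: continuous_intros\<close>)
  then show ?case using ab by (simp add: K_def)
qed

lemma natural_interpolant_unique:
  assumes m: "1 \<le> m" and mp: "m \<le> p" and c: "spline_coeffs m p q c"
    and z: "\<And>j. j < p \<Longrightarrow> spline_deriv m p q c 0 (knot p j) = 0"
  shows "q = 0" "\<And>j. j < p \<Longrightarrow> c j = 0"
proof -
  have E: "((\<lambda>t. (spline_deriv m p q c m t)\<^sup>2) has_integral 0) {0..1}"
    using spline_energy_pairing[OF m spline_derivative_chain[OF m, of p q c] c] z by (simp add: power2_eq_square)
  show c0: "c j = 0" if "j < p" for j by (rule zero_energy_spline[OF m c E that])
  have "poly q (knot p j) = 0" if "j < p" for j using z[OF that] c0 by (simp add: spline_deriv_0)
  then have sub: "knot p ` {..<p} \<subseteq> {x. poly q x = 0}" by auto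
  have "inj_on (knot p) {..<p}"
    by (rule inj_onI) (metis knot_less_iff lessThan_iff linorder_neqE_nat order_less_irrefl gr_zeroI not_less_zero)
  then have "card (knot p ` {..<p}) = p" by (simp add: card_image)
  then show "q = 0"
  proof (rule contrapos_pp)
    assume "q \<noteq> 0"
    have "card (knot p ` {..<p}) \<le> card {x. poly q x = 0}"
      by (rule card_mono[OF poly_roots_finite[OF \<open>q \<noteq> 0\<close>] sub])
    also have "\<dots> \<le> degree q" by (rule card_poly_roots_bound[OF \<open>q \<noteq> 0\<close>])
    also have "\<dots> < p" using c mp by (simp add: spline_coeffs_def)
    finally show "card (knot p ` {..<p}) \<noteq> p" by simp
  qed
qed

section \<open>Every natural spline is explicit\<close>

lemma nderiv_0: "nderiv 0 f = f" by (simp add: nderiv_def)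

lemma nderiv_Suc: "nderiv (Suc k) f t = vector_derivative (nderiv k f) (at t within {0..1})"
  by (simp add: nderiv_def)

lemma vector_derivative_unit_interval:
  assumes "t \<in> {0..1::real}" "(f has_vector_derivative d) (at t within {0..1})"
  shows "vector_derivative f (at t within {0..1}) = (d :: real)"
  by (rule vector_derivative_within_closed_interval) (use assms in auto)

lemma nderiv_spline:
  assumes s: "\<And>t. t \<in> {0..1} \<Longrightarrow> s t = spline_deriv m p q c 0 t"
    and i: "i \<le> 2 * m - 1" and t: "t \<in> {0..1}" and nt: "i < 2 * m - 1 \<or> t \<notin> knot p ` {..<p}"
  shows "nderiv i s t = spline_deriv m p q c i t"
  using i t nt
proof (induct i arbitrary: t)
  case 0
  then show ?case using s by (simp add: nderiv_0)
next
  case (Suc i)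
  have eq: "nderiv i s u = spline_deriv m p q c i u" if "u \<in> {0..1}" for u
    using Suc(1)[of u] Suc(2) that by simp
  have "(spline_deriv m p q c i has_vector_derivative spline_deriv m p q c (Suc i) t) (at t within {0..1})"
    using spline_deriv_has_derivative[of i m t p q c] Suc(2,4)
    by (auto simp: has_real_derivative_iff_has_vector_derivative[symmetric] intro: has_field_derivative_at_within)
  then have "(nderiv i s has_vector_derivative spline_deriv m p q c (Suc i) t) (at t within {0..1})"
    by (rule has_vector_derivative_transform[rotated 2]) (use Suc(3) eq in auto)
  then show ?case unfolding nderiv_Suc by (rule vector_derivative_unit_interval[OF Suc(3)])
qed

text \<open>The pieces of a spline are the intervals between consecutive breakpoints, which are the end
  points of the unit interval and the knots in between.\<close>

definition breakpoint :: "nat \<Rightarrow> nat \<Rightarrow> real" where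
  "breakpoint p k = (if k = 0 then 0 else if k \<le> p then knot p (k - 1) else 1)"

lemma breakpoint_simps:
  "breakpoint p 0 = 0" "k < p \<Longrightarrow> breakpoint p (Suc k) = knot p k" "breakpoint p (Suc p) = 1"
  by (auto simp: breakpoint_def)

lemma breakpoint_less:
  assumes "0 < p" "k \<le> p" shows "breakpoint p k < breakpoint p (Suc k)"
proof (cases "k = p")
  case True
  then show ?thesis using knot_bounds[of "k - 1" p] assms by (simp add: breakpoint_def)
next
  case False
  then show ?thesis using knot_bounds[of 0 p] assms by (auto simp: breakpoint_def knot_less_iff)
qed

lemma breakpoint_bounds: "0 \<le> breakpoint p k" "breakpoint p k \<le> 1"
proof -
  have "k - 1 < p" if "k \<noteq> 0" "k \<le> p" using that by linarith
  then show "0 \<le> breakpoint p k" "breakpoint p k \<le> 1"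
    using knot_bounds[of "k - 1" p] by (auto simp: breakpoint_def less_imp_le)
qed

lemma breakpoint_piece:
  assumes "t \<in> {0..1}"
  obtains k where "k \<le> p" "breakpoint p k \<le> t" "t \<le> breakpoint p (Suc k)"
proof -
  define k where "k = (LEAST k. t \<le> breakpoint p (Suc k))"
  have ex: "t \<le> breakpoint p (Suc p)" using assms by (simp add: breakpoint_def)
  have 1: "t \<le> breakpoint p (Suc k)" unfolding k_def by (rule LeastI[of _ p]) (rule ex)
  have 2: "k \<le> p" unfolding k_def by (rule Least_le) (rule ex)
  have "breakpoint p k \<le> t"
  proof (cases k)
    case 0
    then show ?thesis using assms by (simp add: breakpoint_def)
  next
    case (Suc l)
    then have "\<not> t \<le> breakpoint p (Suc l)" unfolding k_def by (metis lessI not_less_Least)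
    then show ?thesis using Suc by simp
  qed
  with 1 2 show thesis using that by blast
qed

definition piece_poly :: "nat \<Rightarrow> nat \<Rightarrow> real poly \<Rightarrow> (nat \<Rightarrow> real) \<Rightarrow> nat \<Rightarrow> real poly" where
  "piece_poly m p q c k = q + (\<Sum>j<k. Polynomial.smult (c j) ([:- knot p j, 1:] ^ (2 * m - 1)))"

lemma spline_on_piece:
  assumes m: "1 \<le> m" and p: "0 < p" and k: "k \<le> p" and t: "t \<in> {breakpoint p k..breakpoint p (Suc k)}"
  shows "spline_deriv m p q c 0 t = poly (piece_poly m p q c k) t"
proof -
  have "c j * trunc_power (2 * m - 1) (t - knot p j) = (if j < k then c j * (t - knot p j) ^ (2 * m - 1) else 0)"
    if j: "j < p" for j
  proof (cases "j < k")
    case True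
    then have "knot p j \<le> breakpoint p k" using k p by (auto simp: breakpoint_def knot_le_iff)
    then show ?thesis using True t by (auto simp: trunc_power_def)
  next
    case False
    then have "breakpoint p (Suc k) \<le> knot p j" using j p by (auto simp: breakpoint_def knot_le_iff)
    then have "t - knot p j \<le> 0" using t by auto
    then show ?thesis using False m by (auto simp: trunc_power_def power_0_left)
  qed
  then have "(\<Sum>j<p. c j * trunc_power (2 * m - 1) (t - knot p j))
      = (\<Sum>j<p. if j < k then c j * (t - knot p j) ^ (2 * m - 1) else 0)"
    by (intro sum.cong) auto
  also have "\<dots> = (\<Sum>j<k. c j * (t - knot p j) ^ (2 * m - 1))"
    by (rule sum.mono_neutral_cong_right) (use k in auto)
  finally show ?thesis
    by (simp add: spline_deriv_0 piece_poly_def poly_sum)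
qed

lemma coeff_sum_powers:
  assumes "i \<le> N"
  shows "coeff (\<Sum>j<p. Polynomial.smult (c j) ([:- \<tau> j, 1:] ^ N)) i
    = of_nat (N choose i) * (-1) ^ (N - i) * (\<Sum>j<p. c j * \<tau> j ^ (N - i) :: real)"
  using assms by (simp add: coeff_sum coeff_linear_poly_power sum_distrib_left power_minus[of "\<tau> _"] mult_ac)

lemma degree_piece_poly: "spline_coeffs m p q c \<Longrightarrow> degree (piece_poly m p q c k) \<le> 2 * m - 1"
  unfolding piece_poly_def
  by (intro degree_add_le degree_sum_le order.trans[OF degree_smult_le])
    (auto simp: spline_coeffs_def degree_linear_power)

text \<open>The coefficients of the last piece in the degrees \<open>2 * m - 1, \<dots>, m\<close> are nonzero multiples of
  the moments of order \<open>0, \<dots>, m - 1\<close>.\<close>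

lemma degree_last_piece:
  assumes m: "1 \<le> m"
  shows "degree q < m \<Longrightarrow> (degree (piece_poly m p q c p) < m \<longleftrightarrow> (\<forall>l<m. (\<Sum>j<p. c j * knot p j ^ l) = 0))"
proof -
  assume q: "degree q < m"
  define R where "R = (\<Sum>j<p. Polynomial.smult (c j) ([:- knot p j, 1:] ^ (2 * m - 1)))"
  have co: "coeff R (2 * m - 1 - l) = 0 \<longleftrightarrow> (\<Sum>j<p. c j * knot p j ^ l) = 0" if l: "l < m" for l
  proof -
    have "2 * m - 1 - (2 * m - 1 - l) = l" using l by simp
    moreover have "0 < 2 * m - 1 choose (2 * m - 1 - l)" by (rule zero_less_binomial) simp
    ultimately show ?thesis unfolding R_def
      by (subst coeff_sum_powers) (simp_all only: mult_eq_0_iff, simp_all)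
  qed
  have big: "coeff R i = 0" if "2 * m - 1 < i" for i
  proof (rule coeff_eq_0)
    have "degree R \<le> 2 * m - 1" unfolding R_def
      by (intro degree_sum_le order.trans[OF degree_smult_le]) (auto simp: degree_linear_power)
    then show "degree R < i" using that by simp
  qed
  have P: "piece_poly m p q c p = q + R" by (simp add: piece_poly_def R_def)
  have "degree (q + R) < m \<longleftrightarrow> degree R < m"
    using degree_add_less[OF q, of R] degree_add_less[of "q + R" m "- q"] q by auto
  also have "\<dots> \<longleftrightarrow> (\<forall>i\<ge>m. coeff R i = 0)"
  proof
    assume "degree R < m"
    then show "\<forall>i\<ge>m. coeff R i = 0" by (auto intro: coeff_eq_0)
  next
    assume "\<forall>i\<ge>m. coeff R i = 0"
    then have "degree R \<le> m - 1" by (intro degree_le) auto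
    then show "degree R < m" using m by simp
  qed
  also have "\<dots> \<longleftrightarrow> (\<forall>l<m. coeff R (2 * m - 1 - l) = 0)"
  proof
    assume "\<forall>i\<ge>m. coeff R i = 0"
    then show "\<forall>l<m. coeff R (2 * m - 1 - l) = 0" by auto
  next
    assume a: "\<forall>l<m. coeff R (2 * m - 1 - l) = 0"
    show "\<forall>i\<ge>m. coeff R i = 0"
    proof (intro allI impI)
      fix i assume i: "m \<le> i"
      show "coeff R i = 0"
      proof (cases "i \<le> 2 * m - 1")
        case True
        have "2 * m - 1 - i < m" using i m by linarith
        then have "coeff R (2 * m - 1 - (2 * m - 1 - i)) = 0" using a by blast
        moreover have "2 * m - 1 - (2 * m - 1 - i) = i" using True by simp
        ultimately show ?thesis by (simp only:)
      qed (use big in auto)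
    qed
  qed
  finally show ?thesis unfolding P using co by simp
qed

lemma explicit_spline_natural:
  assumes m: "1 \<le> m" and p: "0 < p" and c: "spline_coeffs m p q c"
    and s: "\<And>t. t \<in> {0..1} \<Longrightarrow> s t = spline_deriv m p q c 0 t"
  shows "natural_spline m p s"
proof -
  have piece: "s t = poly (piece_poly m p q c k) t" if "k \<le> p" "t \<in> {breakpoint p k..breakpoint p (Suc k)}" for k t
    using spline_on_piece[OF m p that, of q c] s[of t] that breakpoint_bounds[of p k] breakpoint_bounds[of p "Suc k"] by auto
  have nd: "nderiv i s t = spline_deriv m p q c i t" if "i \<le> 2 * m - 2" "t \<in> {0..1}" for i t
  proof -
    have "i \<le> 2 * m - 1" "i < 2 * m - 1" using that(1) m by linarith+
    then show ?thesis using that(2) by (intro nderiv_spline[OF s]) auto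
  qed
  have "\<exists>u. degree u \<le> 2 * m - 1 \<and> (\<forall>t\<in>{knot p j..knot p (Suc j)}. s t = poly u t)" if j: "Suc j < p" for j
    using piece[of "Suc j"] degree_piece_poly[OF c, of "Suc j"] j
    by (intro exI[of _ "piece_poly m p q c (Suc j)"]) (auto simp: breakpoint_def)
  moreover have "\<exists>u. degree u \<le> m - 1 \<and> (\<forall>t\<in>{0..knot p 0}. s t = poly u t)"
    using piece[of 0] c p
    by (intro exI[of _ "piece_poly m p q c 0"]) (auto simp: breakpoint_def piece_poly_def spline_coeffs_def)
  moreover have "\<exists>u. degree u \<le> m - 1 \<and> (\<forall>t\<in>{knot p (p - 1)..1}. s t = poly u t)"
    using piece[of p] degree_last_piece[OF m, of q p c] c p
    by (intro exI[of _ "piece_poly m p q c p"]) (auto simp: breakpoint_def spline_coeffs_def)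
  moreover have "times_cont_differentiable (2 * m - 2) s"
    unfolding times_cont_differentiable_def times_differentiable_def
  proof (intro conjI allI impI)
    fix i assume i: "i < 2 * m - 2"
    show "nderiv i s differentiable_on {0..1}"
      unfolding differentiable_on_def
    proof
      fix t :: real assume t: "t \<in> {0..1}"
      have "(spline_deriv m p q c i has_real_derivative spline_deriv m p q c (Suc i) t) (at t)"
        using i by (intro spline_deriv_has_derivative) auto
      then have "spline_deriv m p q c i differentiable at t within {0..1}"
        by (meson has_field_derivative_at_within real_differentiable_def)
      then show "nderiv i s differentiable at t within {0..1}"
        by (rule differentiable_transform_within[where d = 1]) (use t nd[of i] i in auto)
    qed
  next
    show "continuous_on {0..1} (nderiv (2 * m - 2) s)"
      using spline_deriv_continuous[of "2 * m - 2" m "{0..1}" p q c] nd[of "2 * m - 2"] m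
      by (subst continuous_on_cong[OF refl, of _ _ "spline_deriv m p q c (2 * m - 2)"]) auto
  qed
  ultimately show ?thesis by (simp add: natural_spline_def)
qed

lemma power_dvd_of_derivs:
  fixes u :: "real poly"
  assumes "\<And>i. i < N \<Longrightarrow> poly ((pderiv ^^ i) u) a = 0"
  shows "[:- a, 1:] ^ N dvd u"
  using assms
proof (induct N arbitrary: u)
  case (Suc N)
  show ?case
  proof (cases "pderiv u = 0")
    case True
    then obtain b where "u = [:b:]" by (metis pderiv_eq_0_iff degree_0_id)
    then show ?thesis using Suc(2)[of 0] by simp
  next
    case False
    have u0: "u \<noteq> 0" using False by auto
    have "[:- a, 1:] ^ N dvd pderiv u"
      using Suc(2)[of "Suc _"] by (intro Suc(1)) (simp add: funpow_swap1)
    then have "N \<le> Polynomial.order a (pderiv u)" using order_divides[of a N "pderiv u"] False by simp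
    moreover have "order a u \<noteq> 0" using Suc(2)[of 0] u0 by (simp add: order_root)
    ultimately have "Suc N \<le> Polynomial.order a u" using order_pderiv[OF u0, of a] Suc(2)[of 0]
      by (metis Suc_le_mono funpow_0 zero_less_Suc)
    then show ?thesis using order_divides[of a "Suc N" u] by simp
  qed
qed simp

lemma nderiv_on_piece:
  assumes lh: "0 \<le> l" "h \<le> 1" and s: "\<And>t. t \<in> {l..h} \<Longrightarrow> s t = poly u t" and t: "t \<in> {l<..<h}"
  shows "nderiv i s t = poly ((pderiv ^^ i) u) t"
  using t
proof (induct i arbitrary: t)
  case 0
  then show ?case using s by (simp add: nderiv_0)
next
  case (Suc i)
  have "(poly ((pderiv ^^ i) u) has_vector_derivative poly ((pderiv ^^ Suc i) u) t) (at t)"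
    using poly_DERIV[of "(pderiv ^^ i) u" t] by (simp add: has_real_derivative_iff_has_vector_derivative)
  then have "(nderiv i s has_vector_derivative poly ((pderiv ^^ Suc i) u) t) (at t)"
    by (rule has_vector_derivative_transform_within_open[where S = "{l<..<h}"]) (use Suc in auto)
  then have "(nderiv i s has_vector_derivative poly ((pderiv ^^ Suc i) u) t) (at t within {0..1})"
    by (rule has_vector_derivative_at_within)
  then show ?case unfolding nderiv_Suc using Suc(2) lh by (intro vector_derivative_unit_interval) auto
qed

lemma nderiv_on_closed_piece:
  assumes lh: "0 \<le> l" "l < h" "h \<le> 1" and s: "\<And>t. t \<in> {l..h} \<Longrightarrow> s t = poly u t"
    and cont: "continuous_on {0..1} (nderiv i s)" and t: "t \<in> {l..h}"
  shows "nderiv i s t = poly ((pderiv ^^ i) u) t"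
proof -
  have cl: "closure {l<..<h} = {l..h}" using lh by simp
  have "nderiv i s t - poly ((pderiv ^^ i) u) t = 0"
  proof (rule continuous_constant_on_closure[where S = "{l<..<h}" and f = "\<lambda>t. nderiv i s t - poly ((pderiv ^^ i) u) t"])
    show "continuous_on (closure {l<..<h}) (\<lambda>t. nderiv i s t - poly ((pderiv ^^ i) u) t)"
      unfolding cl using lh by (intro continuous_intros continuous_on_subset[OF cont]) auto
  qed (use nderiv_on_piece[OF lh(1,3) s] t cl in auto)
  then show ?thesis by simp
qed

text \<open>Two neighbouring pieces agree at their common knot up to the derivative of order
  \<open>2 * m - 2\<close>, so they differ by a multiple of the power \<open>2 * m - 1\<close> of the linear factor there.\<close>

lemma natural_spline_explicit:
  assumes m: "1 \<le> m" and p: "0 < p" and ns: "natural_spline m p s"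
  obtains q c where "spline_coeffs m p q c" "\<And>t. t \<in> {0..1} \<Longrightarrow> s t = spline_deriv m p q c 0 t"
proof -
  have "\<exists>u. degree u \<le> 2 * m - 1 \<and> (k = 0 \<or> k = p \<longrightarrow> degree u \<le> m - 1) \<and>
      (\<forall>t\<in>{breakpoint p k..breakpoint p (Suc k)}. s t = poly u t)" if k: "k \<le> p" for k
  proof -
    consider "k = 0" | "k = p" "k \<noteq> 0" | j where "k = Suc j" "Suc j < p"
      using k by (metis le_neq_implies_less not0_implies_Suc)
    then show ?thesis
    proof cases
      case 1
      obtain u :: "real poly" where "degree u \<le> m - 1" "\<forall>t\<in>{0..knot p 0}. s t = poly u t"
        using ns unfolding natural_spline_def by blast
      then show ?thesis using 1 p by (intro exI[of _ u]) (auto simp: breakpoint_def)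
    next
      case 2
      obtain u :: "real poly" where "degree u \<le> m - 1" "\<forall>t\<in>{knot p (p - 1)..1}. s t = poly u t"
        using ns unfolding natural_spline_def by blast
      then show ?thesis using 2 p by (intro exI[of _ u]) (auto simp: breakpoint_def)
    next
      case 3
      then obtain u :: "real poly" where "degree u \<le> 2 * m - 1" "\<forall>t\<in>{knot p j..knot p (Suc j)}. s t = poly u t"
        using ns unfolding natural_spline_def by blast
      then show ?thesis using 3 p by (intro exI[of _ u]) (auto simp: breakpoint_def)
    qed
  qed
  then obtain U :: "nat \<Rightarrow> real poly" where U: "\<And>k. k \<le> p \<Longrightarrow> degree (U k) \<le> 2 * m - 1"
    "degree (U 0) \<le> m - 1" "degree (U p) \<le> m - 1"
    "\<And>k t. k \<le> p \<Longrightarrow> t \<in> {breakpoint p k..breakpoint p (Suc k)} \<Longrightarrow> s t = poly (U k) t"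
    by (metis le0 order_refl)
  have cont: "continuous_on {0..1} (nderiv i s)" if i: "i \<le> 2 * m - 2" for i
  proof (cases "i = 2 * m - 2")
    case False
    then have "nderiv i s differentiable_on {0..1}"
      using ns i unfolding natural_spline_def times_cont_differentiable_def times_differentiable_def by auto
    then show ?thesis by (rule differentiable_imp_continuous_on)
  qed (use ns in \<open>auto simp: natural_spline_def times_cont_differentiable_def\<close>)
  have "\<exists>b. U (Suc k) - U k = Polynomial.smult b ([:- knot p k, 1:] ^ (2 * m - 1))" if k: "k < p" for k
  proof -
    let ?N = "2 * m - 1"
    have "poly ((pderiv ^^ i) (U (Suc k) - U k)) (knot p k) = 0" if i: "i < ?N" for i
    proof -
      have i': "i \<le> 2 * m - 2" using i by simp
      have "nderiv i s (knot p k) = poly ((pderiv ^^ i) (U k)) (knot p k)"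
        by (rule nderiv_on_closed_piece[of "breakpoint p k" "breakpoint p (Suc k)"])
          (use k p U(4)[of k] cont[OF i'] breakpoint_bounds knot_bounds[OF k] breakpoint_less[of p k] in \<open>auto simp: breakpoint_simps\<close>)
      moreover have "nderiv i s (knot p k) = poly ((pderiv ^^ i) (U (Suc k))) (knot p k)"
        by (rule nderiv_on_closed_piece[of "breakpoint p (Suc k)" "breakpoint p (Suc (Suc k))"])
          (use k p U(4)[of "Suc k"] cont[OF i'] breakpoint_bounds knot_bounds[OF k] breakpoint_less[of p "Suc k"] in \<open>auto simp: breakpoint_simps\<close>)
      moreover have "(pderiv ^^ i) (a - b) = (pderiv ^^ i) a - (pderiv ^^ i) b" for a b :: "real poly"
        by (induct i) (auto simp: pderiv_diff)
      ultimately show ?thesis by simp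
    qed
    then have "[:- knot p k, 1:] ^ ?N dvd U (Suc k) - U k" by (rule power_dvd_of_derivs)
    then obtain r where r: "U (Suc k) - U k = [:- knot p k, 1:] ^ ?N * r" by (elim dvdE)
    have "degree r = 0"
    proof (cases "r = 0")
      case False
      have "degree (U (Suc k) - U k) \<le> ?N" using U(1)[of k] U(1)[of "Suc k"] k by (intro degree_diff_le) auto
      moreover have "degree ([:- knot p k, 1:] ^ ?N * r) = ?N + degree r"
        using False by (subst degree_mult_eq) (auto simp: degree_linear_power)
      ultimately show ?thesis using r by simp
    qed simp
    then obtain b where "r = [:b:]" by (metis degree_0_id)
    then show ?thesis using r by (intro exI[of _ b]) simp
  qed
  then obtain c where c: "\<And>k. k < p \<Longrightarrow> U (Suc k) - U k = Polynomial.smult (c k) ([:- knot p k, 1:] ^ (2 * m - 1))" by metis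
  have Uk: "U k = piece_poly m p (U 0) c k" if "k \<le> p" for k
    using that
  proof (induct k)
    case (Suc k)
    have "U (Suc k) = U k + Polynomial.smult (c k) ([:- knot p k, 1:] ^ (2 * m - 1))" using c[of k] Suc(2) by (simp add: algebra_simps)
    then show ?case using Suc by (simp add: piece_poly_def)
  qed (simp add: piece_poly_def)
  have coeffs: "spline_coeffs m p (U 0) c"
  proof -
    have "degree (U 0) < m" "degree (piece_poly m p (U 0) c p) < m" using U(2,3) m Uk[of p] by auto
    then show ?thesis using degree_last_piece[OF m, of "U 0" p c] by (simp add: spline_coeffs_def)
  qed
  have "s t = spline_deriv m p (U 0) c 0 t" if t: "t \<in> {0..1}" for t
  proof -
    obtain k where k: "k \<le> p" "breakpoint p k \<le> t" "t \<le> breakpoint p (Suc k)" using breakpoint_piece[OF t] .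
    then show ?thesis using U(4)[of k t] spline_on_piece[OF m p k(1), of t "U 0" c] Uk[OF k(1)] by simp
  qed
  with coeffs show thesis by (rule that)
qed

section \<open>Interpolation and the penalty matrix\<close>

lemma sum_split_add: "(\<Sum>k<m + p. f k) = (\<Sum>k<m. f k) + (\<Sum>j<p. f (m + j) :: real)" for p :: nat
  by (induct p) auto

lemma poly_of_coeffs:
  fixes \<theta> :: "nat \<Rightarrow> real"
  assumes "1 \<le> m"
  shows "degree (\<Sum>k<m. monom (\<theta> k) k) < m" "poly (\<Sum>k<m. monom (\<theta> k) k) t = (\<Sum>k<m. \<theta> k * t ^ k)"
    "k < m \<Longrightarrow> coeff (\<Sum>k<m. monom (\<theta> k) k) k = \<theta> k"
proof -
  have "degree (\<Sum>k<m. monom (\<theta> k) k) \<le> m - 1"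
    by (intro degree_sum_le order.trans[OF degree_monom_le]) auto
  then show "degree (\<Sum>k<m. monom (\<theta> k) k) < m" using assms by simp
qed (auto simp: poly_sum poly_monom coeff_sum sum.delta)

text \<open>Existence follows from uniqueness, since the linear system is square.\<close>

lemma natural_interpolant_exists:
  fixes w :: "nat \<Rightarrow> real"
  assumes m: "1 \<le> m" and mp: "m \<le> p"
  obtains q c where "spline_coeffs m p q c" "\<And>j. j < p \<Longrightarrow> spline_deriv m p q c 0 (knot p j) = w j"
proof -
  \<comment> \<open>Interpolation conditions and moment conditions form a square linear system for the \<open>m\<close>
    polynomial coefficients and the \<open>p\<close> jump coefficients.\<close>
  define N where "N = m + p"
  define M where "M = mat N N (\<lambda>(r, k).
    if r < p then (if k < m then knot p r ^ k else trunc_power (2 * m - 1) (knot p r - knot p (k - m)))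
    else (if k < m then 0 else knot p (k - m) ^ (r - p)))"
  have M: "M \<in> carrier_mat N N" by (simp add: M_def)
  define qz where "qz = (\<lambda>z :: real vec. \<Sum>k<m. monom (z $ k) k)"
  define cz where "cz = (\<lambda>(z :: real vec) j. z $ (m + j))"
  have row: "(M *\<^sub>v z) $ r = (\<Sum>k<m. M $$ (r, k) * z $ k) + (\<Sum>j<p. M $$ (r, m + j) * z $ (m + j))"
    if "z \<in> carrier_vec N" "r < N" for z r
    using that M sum_split_add[of "\<lambda>k. M $$ (r, k) * z $ k" m p]
    by (simp add: scalar_prod_def atLeast0LessThan N_def)
  have val: "(M *\<^sub>v z) $ r = spline_deriv m p (qz z) (cz z) 0 (knot p r)" if "z \<in> carrier_vec N" "r < p" for z r
    using that unfolding row[OF that(1), of r] by (subst row) (auto simp: N_def M_def spline_deriv_0 qz_def cz_def poly_of_coeffs(2)[OF m] mult.commute)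
  have mom: "(M *\<^sub>v z) $ (p + l) = (\<Sum>j<p. cz z j * knot p j ^ l)" if "z \<in> carrier_vec N" "l < m" for z l
    using that by (subst row) (auto simp: N_def M_def cz_def mult.commute)
  have coeffs: "spline_coeffs m p (qz z) (cz z)"
    if "z \<in> carrier_vec N" "\<And>l. l < m \<Longrightarrow> (M *\<^sub>v z) $ (p + l) = 0" for z
    using that mom[OF that(1)] poly_of_coeffs(1)[OF m] by (auto simp: spline_coeffs_def qz_def)
  have "det M \<noteq> 0"
  proof
    assume "det M = 0"
    then obtain z where z: "z \<in> carrier_vec N" "z \<noteq> 0\<^sub>v N" "M *\<^sub>v z = 0\<^sub>v N"
      using det_0_iff_vec_prod_zero[OF M] by blast
    have c: "spline_coeffs m p (qz z) (cz z)" by (rule coeffs[OF z(1)]) (simp add: z(3) N_def)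
    have v: "spline_deriv m p (qz z) (cz z) 0 (knot p j) = 0" if "j < p" for j
      using val[OF z(1) that] that by (simp add: z(3) N_def)
    have "z $ k = 0" if k: "k < N" for k
    proof (cases "k < m")
      case True
      then show ?thesis using natural_interpolant_unique(1)[OF m mp c v] poly_of_coeffs(3)[OF m True, of "\<lambda>k. z $ k"]
        by (simp add: qz_def)
    next
      case False
      then show ?thesis using natural_interpolant_unique(2)[OF m mp c v, of "k - m"] k by (simp add: cz_def N_def)
    qed
    then have "z = 0\<^sub>v N" using z(1) by (intro eq_vecI) auto
    with z(2) show False by simp
  qed
  then have "M \<in> Units (ring_mat TYPE(real) N ())" by (rule det_non_zero_imp_unit[OF M])
  then obtain R where "mat_inverse M = Some R"
    using mat_inverse(1)[OF M, of "()"] by (cases "mat_inverse M") auto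
  then have R: "M * R = 1\<^sub>m N" "R \<in> carrier_mat N N" using mat_inverse(2)[OF M] by auto
  define b where "b = vec N (\<lambda>r. if r < p then w r else 0)"
  define z where "z = R *\<^sub>v b"
  have z: "z \<in> carrier_vec N" using R by (simp add: z_def b_def)
  have Mz: "M *\<^sub>v z = b" unfolding z_def by (rule inverse_mult_vec[OF M R(2,1)]) (simp add: b_def)
  show thesis
  proof (rule that)
    show "spline_coeffs m p (qz z) (cz z)"
      by (rule coeffs[OF z]) (simp add: Mz b_def N_def)
    show "spline_deriv m p (qz z) (cz z) 0 (knot p j) = w j" if "j < p" for j
      using val[OF z that] that by (simp add: Mz b_def N_def)
  qed
qed

lemma spline_deriv_sum:
  "spline_deriv m p (\<Sum>i<k. Polynomial.smult (w i) (q i)) (\<lambda>j. \<Sum>i<k. w i * c i j) 0 t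
   = (\<Sum>i<k. w i * spline_deriv m p (q i) (c i) 0 t)" for k :: nat
proof -
  have "(\<Sum>j<p. (\<Sum>i<k. w i * c i j) * trunc_power (2 * m - 1) (t - knot p j))
      = (\<Sum>i<k. w i * (\<Sum>j<p. c i j * trunc_power (2 * m - 1) (t - knot p j)))"
    unfolding sum_distrib_left sum_distrib_right by (subst sum.swap) (simp add: mult_ac)
  then show ?thesis by (simp add: spline_deriv_0 poly_sum distrib_left sum.distrib)
qed

lemma spline_coeffs_sum:
  fixes k :: nat
  assumes m: "1 \<le> m" and c: "\<And>i. i < k \<Longrightarrow> spline_coeffs m p (q i) (c i)"
  shows "spline_coeffs m p (\<Sum>i<k. Polynomial.smult (w i) (q i)) (\<lambda>j. \<Sum>i<k. w i * c i j)"
  unfolding spline_coeffs_def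
proof (intro conjI allI impI)
  have "degree (\<Sum>i<k. Polynomial.smult (w i) (q i)) \<le> m - 1"
  proof (intro degree_sum_le order.trans[OF degree_smult_le])
    fix i assume "i \<in> {..<k}"
    then have "degree (q i) < m" using c by (auto simp: spline_coeffs_def)
    then show "degree (q i) \<le> m - 1" by simp
  qed simp
  then show "degree (\<Sum>i<k. Polynomial.smult (w i) (q i)) < m" using m by simp
  fix l assume l: "l < m"
  have "(\<Sum>j<p. (\<Sum>i<k. w i * c i j) * knot p j ^ l) = (\<Sum>i<k. w i * (\<Sum>j<p. c i j * knot p j ^ l))"
    unfolding sum_distrib_left sum_distrib_right by (subst sum.swap) (simp add: mult_ac)
  also have "\<dots> = 0" using c l by (auto simp: spline_coeffs_def intro!: sum.neutral)
  finally show "(\<Sum>j<p. (\<Sum>i<k. w i * c i j) * knot p j ^ l) = 0" .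
qed

definition interpolates :: "nat \<Rightarrow> nat \<Rightarrow> real poly \<Rightarrow> (nat \<Rightarrow> real) \<Rightarrow> real vec \<Rightarrow> bool" where
  "interpolates m p q c w \<longleftrightarrow> spline_coeffs m p q c \<and> (\<forall>j<p. spline_deriv m p q c 0 (knot p j) = w $ j)"

lemma interpolates_unique:
  assumes m: "1 \<le> m" and mp: "m \<le> p" and 1: "interpolates m p q c w" and 2: "interpolates m p q' c' w"
  shows "q = q'" "j < p \<Longrightarrow> c j = c' j"
proof -
  define qq where "qq = (\<lambda>i::nat. if i = 0 then q else q')"
  define cc where "cc = (\<lambda>i::nat. if i = 0 then c else c')"
  define ww where "ww = (\<lambda>i::nat. if i = 0 then 1 else - 1 :: real)"
  have c: "spline_coeffs m p (\<Sum>i<2. Polynomial.smult (ww i) (qq i)) (\<lambda>j. \<Sum>i<2. ww i * cc i j)"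
    by (rule spline_coeffs_sum[OF m]) (use 1 2 in \<open>auto simp: qq_def cc_def interpolates_def\<close>)
  have v: "spline_deriv m p (\<Sum>i<2. Polynomial.smult (ww i) (qq i)) (\<lambda>j. \<Sum>i<2. ww i * cc i j) 0 (knot p j) = 0" if "j < p" for j
    unfolding spline_deriv_sum using 1 2 that by (simp add: numeral_2_eq_2 qq_def cc_def ww_def interpolates_def)
  show "q = q'" using natural_interpolant_unique(1)[OF m mp c v] by (simp add: numeral_2_eq_2 qq_def ww_def)
  show "j < p \<Longrightarrow> c j = c' j" using natural_interpolant_unique(2)[OF m mp c v, of j] by (simp add: numeral_2_eq_2 cc_def ww_def)
qed

lemma interpolates_exists:
  assumes "1 \<le> m" "m \<le> p" obtains q c where "interpolates m p q c w"
  using natural_interpolant_exists[OF assms, of "\<lambda>j. w $ j"] unfolding interpolates_def by metis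

text \<open>This evaluates the description operator in the definition of \<open>interp_spline\<close>: every natural
  spline has the explicit form, and the explicit form is determined by its values at the knots.\<close>

lemma interp_spline_explicit:
  assumes m: "1 \<le> m" and mp: "m \<le> p" and I: "interpolates m p q c w"
  shows "interp_spline m p w = restrict (spline_deriv m p q c 0) {0..1}"
  unfolding interp_spline_def
proof (rule the_equality)
  let ?s = "restrict (spline_deriv m p q c 0) {0..1}"
  have p: "0 < p" using m mp by simp
  have "natural_spline m p ?s"
    by (rule explicit_spline_natural[OF m p, of q c]) (use I in \<open>auto simp: interpolates_def\<close>)
  then show "?s \<in> extensional {0..1} \<and> natural_spline m p ?s \<and> (\<forall>j<p. ?s (knot p j) = w $ j)"
    using I knot_bounds by (auto simp: interpolates_def less_imp_le)
  fix s assume s: "s \<in> extensional {0..1} \<and> natural_spline m p s \<and> (\<forall>j<p. s (knot p j) = w $ j)"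
  then obtain q' c' where e: "spline_coeffs m p q' c'" "\<And>t. t \<in> {0..1} \<Longrightarrow> s t = spline_deriv m p q' c' 0 t"
    using natural_spline_explicit[OF m p] by blast
  have "interpolates m p q' c' w"
    using e s knot_bounds unfolding interpolates_def by (metis atLeastAtMost_iff less_imp_le)
  note u = interpolates_unique[OF m mp I this]
  have "spline_deriv m p q c 0 t = spline_deriv m p q' c' 0 t" for t
    using u by (simp add: spline_deriv_0)
  then show "s = ?s" using s e(2) by (intro extensionalityI[of _ "{0..1}"]) auto
qed

lemma spline_top_bounded:
  assumes m: "1 \<le> m" and c: "spline_coeffs m p q c"
  obtains K where "\<And>t. t \<in> {0..1} \<Longrightarrow> \<bar>spline_deriv m p q c m t\<bar> \<le> K"
proof -
  have b: "\<bar>trunc_power k (t - knot p j)\<bar> \<le> 1" if "t \<in> {0..1}" "j < p" for t j k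
    using that knot_bounds[of j p] by (auto simp: trunc_power_def power_le_one)
  define K where "K = fact (2 * m - 1) / fact (m - 1) * (\<Sum>j<p. \<bar>c j\<bar>)"
  have "\<bar>spline_deriv m p q c m t\<bar> \<le> K" if t: "t \<in> {0..1}" for t
  proof -
    have "\<bar>\<Sum>j<p. c j * trunc_power (m - 1) (t - knot p j)\<bar> \<le> (\<Sum>j<p. \<bar>c j\<bar>)"
    proof (rule order.trans[OF sum_abs], rule sum_mono)
      fix j assume "j \<in> {..<p}"
      then show "\<bar>c j * trunc_power (m - 1) (t - knot p j)\<bar> \<le> \<bar>c j\<bar>"
        using b[OF t, of j "m - 1"] mult_left_mono[of "\<bar>trunc_power (m - 1) (t - knot p j)\<bar>" 1 "\<bar>c j\<bar>"] by (simp add: abs_mult)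
    qed
    then show ?thesis unfolding spline_top_derivative[OF m c] K_def abs_mult by (simp add: mult_left_mono divide_right_mono)
  qed
  then show thesis by (rule that)
qed

lemma spline_top_measurable:
  assumes m: "1 \<le> m" and c: "spline_coeffs m p q c"
  shows "spline_deriv m p q c m \<in> borel_measurable borel"
proof -
  have "(\<lambda>t. fact (2 * m - 1) / fact (m - 1) * (\<Sum>j<p. c j * trunc_power (m - 1) (t - knot p j))) \<in> borel_measurable borel"
    by measurable
  then show ?thesis using spline_top_derivative[OF m c] by (metis (no_types, lifting) ext)
qed

lemma spline_top_times_integrable:
  assumes m: "1 \<le> m" and c: "spline_coeffs m p q c" and g: "set_integrable lborel {0..1} g"
  shows "set_integrable lborel {0..1} (\<lambda>t. spline_deriv m p q c m t * g t)"
proof -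
  obtain K where K: "\<And>t. t \<in> {0..1} \<Longrightarrow> \<bar>spline_deriv m p q c m t\<bar> \<le> K"
    using spline_top_bounded[OF m c] by blast
  note [measurable] = spline_top_measurable[OF m c]
  have gi: "integrable lborel (\<lambda>t. indicator {0..1} t * g t)" using g by (simp add: set_integrable_def)
  have "integrable lborel (\<lambda>t. spline_deriv m p q c m t * (indicator {0..1} t * g t))"
  proof (rule Bochner_Integration.integrable_bound)
    show "integrable lborel (\<lambda>t. K * (indicator {0..1} t * g t))" using gi by simp
    have "(\<lambda>t. indicator {0..1} t * g t) \<in> borel_measurable lborel" using gi by (rule borel_measurable_integrable)
    then show "(\<lambda>t. spline_deriv m p q c m t * (indicator {0..1} t * g t)) \<in> borel_measurable lborel" by measurable
    have "\<bar>spline_deriv m p q c m t\<bar> * \<bar>indicator {0..1} t * g t\<bar> \<le> \<bar>K\<bar> * \<bar>indicator {0..1} t * g t\<bar>" for t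
      using K[of t] by (cases "t \<in> {0..1}") (auto intro: mult_right_mono)
    then show "AE t in lborel. norm (spline_deriv m p q c m t * (indicator {0..1} t * g t)) \<le> norm (K * (indicator {0..1} t * g t))"
      by (auto simp: abs_mult)
  qed
  then show ?thesis by (simp add: set_integrable_def mult_ac)
qed

lemma set_integrable_unit_interval_const: "set_integrable lborel {0..1::real} (\<lambda>t. k :: real)"
  unfolding set_integrable_def
  by (rule integrableI_bounded_set_indicator[where B = "\<bar>k\<bar>"]) auto

lemma spline_top_square_integrable:
  assumes m: "1 \<le> m" and c: "spline_coeffs m p q c"
  shows "set_integrable lborel {0..1} (\<lambda>t. (spline_deriv m p q c m t)\<^sup>2)"
  using spline_top_times_integrable[OF m c spline_top_times_integrable[OF m c set_integrable_unit_interval_const[of 1]]]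
  by (simp add: power2_eq_square)

lemma spline_energy:
  assumes m: "1 \<le> m" and c: "spline_coeffs m p q c"
  shows "(LBINT t:{0..1}. (spline_deriv m p q c m t)\<^sup>2)
    = duality_const m * (\<Sum>j<p. c j * spline_deriv m p q c 0 (knot p j))"
proof -
  have "((\<lambda>t. (spline_deriv m p q c m t)\<^sup>2) has_integral
      duality_const m * (\<Sum>j<p. c j * spline_deriv m p q c 0 (knot p j))) {0..1}"
    using spline_energy_pairing[OF m spline_derivative_chain[OF m, of p q c] c] by (simp add: power2_eq_square)
  then show ?thesis
    using set_borel_integral_eq_integral(2)[OF spline_top_square_integrable[OF m c]] integral_unique by metis
qed

text \<open>The knots, where the derivative need not exist for \<open>m = 1\<close>, form a null set.\<close>

lemma interp_spline_energy:
  assumes m: "1 \<le> m" and mp: "m \<le> p" and I: "interpolates m p q c w"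
  shows "(LBINT t:{0..1}. (nderiv m (interp_spline m p w) t)\<^sup>2) = duality_const m * (\<Sum>j<p. c j * w $ j)"
proof -
  let ?s = "interp_spline m p w"
  have c: "spline_coeffs m p q c" using I by (simp add: interpolates_def)
  have s: "?s t = spline_deriv m p q c 0 t" if "t \<in> {0..1}" for t
    using that by (simp add: interp_spline_explicit[OF m mp I])
  have "(LBINT t:{0..1}. (nderiv m ?s t)\<^sup>2) = (LBINT t:{0..1}. (spline_deriv m p q c m t)\<^sup>2)"
    unfolding set_lebesgue_integral_def
  proof (rule integral_discrete_difference[where X = "knot p ` {..<p}"])
    fix t assume t: "t \<notin> knot p ` {..<p}"
    show "indicator {0..1} t *\<^sub>R (nderiv m ?s t)\<^sup>2 = indicator {0..1} t *\<^sub>R (spline_deriv m p q c m t)\<^sup>2"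
    proof (cases "t \<in> {0..1}")
      case True
      have "m \<le> 2 * m - 1" using m by simp
      then have "nderiv m ?s t = spline_deriv m p q c m t" using nderiv_spline[of ?s m p q c m t] s True t by blast
      then show ?thesis by simp
    qed simp
  qed (auto intro: countable_finite)
  also have "\<dots> = duality_const m * (\<Sum>j<p. c j * spline_deriv m p q c 0 (knot p j))" by (rule spline_energy[OF m c])
  finally show ?thesis using I by (simp add: interpolates_def)
qed

lemma unit_quadratic_entry:
  assumes "A \<in> carrier_mat n n" "i < n" "j < n"
  shows "unit_vec n i \<bullet> (A *\<^sub>v unit_vec n j) = (A $$ (i, j) :: real)"
proof -
  have "unit_vec n i \<bullet> (A *\<^sub>v unit_vec n j) = (A *\<^sub>v unit_vec n j) $ i"
    using assms by (intro scalar_prod_left_unit) auto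
  also have "\<dots> = row A i \<bullet> unit_vec n j" using assms by simp
  also have "\<dots> = row A i $ j" using assms by (intro scalar_prod_right_unit)
  finally show ?thesis using assms by simp
qed

lemma symmetric_eqI_quadratic:
  fixes A B :: "real mat"
  assumes A: "A \<in> carrier_mat n n" "transpose_mat A = A" and B: "B \<in> carrier_mat n n" "transpose_mat B = B"
    and eq: "\<And>v. v \<in> carrier_vec n \<Longrightarrow> v \<bullet> (A *\<^sub>v v) = v \<bullet> (B *\<^sub>v v)"
  shows "A = B"
proof (rule eq_matI)
  fix i j assume "i < dim_row B" "j < dim_col B"
  then have ij: "i < n" "j < n" using B by auto
  have u: "unit_vec n i \<in> carrier_vec n" "unit_vec n j \<in> carrier_vec n" by auto
  have "unit_vec n i \<bullet> (A *\<^sub>v unit_vec n j) = unit_vec n i \<bullet> (B *\<^sub>v unit_vec n j)"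
    using quadratic_form_diff[OF A u] quadratic_form_diff[OF B u] eq[OF u(1)] eq[OF u(2)]
      eq[of "unit_vec n i - unit_vec n j"] by simp
  then show "A $$ (i, j) = B $$ (i, j)" using unit_quadratic_entry A B ij by metis
qed (use A B in auto)

text \<open>The penalty matrix maps a vector of values to the jump coefficients of its interpolant, up to a
  constant. Its columns come from interpolating the unit vectors, its symmetry from the pairing of
  two interpolants, and a symmetric matrix is determined by its quadratic form.\<close>

theorem A_star_properties:
  assumes m: "1 \<le> m" and mp: "m \<le> p"
  shows "A_star m p \<in> carrier_mat p p" "transpose_mat (A_star m p) = A_star m p"
    "\<And>w q c. w \<in> carrier_vec p \<Longrightarrow> interpolates m p q c w \<Longrightarrow> A_star m p *\<^sub>v w = vec p (\<lambda>j. duality_const m * c j)"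
proof -
  define ok where "ok = (\<lambda>i qc. interpolates m p (fst qc) (snd qc) (unit_vec p i))"
  have "\<exists>qc. ok i qc" for i using interpolates_exists[OF m mp, of "unit_vec p i"] unfolding ok_def by (metis fst_conv snd_conv)
  then obtain qc where qc: "\<And>i. ok i (qc i)" by metis
  define q where "q = (\<lambda>i. fst (qc i))"
  define c where "c = (\<lambda>i. snd (qc i))"
  have I: "interpolates m p (q i) (c i) (unit_vec p i)" for i using qc[of i] by (simp add: ok_def q_def c_def)
  define A where "A = mat p p (\<lambda>(j, i). duality_const m * c i j)"
  have A: "A \<in> carrier_mat p p" by (simp add: A_def)
  have Aw: "A *\<^sub>v w = vec p (\<lambda>j. duality_const m * c' j)" if w: "w \<in> carrier_vec p" and I': "interpolates m p q' c' w" for w q' c'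
  proof -
    have "interpolates m p (\<Sum>i<p. Polynomial.smult (w $ i) (q i)) (\<lambda>j. \<Sum>i<p. w $ i * c i j) w"
      unfolding interpolates_def
    proof (intro conjI allI impI)
      show "spline_coeffs m p (\<Sum>i<p. Polynomial.smult (w $ i) (q i)) (\<lambda>j. \<Sum>i<p. w $ i * c i j)"
        by (rule spline_coeffs_sum[OF m]) (use I in \<open>auto simp: interpolates_def\<close>)
      fix j assume j: "j < p"
      have "(\<Sum>i<p. w $ i * spline_deriv m p (q i) (c i) 0 (knot p j)) = (\<Sum>i<p. if i = j then w $ i else 0)"
        using I j by (intro sum.cong) (auto simp: interpolates_def)
      then show "spline_deriv m p (\<Sum>i<p. Polynomial.smult (w $ i) (q i)) (\<lambda>j. \<Sum>i<p. w $ i * c i j) 0 (knot p j) = w $ j"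
        unfolding spline_deriv_sum using j by simp
    qed
    from interpolates_unique(2)[OF m mp this I'] have "(\<Sum>i<p. w $ i * c i j) = c' j" if "j < p" for j using that .
    then show ?thesis using w
      by (intro eq_vecI) (auto simp: A_def scalar_prod_def atLeast0LessThan mult_ac simp flip: sum_distrib_left)
  qed
  have sym: "transpose_mat A = A"
  proof (rule eq_matI)
    fix i j assume "i < dim_row A" "j < dim_col A"
    then have ij: "i < p" "j < p" by (auto simp: A_def)
    have pair: "((\<lambda>t. spline_deriv m p (q j) (c j) m t * spline_deriv m p (q i) (c i) m t) has_integral
       duality_const m * c j i) {0..1}" if "i < p" for i j
    proof -
      have "(\<Sum>k<p. c j k * spline_deriv m p (q i) (c i) 0 (knot p k)) = (\<Sum>k<p. if k = i then c j k else 0)"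
        using I that by (intro sum.cong) (auto simp: interpolates_def)
      then have "(\<Sum>k<p. c j k * spline_deriv m p (q i) (c i) 0 (knot p k)) = c j i" using that by simp
      then show ?thesis
        using spline_energy_pairing[OF m spline_derivative_chain[OF m, of p "q i" "c i"], of p "q j" "c j"] I
        by (simp add: interpolates_def)
    qed
    have "duality_const m * c j i = duality_const m * c i j"
      using has_integral_unique[OF pair[OF ij(1), of j]] pair[OF ij(2), of i] by (simp add: mult.commute)
    then show "transpose_mat A $$ (i, j) = A $$ (i, j)" using ij by (auto simp add: A_def)
  qed (auto simp: A_def)
  \<comment> \<open>The quadratic form of \<open>A\<close> is the energy of the interpolant.\<close>
  have form: "w \<bullet> (A *\<^sub>v w) = (LBINT t:{0..1}. (nderiv m (interp_spline m p w) t)\<^sup>2)" if w: "w \<in> carrier_vec p" for w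
  proof -
    obtain q' c' where I': "interpolates m p q' c' w" using interpolates_exists[OF m mp] by blast
    show ?thesis unfolding interp_spline_energy[OF m mp I'] Aw[OF w I'] using w
      by (simp add: scalar_prod_def atLeast0LessThan sum_distrib_left mult_ac)
  qed
  have eq: "A_star m p = A"
    unfolding A_star_def
  proof (rule the_equality)
    show "A \<in> carrier_mat p p \<and> transpose_mat A = A \<and>
      (\<forall>w\<in>carrier_vec p. w \<bullet> (A *\<^sub>v w) = (LBINT t:{0..1}. (nderiv m (interp_spline m p w) t)\<^sup>2))"
      using A sym form by blast
    fix B assume "B \<in> carrier_mat p p \<and> transpose_mat B = B \<and>
      (\<forall>w\<in>carrier_vec p. w \<bullet> (B *\<^sub>v w) = (LBINT t:{0..1}. (nderiv m (interp_spline m p w) t)\<^sup>2))"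
    then have B: "B \<in> carrier_mat p p" "transpose_mat B = B"
      "\<And>w. w \<in> carrier_vec p \<Longrightarrow> w \<bullet> (B *\<^sub>v w) = (LBINT t:{0..1}. (nderiv m (interp_spline m p w) t)\<^sup>2)"
      by blast+
    show "B = A" by (rule symmetric_eqI_quadratic[OF B(1,2) A sym]) (simp only: B(3) form)
  qed
  show "A_star m p \<in> carrier_mat p p" "transpose_mat (A_star m p) = A_star m p"
    unfolding eq by (rule A, rule sym)
  show "A_star m p *\<^sub>v w = vec p (\<lambda>j. duality_const m * c j)"
    if "w \<in> carrier_vec p" "interpolates m p q c w" for w q c
    unfolding eq by (rule Aw[OF that])
qed

section \<open>Spectrum of the penalty matrix\<close>

lemma A_star_form:
  assumes m: "1 \<le> m" and mp: "m \<le> p" and w: "w \<in> carrier_vec p" and I: "interpolates m p q c w"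
  shows "w \<bullet> (A_star m p *\<^sub>v w) = (LBINT t:{0..1}. (spline_deriv m p q c m t)\<^sup>2)"
proof -
  have c: "spline_coeffs m p q c" using I by (simp add: interpolates_def)
  have "w \<bullet> (A_star m p *\<^sub>v w) = duality_const m * (\<Sum>j<p. c j * w $ j)"
    unfolding A_star_properties(3)[OF m mp w I] using w
    by (simp add: scalar_prod_def atLeast0LessThan sum_distrib_left mult_ac)
  then show ?thesis unfolding spline_energy[OF m c] using I by (simp add: interpolates_def)
qed

lemma A_star_nonneg:
  assumes m: "1 \<le> m" and mp: "m \<le> p" and w: "w \<in> carrier_vec p"
  shows "0 \<le> w \<bullet> (A_star m p *\<^sub>v w)"
proof -
  obtain q c where I: "interpolates m p q c w" using interpolates_exists[OF m mp] by blast
  show ?thesis unfolding A_star_form[OF m mp w I]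
    by (auto simp: set_lebesgue_integral_def intro!: integral_nonneg)
qed

text \<open>Zero energy removes the truncated powers and leaves a polynomial.\<close>

lemma A_star_form_zero:
  assumes m: "1 \<le> m" and mp: "m \<le> p" and w: "w \<in> carrier_vec p" and z: "w \<bullet> (A_star m p *\<^sub>v w) = 0"
  obtains q where "degree q < m" "\<And>j. j < p \<Longrightarrow> w $ j = poly q (knot p j)"
proof -
  obtain q c where I: "interpolates m p q c w" using interpolates_exists[OF m mp] by blast
  have c: "spline_coeffs m p q c" using I by (simp add: interpolates_def)
  have zero: "duality_const m * (\<Sum>j<p. c j * spline_deriv m p q c 0 (knot p j)) = 0"
    using A_star_form[OF m mp w I] z spline_energy[OF m c] by simp
  have "((\<lambda>t. (spline_deriv m p q c m t)\<^sup>2) has_integral 0) {0..1}"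
    using spline_energy_pairing[OF m spline_derivative_chain[OF m, of p q c] c]
    unfolding zero power2_eq_square .
  then have "c j = 0" if "j < p" for j using zero_energy_spline[OF m c _ that] by blast
  then have "w $ j = poly q (knot p j)" if "j < p" for j
    using I that by (simp add: interpolates_def spline_deriv_0 flip: spline_deriv_0)
      (metis (no_types, lifting) add.right_neutral lessThan_iff mult_zero_left spline_deriv_0 sum.neutral)
  with c show thesis by (intro that[of q]) (auto simp: spline_coeffs_def)
qed

lemma poly_space_iff:
  assumes m: "1 \<le> m"
  shows "w \<in> poly_space m p \<longleftrightarrow> w \<in> carrier_vec p \<and> (\<exists>q. degree q < m \<and> (\<forall>j<p. w $ j = poly q (knot p j)))"
proof
  assume "w \<in> poly_space m p"
  then obtain \<theta> :: "nat \<Rightarrow> real" where w: "w = vec p (\<lambda>j. \<Sum>l<m. \<theta> l * knot p j ^ l)"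
    by (auto simp: poly_space_def)
  then show "w \<in> carrier_vec p \<and> (\<exists>q. degree q < m \<and> (\<forall>j<p. w $ j = poly q (knot p j)))"
    using poly_of_coeffs[OF m, where \<theta> = \<theta>] by (auto intro!: exI[of _ "\<Sum>k<m. monom (\<theta> k) k"])
next
  assume "w \<in> carrier_vec p \<and> (\<exists>q. degree q < m \<and> (\<forall>j<p. w $ j = poly q (knot p j)))"
  then obtain q where w: "w \<in> carrier_vec p" "degree q < m" "\<And>j. j < p \<Longrightarrow> w $ j = poly q (knot p j)" by blast
  have "poly q t = (\<Sum>l<m. coeff q l * t ^ l)" for t
    unfolding poly_altdef
    by (rule sum.mono_neutral_left) (use w(2) in \<open>auto simp: coeff_eq_0\<close>)
  then have "w = vec p (\<lambda>j. \<Sum>l<m. coeff q l * knot p j ^ l)" using w by (intro eq_vecI) auto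
  then show "w \<in> poly_space m p" unfolding poly_space_def by blast
qed

lemma A_star_kernel:
  assumes m: "1 \<le> m" and mp: "m \<le> p" and w: "w \<in> carrier_vec p"
  shows "A_star m p *\<^sub>v w = 0\<^sub>v p \<longleftrightarrow> w \<in> poly_space m p"
proof
  assume z: "A_star m p *\<^sub>v w = 0\<^sub>v p"
  then have "w \<bullet> (A_star m p *\<^sub>v w) = 0" using w by simp
  from A_star_form_zero[OF m mp w this] show "w \<in> poly_space m p"
    using w unfolding poly_space_iff[OF m] by blast
next
  assume "w \<in> poly_space m p"
  then obtain q where q: "degree q < m" "\<And>j. j < p \<Longrightarrow> w $ j = poly q (knot p j)"
    unfolding poly_space_iff[OF m] by blast
  have "interpolates m p q (\<lambda>_. 0) w" using q by (simp add: interpolates_def spline_coeffs_def spline_deriv_0)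
  from A_star_properties(3)[OF m mp w this] show "A_star m p *\<^sub>v w = 0\<^sub>v p" by auto
qed

text \<open>If \<open>P\<close> and \<open>P'\<close> have the same image, then \<open>P' P = P\<close> and \<open>P P' = P'\<close>; transpose the
  second equation.\<close>

lemma symmetric_projection_unique:
  fixes P P' :: "real mat"
  assumes P: "P \<in> carrier_mat n n" "transpose_mat P = P" "P * P = P"
    and P': "P' \<in> carrier_mat n n" "transpose_mat P' = P'" "P' * P' = P'"
    and im: "(\<lambda>w. P *\<^sub>v w) ` carrier_vec n = (\<lambda>w. P' *\<^sub>v w) ` carrier_vec n"
  shows "P = P'"
proof -
  have absorb: "R * S = S"
    if R: "R \<in> carrier_mat n n" "R * R = R" and S: "S \<in> carrier_mat n n"
      and im: "(\<lambda>w. S *\<^sub>v w) ` carrier_vec n \<subseteq> (\<lambda>w. R *\<^sub>v w) ` carrier_vec n" for R S :: "real mat"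
  proof -
    have fix_col: "R *\<^sub>v (S *\<^sub>v v) = S *\<^sub>v v" if v: "v \<in> carrier_vec n" for v
    proof -
      obtain u where u: "u \<in> carrier_vec n" "S *\<^sub>v v = R *\<^sub>v u" using im v by blast
      then show ?thesis using assoc_mult_mat_vec[OF R(1) R(1) u(1)] R(2) by simp
    qed
    show ?thesis
    proof (rule eq_matI)
      fix i j assume "i < dim_row S" "j < dim_col S"
      then have ij: "i < n" "j < n" using S by auto
      have "(R * S) $$ (i, j) = unit_vec n i \<bullet> ((R * S) *\<^sub>v unit_vec n j)"
        using unit_quadratic_entry[OF mult_carrier_mat[OF R(1) S] ij] by simp
      also have "\<dots> = unit_vec n i \<bullet> (S *\<^sub>v unit_vec n j)"
        using fix_col[of "unit_vec n j"] assoc_mult_mat_vec[OF R(1) S, of "unit_vec n j"] by simp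
      also have "\<dots> = S $$ (i, j)" by (rule unit_quadratic_entry[OF S ij])
      finally show "(R * S) $$ (i, j) = S $$ (i, j)" .
    qed (use R S in auto)
  qed
  have "P' * P = P" using absorb[OF P'(1,3) P(1)] im by blast
  moreover have "P * P' = P'" using absorb[OF P(1,3) P'(1)] im by blast
  moreover have "transpose_mat (P * P') = P' * P" using transpose_mult[OF P(1) P'(1)] P(2) P'(2) by simp
  ultimately show ?thesis using P'(2) by simp
qed

lemma diagonal_mult: "diagonal n d * diagonal n e = diagonal n (\<lambda>i. d i * e i)"
proof (rule eq_matI)
  fix i j assume "i < dim_row (diagonal n (\<lambda>i. d i * e i))" "j < dim_col (diagonal n (\<lambda>i. d i * e i))"
  then have ij: "i < n" "j < n" by simp_all
  show "(diagonal n d * diagonal n e) $$ (i, j) = diagonal n (\<lambda>i. d i * e i) $$ (i, j)"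
    unfolding mult_diagonal_entry[OF diagonal_carrier ij] using ij by (simp add: diagonal_def)
qed simp_all

lemma diagonalized_mult:
  assumes Q: "orthonormal_mat n Q"
  shows "(Q * diagonal n d * transpose_mat Q) * (Q * diagonal n e * transpose_mat Q)
    = Q * diagonal n (\<lambda>i. d i * e i) * transpose_mat Q"
proof -
  have Qc: "Q \<in> carrier_mat n n" "transpose_mat Q \<in> carrier_mat n n" "transpose_mat Q * Q = 1\<^sub>m n"
    using Q by (auto simp: orthonormal_mat_def)
  note c = mult_carrier_mat[of _ n n _ n]
  have "(Q * diagonal n d * transpose_mat Q) * (Q * diagonal n e * transpose_mat Q)
     = Q * (diagonal n d * ((transpose_mat Q * Q) * (diagonal n e * transpose_mat Q)))"
    using Qc(1,2) by (simp add: assoc_mult_mat[of _ n n _ n _ n] c)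
  also have "\<dots> = Q * (diagonal n d * (diagonal n e * transpose_mat Q))"
    unfolding Qc(3) using left_mult_one_mat[OF c[OF diagonal_carrier Qc(2)]] by simp
  also have "\<dots> = Q * (diagonal n d * diagonal n e) * transpose_mat Q"
    using Qc(1,2) by (simp add: assoc_mult_mat[of _ n n _ n _ n] c)
  finally show ?thesis unfolding diagonal_mult .
qed

lemma diagonal_add: "diagonal n d + diagonal n e = diagonal n (\<lambda>i. d i + e i)"
  by (rule eq_matI) (auto simp: diagonal_def)

lemma diagonalized_add:
  assumes Q: "orthonormal_mat n Q"
  shows "Q * diagonal n d * transpose_mat Q + Q * diagonal n e * transpose_mat Q
    = Q * diagonal n (\<lambda>i. d i + e i) * transpose_mat Q"
proof -
  have Qc: "Q \<in> carrier_mat n n" "transpose_mat Q \<in> carrier_mat n n" using Q by (auto simp: orthonormal_mat_def)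
  note c = mult_carrier_mat[OF Qc(1) diagonal_carrier]
  show ?thesis
    unfolding diagonal_add[symmetric] mult_add_distrib_mat[OF Qc(1) diagonal_carrier diagonal_carrier]
      add_mult_distrib_mat[OF c c Qc(2)] ..
qed

lemma eigenvector_coordinates:
  assumes Q: "orthonormal_mat n Q" and v: "v \<in> carrier_vec n" and i: "i < n"
  shows "col Q i \<bullet> ((Q * diagonal n d * transpose_mat Q) *\<^sub>v v) = d i * (col Q i \<bullet> v)"
proof -
  have q: "col Q i \<in> carrier_vec n" using Q i by (auto simp: orthonormal_mat_def)
  show ?thesis
    using symmetric_scalar_prod[OF diagonalized_symmetric[OF Q, of d] q v] diagonalized_mult_vec[OF Q i, of d]
      q v comm_scalar_prod[OF q v] by simp
qed

lemma scaled_A_star: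
  assumes m: "1 \<le> m" and mp: "m \<le> p"
  shows "real p \<cdot>\<^sub>m A_star m p \<in> carrier_mat p p" "transpose_mat (real p \<cdot>\<^sub>m A_star m p) = real p \<cdot>\<^sub>m A_star m p"
    "v \<in> carrier_vec p \<Longrightarrow> (real p \<cdot>\<^sub>m A_star m p) *\<^sub>v v = real p \<cdot>\<^sub>v (A_star m p *\<^sub>v v)"
proof -
  note A = A_star_properties(1,2)[OF m mp]
  show "real p \<cdot>\<^sub>m A_star m p \<in> carrier_mat p p" using A by simp
  show "transpose_mat (real p \<cdot>\<^sub>m A_star m p) = real p \<cdot>\<^sub>m A_star m p"
    using A(1) arg_cong[OF A(2), of "\<lambda>M. real p \<cdot>\<^sub>m M"] by (intro eq_matI) (auto simp: mat_eq_iff)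
  show "v \<in> carrier_vec p \<Longrightarrow> (real p \<cdot>\<^sub>m A_star m p) *\<^sub>v v = real p \<cdot>\<^sub>v (A_star m p *\<^sub>v v)"
    by (rule smult_mat_mult_vec[OF A(1)])
qed

text \<open>The penalty matrix has at most \<open>m\<close> vanishing eigenvalues: otherwise a nonzero vector in its
  kernel would vanish at \<open>m\<close> knots, although the kernel consists of the values of polynomials of
  degree below \<open>m\<close>.\<close>

theorem penalty_spectrum:
  assumes m: "1 \<le> m" and mp: "m < p"
  obtains Q \<mu> where "orthonormal_mat p Q"
    "real p \<cdot>\<^sub>m A_star m p = Q * diagonal p \<mu> * transpose_mat Q"
    "\<And>i. i < p \<Longrightarrow> \<mu> i = eigenvalue_asc (real p \<cdot>\<^sub>m A_star m p) (i + 1)"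
    "\<And>i. i < p \<Longrightarrow> 0 \<le> \<mu> i" "\<And>i j. i \<le> j \<Longrightarrow> j < p \<Longrightarrow> \<mu> i \<le> \<mu> j"
    "\<And>i. m \<le> i \<Longrightarrow> i < p \<Longrightarrow> 0 < \<mu> i"
proof -
  have mp': "m \<le> p" using mp by simp
  let ?S = "real p \<cdot>\<^sub>m A_star m p"
  note S = scaled_A_star[OF m mp']
  define es where "es = sorted_list_of_multiset (proots (char_poly ?S))"
  have "length es = p \<and> (\<exists>Q. orthonormal_mat p Q \<and> ?S = Q * diagonal p (\<lambda>i. es ! i) * transpose_mat Q)"
    unfolding es_def by (rule symmetric_diagonalization[OF S(1,2) char_poly_symmetric_splits[OF S(1,2)]])
  then obtain Q where len: "length es = p" and Q: "orthonormal_mat p Q"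
    and SQ: "?S = Q * diagonal p (\<lambda>i. es ! i) * transpose_mat Q" by blast
  have Qc: "Q \<in> carrier_mat p p" using Q by (simp add: orthonormal_mat_def)
  have sorted: "sorted es" unfolding es_def by simp
  have form: "v \<bullet> (?S *\<^sub>v v) = real p * (v \<bullet> (A_star m p *\<^sub>v v))" if "v \<in> carrier_vec p" for v
    unfolding S(3)[OF that] using that mult_mat_vec_carrier[OF A_star_properties(1)[OF m mp'] that] by simp
  have nonneg: "0 \<le> es ! i" if i: "i < p" for i
  proof -
    have q: "col Q i \<in> carrier_vec p" using Qc i by auto
    have "0 \<le> col Q i \<bullet> (?S *\<^sub>v col Q i)" unfolding form[OF q] using A_star_nonneg[OF m mp' q] by simp
    also have "\<dots> = es ! i" unfolding SQ diagonalized_mult_vec[OF Q i] using q col_orthonormal[OF Q i i] by simp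
    finally show ?thesis .
  qed
  have mono: "es ! i \<le> es ! j" if "i \<le> j" "j < p" for i j using sorted_nth_mono[OF sorted that(1)] that(2) len by simp
  have pos: "0 < es ! i" if i: "m \<le> i" "i < p" for i
  proof (rule ccontr)
    assume "\<not> 0 < es ! i"
    then have z: "es ! k = 0" if "k \<le> m" for k using nonneg[of k] mono[of k i] that i by force
    \<comment> \<open>Some nontrivial combination of the first \<open>m + 1\<close> eigenvectors vanishes at the first \<open>m\<close>
      knots: its coefficients form a vector in the kernel of \<open>M\<close>, whose last row is zero.\<close>
    define M where "M = mat (Suc m) (Suc m) (\<lambda>(j, k). if j < m then Q $$ (j, k) else 0)"
    have M: "M \<in> carrier_mat (Suc m) (Suc m)" by (simp add: M_def)
    have MT: "transpose_mat M \<in> carrier_mat (Suc m) (Suc m)" using M by simp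
    have "transpose_mat M *\<^sub>v unit_vec (Suc m) m = 0\<^sub>v (Suc m)"
    proof (rule eq_vecI)
      fix j assume "j < dim_vec (0\<^sub>v (Suc m) :: real vec)"
      then have j: "j < Suc m" by simp
      have "(transpose_mat M *\<^sub>v unit_vec (Suc m) m) $ j = col M j $ m"
        using j M scalar_prod_right_unit[of m "Suc m" "col M j"] by simp
      then show "(transpose_mat M *\<^sub>v unit_vec (Suc m) m) $ j = 0\<^sub>v (Suc m) $ j" using j by (simp add: M_def)
    qed (simp add: M_def)
    then have "\<exists>v. v \<in> carrier_vec (Suc m) \<and> v \<noteq> 0\<^sub>v (Suc m) \<and> transpose_mat M *\<^sub>v v = 0\<^sub>v (Suc m)"
      by (intro exI[of _ "unit_vec (Suc m) m"]) simp
    then have "det (transpose_mat M) = 0" using det_0_iff_vec_prod_zero[OF MT] by blast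
    then have "det M = 0" using det_transpose[OF M] by simp
    then obtain y where y: "y \<in> carrier_vec (Suc m)" "y \<noteq> 0\<^sub>v (Suc m)" "M *\<^sub>v y = 0\<^sub>v (Suc m)"
      using det_0_iff_vec_prod_zero[OF M] by blast
    define y' where "y' = vec p (\<lambda>k. if k \<le> m then y $ k else 0)"
    define v where "v = Q *\<^sub>v y'"
    have y': "y' \<in> carrier_vec p" by (simp add: y'_def)
    have v: "v \<in> carrier_vec p" using Qc y' by (simp add: v_def)
    have coord: "col Q k \<bullet> v = y' $ k" if k: "k < p" for k
    proof -
      have QT: "transpose_mat Q \<in> carrier_mat p p" "transpose_mat Q * Q = 1\<^sub>m p"
        using Q by (auto simp: orthonormal_mat_def)
      have "transpose_mat Q *\<^sub>v v = y'" unfolding v_def by (rule inverse_mult_vec[OF QT(1) Qc QT(2) y'])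
      moreover have "(transpose_mat Q *\<^sub>v v) $ k = col Q k \<bullet> v" using Qc k by simp
      ultimately show ?thesis by simp
    qed
    have "v \<bullet> (?S *\<^sub>v v) = (\<Sum>k<p. es ! k * (col Q k \<bullet> v)\<^sup>2)"
      unfolding SQ by (rule diagonalized_quadratic_form[OF Q v])
    also have "\<dots> = 0"
    proof (rule sum.neutral, rule ballI)
      fix k assume "k \<in> {..<p}"
      then show "es ! k * (col Q k \<bullet> v)\<^sup>2 = 0" using coord[of k] z[of k] by (cases "k \<le> m") (auto simp: y'_def)
    qed
    finally have "v \<bullet> (A_star m p *\<^sub>v v) = 0" unfolding form[OF v] using mp by simp
    then obtain q where q: "degree q < m" "\<And>j. j < p \<Longrightarrow> v $ j = poly q (knot p j)"
      using A_star_form_zero[OF m mp' v] by blast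
    have "poly q (knot p j) = 0" if j: "j < m" for j
    proof -
      have "v $ j = (\<Sum>k<p. if k \<le> m then Q $$ (j, k) * y $ k else 0)"
        using j mp Qc y' by (auto simp: v_def y'_def scalar_prod_def atLeast0LessThan intro!: sum.cong)
      also have "\<dots> = (\<Sum>k<Suc m. Q $$ (j, k) * y $ k)"
        by (rule sum.mono_neutral_cong_right) (use mp in auto)
      also have "\<dots> = (M *\<^sub>v y) $ j"
        using j M y(1) by (simp add: M_def scalar_prod_def atLeast0LessThan)
      finally show ?thesis using q(2)[of j] j mp y(3) by simp
    qed
    then have sub: "knot p ` {..<m} \<subseteq> {x. poly q x = 0}" by auto
    have "inj_on (knot p) {..<m}"
      using knot_less_iff[of p] mp by (intro linorder_inj_onI) (auto simp: neq_iff)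
    then have card: "card (knot p ` {..<m}) = m" by (simp add: card_image)
    have "q = 0"
    proof (rule ccontr)
      assume "q \<noteq> 0"
      then have "m \<le> degree q"
        using card_mono[OF poly_roots_finite[OF \<open>q \<noteq> 0\<close>] sub] card_poly_roots_bound[OF \<open>q \<noteq> 0\<close>] card by linarith
      then show False using q(1) by simp
    qed
    then have v0: "v = 0\<^sub>v p" using q(2) v by (intro eq_vecI) auto
    have "y $ k = 0" if k: "k < Suc m" for k
      using coord[of k] k mp v0 Qc by (auto simp: y'_def)
    then have "y = 0\<^sub>v (Suc m)" using y(1) by (intro eq_vecI) auto
    with y(2) show False by simp
  qed
  show thesis
    by (rule that[OF Q SQ]) (use nonneg mono pos in \<open>auto simp: eigenvalue_asc_def es_def\<close>)
qed

text \<open>The kernel of the penalty matrix is the polynomial space, so its spectral projection to the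
  eigenvalue 0 is the orthogonal projection onto that space.\<close>

lemma P_mat_eq_kernel_projection:
  assumes m: "1 \<le> m" and mp: "m < p" and Q: "orthonormal_mat p Q"
    and SQ: "real p \<cdot>\<^sub>m A_star m p = Q * diagonal p \<mu> * transpose_mat Q"
  shows "P_mat m p = Q * diagonal p (\<lambda>i. if \<mu> i = 0 then 1 else 0) * transpose_mat Q"
proof -
  have mp': "m \<le> p" and p: "0 < p" using mp by auto
  let ?S = "real p \<cdot>\<^sub>m A_star m p"
  note S = scaled_A_star[OF m mp']
  define \<chi> where "\<chi> = (\<lambda>i. if \<mu> i = 0 then 1 else 0 :: real)"
  define P where "P = Q * diagonal p \<chi> * transpose_mat Q"
  have P: "P \<in> carrier_mat p p" "transpose_mat P = P" unfolding P_def by (rule diagonalized_symmetric[OF Q])+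
  have PP: "P * P = P"
  proof -
    have "(\<lambda>i. \<chi> i * \<chi> i) = \<chi>" by (auto simp: \<chi>_def)
    then show ?thesis unfolding P_def diagonalized_mult[OF Q] by simp
  qed
  have ker: "?S *\<^sub>v w = 0\<^sub>v p \<longleftrightarrow> w \<in> poly_space m p" if w: "w \<in> carrier_vec p" for w
  proof -
    have Aw: "A_star m p *\<^sub>v w \<in> carrier_vec p"
      by (rule mult_mat_vec_carrier[OF A_star_properties(1)[OF m mp'] w])
    have "real p \<cdot>\<^sub>v (A_star m p *\<^sub>v w) = 0\<^sub>v p \<longleftrightarrow> A_star m p *\<^sub>v w = 0\<^sub>v p"
      using Aw p by (auto simp: vec_eq_iff)
    then show ?thesis unfolding S(3)[OF w] A_star_kernel[OF m mp' w, symmetric] .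
  qed
  have im: "(\<lambda>w. P *\<^sub>v w) ` carrier_vec p = poly_space m p"
  proof (intro equalityI subsetI)
    fix w assume "w \<in> (\<lambda>w. P *\<^sub>v w) ` carrier_vec p"
    then obtain v where v: "v \<in> carrier_vec p" "w = P *\<^sub>v v" by blast
    have w: "w \<in> carrier_vec p" using v P by simp
    have "?S *\<^sub>v w = 0\<^sub>v p"
    proof (rule orthogonal_coordinates_eqI[OF Q])
      show "?S *\<^sub>v w \<in> carrier_vec p" by (rule mult_mat_vec_carrier[OF S(1) w])
      fix i assume i: "i < p"
      have q: "col Q i \<in> carrier_vec p" using Q i by (auto simp: orthonormal_mat_def)
      have "col Q i \<bullet> (?S *\<^sub>v w) = \<mu> i * (\<chi> i * (col Q i \<bullet> v))"
        unfolding SQ eigenvector_coordinates[OF Q w i] unfolding v(2) P_def eigenvector_coordinates[OF Q v(1) i] ..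
      also have "\<dots> = 0" by (simp add: \<chi>_def)
      finally show "col Q i \<bullet> (?S *\<^sub>v w) = col Q i \<bullet> 0\<^sub>v p" using q by simp
    qed simp
    then show "w \<in> poly_space m p" using ker[OF w] by simp
  next
    fix w assume w: "w \<in> poly_space m p"
    then have wc: "w \<in> carrier_vec p" using poly_space_iff[OF m] by blast
    have "P *\<^sub>v w = w"
    proof (rule orthogonal_coordinates_eqI[OF Q _ wc])
      show "P *\<^sub>v w \<in> carrier_vec p" by (rule mult_mat_vec_carrier[OF P(1) wc])
      fix i assume i: "i < p"
      have q: "col Q i \<in> carrier_vec p" using Q i by (auto simp: orthonormal_mat_def)
      have "\<mu> i * (col Q i \<bullet> w) = col Q i \<bullet> (?S *\<^sub>v w)"
        unfolding SQ eigenvector_coordinates[OF Q wc i] ..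
      also have "?S *\<^sub>v w = 0\<^sub>v p" using ker[OF wc] w by simp
      finally have "\<mu> i * (col Q i \<bullet> w) = 0" using q by simp
      then show "col Q i \<bullet> (P *\<^sub>v w) = col Q i \<bullet> w"
        unfolding P_def eigenvector_coordinates[OF Q wc i] by (auto simp: \<chi>_def)
    qed
    then show "w \<in> (\<lambda>w. P *\<^sub>v w) ` carrier_vec p" by (intro image_eqI[OF _ wc]) (rule sym)
  qed
  have "P_mat m p = P"
    unfolding P_mat_def orth_projection_def
  proof (rule the_equality)
    show "P \<in> carrier_mat p p \<and> transpose_mat P = P \<and> P * P = P \<and> (\<lambda>w. P *\<^sub>v w) ` carrier_vec p = poly_space m p"
      using P PP im by blast
    fix P' assume "P' \<in> carrier_mat p p \<and> transpose_mat P' = P' \<and> P' * P' = P' \<and>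
      (\<lambda>w. P' *\<^sub>v w) ` carrier_vec p = poly_space m p"
    then have P': "P' \<in> carrier_mat p p" "transpose_mat P' = P'" "P' * P' = P'"
      "(\<lambda>w. P' *\<^sub>v w) ` carrier_vec p = poly_space m p" by blast+
    show "P' = P" by (rule symmetric_projection_unique[OF P'(1-3) P PP]) (simp only: P'(4) im)
  qed
  then show ?thesis by (simp add: P_def \<chi>_def[abs_def])
qed

theorem A_mat_spectrum:
  assumes m: "1 \<le> m" and mp: "m < p"
  obtains Q a where "orthonormal_mat p Q" "A_mat m p = Q * diagonal p a * transpose_mat Q"
    "\<And>i. i < p \<Longrightarrow> 0 < a i"
    "\<And>i. m \<le> i \<Longrightarrow> i < p \<Longrightarrow> a i = eigenvalue_asc (real p \<cdot>\<^sub>m A_star m p) (i + 1)"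
    "\<And>i j. m \<le> i \<Longrightarrow> i \<le> j \<Longrightarrow> j < p \<Longrightarrow> a i \<le> a j"
proof -
  obtain Q \<mu> where Q: "orthonormal_mat p Q" and SQ: "real p \<cdot>\<^sub>m A_star m p = Q * diagonal p \<mu> * transpose_mat Q"
    and mu: "\<And>i. i < p \<Longrightarrow> \<mu> i = eigenvalue_asc (real p \<cdot>\<^sub>m A_star m p) (i + 1)"
    "\<And>i. i < p \<Longrightarrow> 0 \<le> \<mu> i" "\<And>i j. i \<le> j \<Longrightarrow> j < p \<Longrightarrow> \<mu> i \<le> \<mu> j"
    "\<And>i. m \<le> i \<Longrightarrow> i < p \<Longrightarrow> 0 < \<mu> i"
    using penalty_spectrum[OF m mp] by blast
  define a where "a = (\<lambda>i. (if \<mu> i = 0 then 1 else 0) + \<mu> i)"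
  have A: "A_mat m p = Q * diagonal p a * transpose_mat Q"
    unfolding A_mat_def P_mat_eq_kernel_projection[OF m mp Q SQ] SQ diagonalized_add[OF Q] a_def ..
  have eq: "a i = \<mu> i" if "m \<le> i" "i < p" for i using mu(4)[OF that] by (simp add: a_def)
  show thesis
  proof (rule that[OF Q A])
    show "0 < a i" if "i < p" for i using mu(2)[OF that] by (auto simp: a_def)
    show "a i = eigenvalue_asc (real p \<cdot>\<^sub>m A_star m p) (i + 1)" if "m \<le> i" "i < p" for i
      using eq[OF that] mu(1)[OF that(2)] by simp
    show "a i \<le> a j" if "m \<le> i" "i \<le> j" "j < p" for i j
      using that eq[of i] eq[of j] mu(3)[OF that(2,3)] by simp
  qed
qed

section \<open>Minimality of natural splines\<close>

lemma nderiv_derivative_chain: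
  assumes "times_differentiable m f"
  shows "derivative_chain m (\<lambda>i. nderiv i f)"
  unfolding derivative_chain_def
proof (rule exI[of _ "{}"], intro conjI allI impI ballI)
  fix i assume i: "i < m"
  then have d: "nderiv i f differentiable_on {0..1}" using assms by (simp add: times_differentiable_def)
  then show "continuous_on {0..1} (nderiv i f)" by (rule differentiable_imp_continuous_on)
  fix t :: real assume t: "t \<in> {0<..<1} - {}"
  then have "nderiv i f differentiable (at t within {0..1})" using d by (auto simp: differentiable_on_def)
  then have "(nderiv i f has_vector_derivative nderiv (Suc i) f t) (at t within {0..1})"
    unfolding nderiv_Suc by (simp add: vector_derivative_works)
  moreover have "at t within {0..1} = at t" using t by (intro at_within_interior) auto
  ultimately show "(nderiv i f has_real_derivative nderiv (Suc i) f t) (at t)"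
    by (simp add: has_real_derivative_iff_has_vector_derivative)
qed simp

lemma square_integrable_imp_set_integrable:
  assumes "square_integrable f" shows "set_integrable lborel {0..1} f"
proof -
  have m: "(\<lambda>t. indicator {0..1} t *\<^sub>R f t) \<in> borel_measurable lborel"
    using assms by (simp add: square_integrable_def set_borel_measurable_def)
  have b: "integrable lborel (\<lambda>t. indicator {0..1} t *\<^sub>R (1 + (f t)\<^sup>2))"
    using set_integral_add(1)[OF set_integrable_unit_interval_const[of 1], of "\<lambda>t. (f t)\<^sup>2"] assms
    by (simp add: square_integrable_def set_integrable_def)
  have "\<bar>y\<bar> \<le> 1 + y\<^sup>2" for y :: real
    using sum_squares_bound[of 1 "\<bar>y\<bar>"] by (simp add: power2_eq_square)
  then show ?thesis
    unfolding set_integrable_def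
    by (intro Bochner_Integration.integrable_bound[OF b m]) (auto simp: indicator_def)
qed

text \<open>The natural spline has the smallest energy among all interpolants of the same values: the pairing
  of its top derivative with that of \<open>\<alpha>\<close> equals its own energy.\<close>

theorem sample_penalty_le:
  assumes m: "1 \<le> m" and mp: "m \<le> p" and d: "times_differentiable m \<alpha>" and L2: "square_integrable (nderiv m \<alpha>)"
  shows "sample p \<alpha> \<bullet> (A_star m p *\<^sub>v sample p \<alpha>) \<le> (LBINT t:{0..1}. (nderiv m \<alpha> t)\<^sup>2)"
proof -
  have w: "sample p \<alpha> \<in> carrier_vec p" by (simp add: sample_def)
  obtain q c where I: "interpolates m p q c (sample p \<alpha>)" using interpolates_exists[OF m mp] by blast
  have c: "spline_coeffs m p q c" using I by (simp add: interpolates_def)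
  let ?S = "spline_deriv m p q c m" and ?F = "nderiv m \<alpha>"
  have iS: "set_integrable lborel {0..1} (\<lambda>t. (?S t)\<^sup>2)" by (rule spline_top_square_integrable[OF m c])
  have iF: "set_integrable lborel {0..1} (\<lambda>t. (?F t)\<^sup>2)" using L2 by (simp add: square_integrable_def)
  have iSF: "set_integrable lborel {0..1} (\<lambda>t. ?S t * ?F t)"
    by (rule spline_top_times_integrable[OF m c square_integrable_imp_set_integrable[OF L2]])
  have "(LBINT t:{0..1}. ?S t * ?F t) = duality_const m * (\<Sum>j<p. c j * \<alpha> (knot p j))"
    using spline_energy_pairing[OF m nderiv_derivative_chain[OF d] c] set_borel_integral_eq_integral(2)[OF iSF]
    by (simp add: integral_unique nderiv_0)
  also have "\<dots> = (LBINT t:{0..1}. (?S t)\<^sup>2)"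
    unfolding spline_energy[OF m c] using I by (simp add: interpolates_def sample_def)
  finally have cross: "(LBINT t:{0..1}. ?S t * ?F t) = (LBINT t:{0..1}. (?S t)\<^sup>2)" .
  have "0 \<le> (LBINT t:{0..1}. (?F t - ?S t)\<^sup>2)"
    by (auto simp: set_lebesgue_integral_def intro!: integral_nonneg)
  also have "\<dots> = (LBINT t:{0..1}. (?F t)\<^sup>2 - 2 * (?S t * ?F t) + (?S t)\<^sup>2)"
    by (simp add: power2_diff algebra_simps)
  also have "\<dots> = (LBINT t:{0..1}. (?F t)\<^sup>2) - 2 * (LBINT t:{0..1}. ?S t * ?F t) + (LBINT t:{0..1}. (?S t)\<^sup>2)"
  proof -
    have i2: "set_integrable lborel {0..1} (\<lambda>t. 2 * (?S t * ?F t))" using iSF by simp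
    show ?thesis
      using set_integral_add(2)[OF set_integral_diff(1)[OF iF i2] iS] set_integral_diff(2)[OF iF i2] by simp
  qed
  finally show ?thesis using cross A_star_form[OF m mp w I] by simp
qed

lemma A_mat_pos_def:
  assumes m: "1 \<le> m" and mp: "m < p" shows "pos_def p (A_mat m p)"
  using A_mat_spectrum[OF m mp] diagonalized_pos_def by metis

lemma A_mat_form:
  assumes m: "1 \<le> m" and mp: "m < p" and w: "w \<in> carrier_vec p"
  shows "w \<bullet> (A_mat m p *\<^sub>v w) = w \<bullet> (P_mat m p *\<^sub>v w) + real p * (w \<bullet> (A_star m p *\<^sub>v w))"
proof -
  have mp': "m \<le> p" using mp by simp
  obtain Q \<mu> where Q: "orthonormal_mat p Q" and SQ: "real p \<cdot>\<^sub>m A_star m p = Q * diagonal p \<mu> * transpose_mat Q"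
    using penalty_spectrum[OF m mp] by metis
  have Pc: "P_mat m p \<in> carrier_mat p p"
    unfolding P_mat_eq_kernel_projection[OF m mp Q SQ] by (rule diagonalized_symmetric[OF Q])
  note S = scaled_A_star[OF m mp']
  have Aw: "A_star m p *\<^sub>v w \<in> carrier_vec p" by (rule mult_mat_vec_carrier[OF A_star_properties(1)[OF m mp'] w])
  have Pw: "P_mat m p *\<^sub>v w \<in> carrier_vec p" by (rule mult_mat_vec_carrier[OF Pc w])
  show ?thesis
    unfolding A_mat_def add_mult_distrib_mat_vec[OF Pc S(1) w] S(3)[OF w]
    using w Aw Pw by (simp add: scalar_prod_add_distrib[of _ p])
qed

section \<open>The trace for the spline penalty\<close>

text \<open>The general trace bound with \<open>r = m + k\<close> and \<open>\<mu>\<close> the next eigenvalue of the penalty;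
  the exponent in the choice of \<open>k\<close> balances \<open>1 / \<rho>\<close> against \<open>k\<close> to the power
  \<open>2 * m + 2 * q + 1\<close>.\<close>

theorem ridge_trace_le:
  fixes x :: "nat \<Rightarrow> real \<Rightarrow> real"
  assumes m: "1 \<le> m" and mp: "m < p" and n: "0 < n" and \<rho>: "0 < \<rho>" and C\<^sub>0: "0 < C\<^sub>0"
    and eig: "\<And>k. k \<le> p - m - 1 \<Longrightarrow>
      real k ^ (2 * m) / eigenvalue_asc (real p \<cdot>\<^sub>m A_star m p) (k + m + 1) \<le> C\<^sub>0"
    and C: "0 < C" and q: "0 \<le> q" and k: "k = next_int (\<rho> powr (- 1 / (2 * real m + 2 * q + 1)))"
    and tail: "(\<Sum>j=k+1..p. eigenvalue_desc (gram n p x) j) \<le> C * real k powr (- 2 * q)"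
  shows "mat_trace (ridge_inv m n p \<rho> x * gram n p x) \<le> real m + real k * (2 + C * C\<^sub>0)"
proof -
  let ?G = "gram n p x"
  have mp': "m \<le> p" and p: "0 < p" using mp by auto
  interpret ridge m n p \<rho> by unfold_locales (use n p \<rho> A_mat_pos_def[OF m mp] in auto)
  obtain Q a where Q: "orthonormal_mat p Q" and A: "A_mat m p = Q * diagonal p a * transpose_mat Q"
    and a: "\<And>i. i < p \<Longrightarrow> 0 < a i"
    "\<And>i. m \<le> i \<Longrightarrow> i < p \<Longrightarrow> a i = eigenvalue_asc (real p \<cdot>\<^sub>m A_star m p) (i + 1)"
    "\<And>i j. m \<le> i \<Longrightarrow> i \<le> j \<Longrightarrow> j < p \<Longrightarrow> a i \<le> a j"
    using A_mat_spectrum[OF m mp] by blast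
  define es where "es = rev (sorted_list_of_multiset (proots (char_poly ?G)))"
  have "char_poly ?G = (\<Prod>e\<leftarrow>es. [:- e, 1:])"
    using char_poly_symmetric_splits[OF gram_carrier gram_symmetric, of n p x]
    by (simp add: es_def rev_map[symmetric])
  from symmetric_diagonalization[OF gram_carrier gram_symmetric this]
  obtain U where len: "length es = p" and U: "orthonormal_mat p U"
    and G: "?G = U * diagonal p (\<lambda>i. es ! i) * transpose_mat U" by blast
  have es: "es ! j = eigenvalue_desc ?G (j + 1)" for j by (simp add: es_def eigenvalue_desc_def)
  have es_nonneg: "0 \<le> es ! j" if j: "j < p" for j
  proof -
    have u: "col U j \<in> carrier_vec p" using U j by (auto simp: orthonormal_mat_def)
    have "0 \<le> col U j \<bullet> (?G *\<^sub>v col U j)" by (rule gram_nonneg[OF u])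
    also have "\<dots> = es ! j" unfolding G diagonalized_mult_vec[OF U j] using u col_orthonormal[OF U j j] by simp
    finally show ?thesis .
  qed
  have Rinv: "ridge_inv m n p \<rho> x \<in> carrier_mat p p" "(?G + \<rho> \<cdot>\<^sub>m A_mat m p) * ridge_inv m n p \<rho> x = 1\<^sub>m p"
    by (rule ridge_inv)+
  have bound: "mat_trace (ridge_inv m n p \<rho> x * ?G) \<le> real k' + real r + (\<Sum>j=k'..<p. es ! j) / (\<rho> * \<mu>)"
    if "0 < \<mu>" "\<And>j. r \<le> j \<Longrightarrow> j < p \<Longrightarrow> \<mu> \<le> a j" "k' \<le> p" "r \<le> p" for k' r \<mu>
    by (rule ridge_trace_bound[OF U G es_nonneg Q A a(1) \<rho> Rinv that])
  define e where "e = 2 * real m + 2 * q + 1"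
  have e: "0 < e" using q by (simp add: e_def)
  \<comment> \<open>The strict inequality comes from \<open>next_int\<close>; it also gives \<open>k > 0\<close>.\<close>
  have kgt: "\<rho> powr (- 1 / e) < real k"
  proof -
    define r where "r = \<rho> powr (- 1 / e)"
    have "k = nat (\<lfloor>r\<rfloor> + 1)" by (simp add: k next_int_def r_def e_def)
    moreover have "r < real_of_int (\<lfloor>r\<rfloor> + 1)" by linarith
    ultimately have "r < real k" by linarith
    then show ?thesis by (simp add: r_def)
  qed
  have kpos: "0 < real k" using kgt powr_gt_zero[of \<rho> "- 1 / e"] \<rho> by linarith
  have "1 / \<rho> = (\<rho> powr (- 1 / e)) powr e"
  proof -
    have "(\<rho> powr (- 1 / e)) powr e = \<rho> powr (- 1 / e * e)" by (rule powr_powr)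
    also have "- 1 / e * e = - 1" using e by simp
    also have "\<rho> powr (- 1) = 1 / \<rho>" using \<rho> powr_minus_divide[of \<rho> 1] by simp
    finally show ?thesis by simp
  qed
  also have "\<dots> \<le> real k powr e" using kgt e by (intro powr_mono2) auto
  finally have ke: "1 / \<rho> \<le> real k powr e" .
  have CC: "0 \<le> real k * (C * C\<^sub>0)" using kpos C C\<^sub>0 by simp
  show ?thesis
  proof (cases "k + m + 1 \<le> p")
    case False
    \<comment> \<open>No eigenvalue is left for \<open>\<mu>\<close>, so \<open>\<mu>\<close> is free; this choice makes the remainder at most 1,
      which is at most \<open>k\<close>, while \<open>p \<le> m + k\<close>.\<close>
    define T where "T = (\<Sum>j=0..<p. es ! j)"
    define \<mu> where "\<mu> = T / \<rho> + 1"
    have T: "0 \<le> T" unfolding T_def using es_nonneg by (intro sum_nonneg) auto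
    have mu: "0 < \<mu>" using T \<rho> by (simp add: \<mu>_def add_nonneg_pos)
    have "\<rho> * \<mu> = T + \<rho>" using \<rho> by (simp add: \<mu>_def field_simps)
    then have "T / (\<rho> * \<mu>) \<le> 1" using T \<rho> by simp
    moreover have "mat_trace (ridge_inv m n p \<rho> x * ?G) \<le> real 0 + real p + (\<Sum>j=0..<p. es ! j) / (\<rho> * \<mu>)"
      by (rule bound[OF mu]) auto
    moreover have "real p \<le> real m + real k" "1 \<le> real k" using False kpos by auto
    moreover have "real k * (2 + C * C\<^sub>0) = 2 * real k + real k * (C * C\<^sub>0)" by (simp add: algebra_simps)
    ultimately show ?thesis using CC unfolding T_def by linarith
  next
    case True
    define \<mu> where "\<mu> = a (m + k)"
    have mu: "0 < \<mu>" using a(1)[of "m + k"] True by (simp add: \<mu>_def)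
    have "real k ^ (2 * m) / \<mu> \<le> C\<^sub>0"
      using eig[of k] a(2)[of "m + k"] True by (simp add: \<mu>_def add.commute)
    then have kmu: "real k powr (2 * real m) / \<mu> \<le> C\<^sub>0"
      using kpos powr_realpow[OF kpos, of "2 * m"] by simp
    have sum_eq: "(\<Sum>j=k..<p. es ! j) = (\<Sum>j=k+1..p. eigenvalue_desc ?G j)"
    proof -
      have "(\<Sum>j=k..<p. es ! j) = (\<Sum>j=k..<p. eigenvalue_desc ?G (Suc j))" by (simp add: es)
      also have "\<dots> = (\<Sum>j=Suc k..<Suc p. eigenvalue_desc ?G j)" by (rule sum.shift_bounds_Suc_ivl[symmetric])
      finally show ?thesis by (simp add: atLeastLessThanSuc_atLeastAtMost)
    qed
    have "(\<Sum>j=k..<p. es ! j) / (\<rho> * \<mu>) \<le> C * real k powr (- 2 * q) / (\<rho> * \<mu>)"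
      unfolding sum_eq using tail \<rho> mu by (intro divide_right_mono) auto
    also have "\<dots> = (1 / \<rho>) * (C * real k powr (- 2 * q) * (1 / \<mu>))" by simp
    also have "\<dots> \<le> real k powr e * (C * real k powr (- 2 * q) * (C\<^sub>0 * real k powr (- (2 * real m))))"
    proof (intro mult_mono ke mult_left_mono)
      have "1 / \<mu> = (real k powr (2 * real m) / \<mu>) * real k powr (- (2 * real m))"
        using kpos by (simp add: powr_minus field_simps)
      also have "\<dots> \<le> C\<^sub>0 * real k powr (- (2 * real m))" by (rule mult_right_mono[OF kmu]) simp
      finally show "1 / \<mu> \<le> C\<^sub>0 * real k powr (- (2 * real m))" .
    qed (use C mu in auto)
    also have "\<dots> = C * C\<^sub>0 * (real k powr e * (real k powr (- 2 * q) * real k powr (- (2 * real m))))" by simp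
    also have "real k powr e * (real k powr (- 2 * q) * real k powr (- (2 * real m))) = real k powr 1"
      unfolding powr_add[symmetric] by (simp add: e_def)
    also have "\<dots> = real k" using kpos by simp
    finally have t: "(\<Sum>j=k..<p. es ! j) / (\<rho> * \<mu>) \<le> C * C\<^sub>0 * real k" .
    have "mat_trace (ridge_inv m n p \<rho> x * ?G) \<le> real k + real (m + k) + (\<Sum>j=k..<p. es ! j) / (\<rho> * \<mu>)"
      using a(3)[of "m + k"] True by (intro bound mu) (auto simp: \<mu>_def)
    also have "\<dots> \<le> real k + real (m + k) + C * C\<^sub>0 * real k" using t by simp
    also have "\<dots> = real m + real k * (2 + C * C\<^sub>0)" by (simp add: algebra_simps)
    finally show ?thesis .
  qed
qed

section \<open>Conditional expectations\<close>

lemma (in sigma_finite_subalgebra) real_cond_exp_sum_eq: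
  fixes f g :: "'b \<Rightarrow> 'a \<Rightarrow> real"
  assumes fin: "finite I" and int: "\<And>i. i \<in> I \<Longrightarrow> integrable M (f i)"
    and eq: "\<And>i. i \<in> I \<Longrightarrow> AE \<omega> in M. real_cond_exp M F (f i) \<omega> = g i \<omega>"
  shows "AE \<omega> in M. real_cond_exp M F (\<lambda>\<omega>. \<Sum>i\<in>I. f i \<omega>) \<omega> = (\<Sum>i\<in>I. g i \<omega>)"
proof -
  define f' where "f' = (\<lambda>i. if i \<in> I then f i else (\<lambda>_. 0))"
  have "integrable M (f' i)" for i using int by (auto simp: f'_def)
  from real_cond_exp_sum[of f', OF this, of I]
  have 1: "AE \<omega> in M. real_cond_exp M F (\<lambda>\<omega>. \<Sum>i\<in>I. f' i \<omega>) \<omega> = (\<Sum>i\<in>I. real_cond_exp M F (f' i) \<omega>)" .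
  have sum_f': "(\<lambda>\<omega>. \<Sum>i\<in>I. f' i \<omega>) = (\<lambda>\<omega>. \<Sum>i\<in>I. f i \<omega>)" by (auto simp: f'_def)
  have 2: "AE \<omega> in M. \<forall>i\<in>I. real_cond_exp M F (f i) \<omega> = g i \<omega>"
    using fin eq by (rule AE_finite_allI)
  show ?thesis
    using 1 2 unfolding sum_f'
  proof eventually_elim
    case (elim \<omega>)
    have "(\<Sum>i\<in>I. real_cond_exp M F (f' i) \<omega>) = (\<Sum>i\<in>I. g i \<omega>)"
      using elim(2) by (intro sum.cong) (auto simp: f'_def)
    then show ?case using elim(1) by simp
  qed
qed

text \<open>The defining set integrals factorize by independence.\<close>

lemma (in prob_space) real_cond_exp_indep:
  assumes ind: "indep_set (sets G) (sets F)" and F: "subalgebra M F" and G: "subalgebra M G"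
    and W: "W \<in> borel_measurable G" and int: "integrable M W"
  shows "AE \<omega> in M. real_cond_exp M F W \<omega> = expectation W"
proof -
  interpret finite_measure_subalgebra M F by unfold_locales (rule F)
  have WM: "W \<in> borel_measurable M" using W G by (rule measurable_from_subalg[rotated])
  show ?thesis
  proof (rule real_cond_exp_charact)
    fix A assume A: "A \<in> sets F"
    have AM: "A \<in> sets M" using A F by (auto simp: subalgebra_def)
    have gen1: "sigma_sets (space M) {W -` B \<inter> space M |B. B \<in> sets borel} \<subseteq> sets G"
    proof -
      have "{W -` B \<inter> space M |B. B \<in> sets borel} \<subseteq> sets G"
        using measurable_sets[OF W] G by (auto simp: subalgebra_def)
      then have "sigma_sets (space G) {W -` B \<inter> space M |B. B \<in> sets borel} \<subseteq> sets G" by (rule sets.sigma_sets_subset)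
      then show ?thesis using G by (simp add: subalgebra_def)
    qed
    have mI: "(indicator A :: 'a \<Rightarrow> real) \<in> borel_measurable F" using A by simp
    have gen2: "sigma_sets (space M) {indicator A -` B \<inter> space M |B. B \<in> sets (borel :: real measure)} \<subseteq> sets F"
    proof -
      have "{indicator A -` B \<inter> space M |B. B \<in> sets (borel :: real measure)} \<subseteq> sets F"
        using measurable_sets[OF mI] F by (auto simp: subalgebra_def)
      then have "sigma_sets (space F) {indicator A -` B \<inter> space M |B. B \<in> sets (borel :: real measure)} \<subseteq> sets F"
        by (rule sets.sigma_sets_subset)
      then show ?thesis using F by (simp add: subalgebra_def)
    qed
    have "indep_set (sigma_sets (space M) {W -` B \<inter> space M |B. B \<in> sets borel})
        (sigma_sets (space M) {indicator A -` B \<inter> space M |B. B \<in> sets (borel :: real measure)})"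
      unfolding indep_set_def
      by (rule indep_sets_mono_sets[OF ind[unfolded indep_set_def]]) (use gen1 gen2 in \<open>auto split: bool.splits\<close>)
    then have iv: "indep_var borel W borel (indicator A :: 'a \<Rightarrow> real)"
      unfolding indep_var_eq using WM AM by simp
    have "(\<integral>\<omega>. W \<omega> * indicator A \<omega> \<partial>M) = expectation W * expectation (indicator A)"
      by (rule indep_var_lebesgue_integral[OF iv int])
        (rule integrable_real_indicator[OF AM], simp add: emeasure_eq_measure)
    then show "(\<integral>\<omega>\<in>A. W \<omega> \<partial>M) = (\<integral>\<omega>\<in>A. expectation W \<partial>M)"
      using AM by (simp add: set_lebesgue_integral_def mult.commute)
  qed (use int in auto)
qed

text \<open>An integral \<open>Z\<close> over the parameter of functions that are all measurable for \<open>F\<close> need not be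
  measurable for \<open>F\<close> itself, when \<open>F\<close> is generated by uncountably many coordinates and joint
  measurability only holds for the larger algebra. It is nevertheless determined by \<open>F\<close> up to a
  null set: by Fubini's theorem, in the expectation of \<open>W Z\<close> the factor \<open>W\<close> can be replaced by its
  conditional expectation under the parameter integral.\<close>

lemma (in finite_measure_subalgebra) real_cond_exp_parametric_integral:
  fixes f :: "'a \<times> 'b \<Rightarrow> real"
  assumes L: "sigma_finite_measure L" and int: "integrable (M \<Otimes>\<^sub>M L) f"
    and F_meas: "\<And>t. t \<in> space L \<Longrightarrow> (\<lambda>\<omega>. f (\<omega>, t)) \<in> borel_measurable F"
  shows "integrable M (\<lambda>\<omega>. \<integral>t. f (\<omega>, t) \<partial>L)"
    "AE \<omega> in M. real_cond_exp M F (\<lambda>\<omega>. \<integral>t. f (\<omega>, t) \<partial>L) \<omega> = (\<integral>t. f (\<omega>, t) \<partial>L)"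
proof -
  interpret L: sigma_finite_measure L by (rule L)
  interpret PL: pair_sigma_finite M L ..
  define Z where "Z = (\<lambda>\<omega>. \<integral>t. f (\<omega>, t) \<partial>L)"
  show Zint: "integrable M (\<lambda>\<omega>. \<integral>t. f (\<omega>, t) \<partial>L)" by (rule PL.integrable_fst'[OF int])
  then have Z[measurable, simp]: "integrable M Z" by (simp add: Z_def)
  have Zm[measurable]: "Z \<in> borel_measurable M" by (rule borel_measurable_integrable[OF Z])
  have fm[measurable]: "f \<in> borel_measurable (M \<Otimes>\<^sub>M L)" by (rule borel_measurable_integrable[OF int])
  define E where "E = real_cond_exp M F"
  have Fsub: "f \<in> borel_measurable M" if "f \<in> borel_measurable F" for f :: "'a \<Rightarrow> real"
    by (rule measurable_from_subalg[OF subalg that])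
  have fubini: "(\<integral>\<omega>. W \<omega> * Z \<omega> \<partial>M) = (\<integral>t. (\<integral>\<omega>. W \<omega> * f (\<omega>, t) \<partial>M) \<partial>L)"
    "integrable M (\<lambda>\<omega>. W \<omega> * Z \<omega>)"
    if W[measurable]: "W \<in> borel_measurable M" and b: "\<And>\<omega>. \<bar>W \<omega>\<bar> \<le> 1" for W
  proof -
    have i: "integrable (M \<Otimes>\<^sub>M L) (\<lambda>z. W (fst z) * f z)"
      by (rule Bochner_Integration.integrable_bound[OF int])
        (use b in \<open>auto simp: abs_mult mult_left_le_one_le\<close>)
    have "(\<integral>t. (\<integral>\<omega>. W \<omega> * f (\<omega>, t) \<partial>M) \<partial>L) = (\<integral>\<omega>. (\<integral>t. W \<omega> * f (\<omega>, t) \<partial>L) \<partial>M)"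
      using PL.Fubini_integral[of "\<lambda>\<omega> t. W \<omega> * f (\<omega>, t)"] i by (simp add: case_prod_beta')
    then show "(\<integral>\<omega>. W \<omega> * Z \<omega> \<partial>M) = (\<integral>t. (\<integral>\<omega>. W \<omega> * f (\<omega>, t) \<partial>M) \<partial>L)" by (simp add: Z_def)
    show "integrable M (\<lambda>\<omega>. W \<omega> * Z \<omega>)"
      by (rule Bochner_Integration.integrable_bound[OF Z])
        (use b in \<open>auto simp: abs_mult mult_left_le_one_le\<close>)
  qed
  have key: "(\<integral>\<omega>\<in>A. Z \<omega> \<partial>M) = (\<integral>\<omega>\<in>A. E Z \<omega> \<partial>M)" if A: "A \<in> sets M" for A
  proof -
    define W where "W = (indicator A :: 'a \<Rightarrow> real)"
    have W[measurable]: "W \<in> borel_measurable M" using A by (simp add: W_def)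
    have Wi: "integrable M W" unfolding W_def
      by (rule integrable_real_indicator[OF A]) (simp add: emeasure_eq_measure)
    have Wb: "\<bar>W \<omega>\<bar> \<le> 1" for \<omega> by (simp add: W_def indicator_def)
    \<comment> \<open>A version of \<open>E W\<close> that is bounded everywhere, so that Fubini's theorem applies.\<close>
    define V where "V = (\<lambda>\<omega>. max 0 (min 1 (E W \<omega>)))"
    have VF[measurable]: "V \<in> borel_measurable F" unfolding V_def E_def by measurable
    have V[measurable]: "V \<in> borel_measurable M" by (rule Fsub[OF VF])
    have Vb: "\<bar>V \<omega>\<bar> \<le> 1" for \<omega> by (simp add: V_def)
    have EW: "E W \<in> borel_measurable M" unfolding E_def by simp
    have "AE \<omega> in M. 0 \<le> E W \<omega>" unfolding E_def by (rule real_cond_exp_ge_c[OF Wi]) (simp add: W_def)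
    moreover have "AE \<omega> in M. E W \<omega> \<le> 1" unfolding E_def by (rule real_cond_exp_le_c[OF Wi]) (simp add: W_def indicator_def)
    ultimately have VE: "AE \<omega> in M. V \<omega> = E W \<omega>" by eventually_elim (simp add: V_def)
    have inner: "(\<integral>\<omega>. W \<omega> * f (\<omega>, t) \<partial>M) = (\<integral>\<omega>. V \<omega> * f (\<omega>, t) \<partial>M)"
      if t: "t \<in> space L" and ft: "integrable M (\<lambda>\<omega>. f (\<omega>, t))" for t
    proof -
      have i: "integrable M (\<lambda>\<omega>. f (\<omega>, t) * W \<omega>)"
        by (rule Bochner_Integration.integrable_bound[OF ft])
          (use Wb ft in \<open>auto simp: abs_mult mult_left_le intro: borel_measurable_integrable\<close>)
      have "(\<integral>\<omega>. f (\<omega>, t) * E W \<omega> \<partial>M) = (\<integral>\<omega>. f (\<omega>, t) * W \<omega> \<partial>M)"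
        unfolding E_def by (rule real_cond_exp_intg(2)[OF i F_meas[OF t] W])
      moreover have "(\<integral>\<omega>. f (\<omega>, t) * E W \<omega> \<partial>M) = (\<integral>\<omega>. f (\<omega>, t) * V \<omega> \<partial>M)"
        using VE Fsub[OF F_meas[OF t]] EW by (intro integral_cong_AE) (auto elim: eventually_mono)
      ultimately show ?thesis by (simp add: mult.commute)
    qed
    have "(\<integral>\<omega>. W \<omega> * Z \<omega> \<partial>M) = (\<integral>t. (\<integral>\<omega>. W \<omega> * f (\<omega>, t) \<partial>M) \<partial>L)" by (rule fubini(1)[OF W Wb])
    also have "\<dots> = (\<integral>t. (\<integral>\<omega>. V \<omega> * f (\<omega>, t) \<partial>M) \<partial>L)"
    proof (rule integral_cong_AE)
      have "AE t in L. integrable M (\<lambda>\<omega>. f (\<omega>, t))" using PL.AE_integrable_snd[of "\<lambda>\<omega> t. f (\<omega>, t)"] int by simp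
      then show "AE t in L. (\<integral>\<omega>. W \<omega> * f (\<omega>, t) \<partial>M) = (\<integral>\<omega>. V \<omega> * f (\<omega>, t) \<partial>M)"
        using AE_space by eventually_elim (rule inner)
    qed measurable
    also have "\<dots> = (\<integral>\<omega>. V \<omega> * Z \<omega> \<partial>M)" by (rule fubini(1)[OF V Vb, symmetric])
    also have "\<dots> = (\<integral>\<omega>. V \<omega> * E Z \<omega> \<partial>M)"
      unfolding E_def by (rule real_cond_exp_intg(2)[OF fubini(2)[OF V Vb] VF Zm, symmetric])
    also have "\<dots> = (\<integral>\<omega>. E Z \<omega> * E W \<omega> \<partial>M)"
      using VE EW by (intro integral_cong_AE) (auto simp: E_def elim: eventually_mono)
    also have "\<dots> = (\<integral>\<omega>. E Z \<omega> * W \<omega> \<partial>M)"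
    proof -
      have EZ: "integrable M (E Z)" unfolding E_def by (rule real_cond_exp_int(1)[OF Z])
      have "integrable M (\<lambda>\<omega>. E Z \<omega> * W \<omega>)"
        by (rule Bochner_Integration.integrable_bound[OF EZ])
          (use Wb EZ in \<open>auto simp: abs_mult mult_left_le intro: borel_measurable_integrable\<close>)
      then show ?thesis unfolding E_def by (rule real_cond_exp_intg(2)) (auto simp: W)
    qed
    finally show ?thesis by (simp add: set_lebesgue_integral_def W_def mult.commute)
  qed
  \<comment> \<open>Conditioning on the full algebra turns equality of all set integrals into equality almost
    everywhere.\<close>
  interpret full: finite_measure_subalgebra M M by unfold_locales (simp add: subalgebra_def)
  have "AE \<omega> in M. real_cond_exp M M Z \<omega> = E Z \<omega>"
    by (rule full.real_cond_exp_charact[OF key]) (auto simp: E_def intro!: real_cond_exp_int(1))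
  moreover have "AE \<omega> in M. real_cond_exp M M Z \<omega> = Z \<omega>" by (rule full.real_cond_exp_F_meas) auto
  ultimately have "AE \<omega> in M. E Z \<omega> = Z \<omega>" by eventually_elim simp
  then show "AE \<omega> in M. real_cond_exp M F (\<lambda>\<omega>. \<integral>t. f (\<omega>, t) \<partial>L) \<omega> = (\<integral>t. f (\<omega>, t) \<partial>L)"
    by (simp add: E_def Z_def)
qed

section \<open>Measurability of the estimator\<close>

lemma det_measurable:
  fixes D :: "'w \<Rightarrow> real mat"
  assumes c: "\<And>\<omega>. D \<omega> \<in> carrier_mat k k"
    and m: "\<And>i j. i < k \<Longrightarrow> j < k \<Longrightarrow> (\<lambda>\<omega>. D \<omega> $$ (i, j)) \<in> borel_measurable N"
  shows "(\<lambda>\<omega>. det (D \<omega>)) \<in> borel_measurable N"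
proof -
  have "(\<lambda>\<omega>. \<Sum>\<pi> | \<pi> permutes {0..<k}. signof \<pi> * (\<Prod>i = 0..<k. D \<omega> $$ (i, \<pi> i))) \<in> borel_measurable N"
  proof (intro borel_measurable_sum borel_measurable_times borel_measurable_prod borel_measurable_const)
    fix \<pi> i assume "\<pi> \<in> {\<pi>. \<pi> permutes {0..<k}}" "i \<in> {0..<k}"
    then have "i < k" "\<pi> i < k" using permutes_in_image[of \<pi> "{0..<k}" i] by auto
    then show "(\<lambda>\<omega>. D \<omega> $$ (i, \<pi> i)) \<in> borel_measurable N" by (rule m)
  qed
  then show ?thesis by (simp add: det_def'[OF c])
qed

lemma adj_mat_measurable:
  fixes D :: "'w \<Rightarrow> real mat"
  assumes c: "\<And>\<omega>. D \<omega> \<in> carrier_mat k k"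
    and m: "\<And>i j. i < k \<Longrightarrow> j < k \<Longrightarrow> (\<lambda>\<omega>. D \<omega> $$ (i, j)) \<in> borel_measurable N"
    and ij: "i < k" "j < k"
  shows "(\<lambda>\<omega>. adj_mat (D \<omega>) $$ (i, j)) \<in> borel_measurable N"
proof -
  have d: "dim_row (D \<omega>) = k" "dim_col (D \<omega>) = k" for \<omega> using c[of \<omega>] by auto
  have "(\<lambda>\<omega>. det (mat_delete (D \<omega>) j i)) \<in> borel_measurable N"
  proof (rule det_measurable[of _ "k - 1"])
    show "mat_delete (D \<omega>) j i \<in> carrier_mat (k - 1) (k - 1)" for \<omega> by (rule carrier_matI) (simp_all add: mat_delete_def d)
    fix a b assume ab: "a < k - 1" "b < k - 1"
    have "mat_delete (D \<omega>) j i $$ (a, b) = D \<omega> $$ (if a < j then a else Suc a, if b < i then b else Suc b)" for \<omega>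
      using ab by (simp add: mat_delete_def d)
    then show "(\<lambda>\<omega>. mat_delete (D \<omega>) j i $$ (a, b)) \<in> borel_measurable N"
      using ab by (auto intro!: m)
  qed
  then show ?thesis using ij by (simp add: adj_mat_def cofactor_def d)
qed

text \<open>Cramer's rule, which shows that the entries of an inverse depend measurably on the matrix.\<close>

lemma inverse_entry:
  fixes B :: "real mat"
  assumes B: "B \<in> carrier_mat k k" and R: "R \<in> carrier_mat k k" "B * R = 1\<^sub>m k" and ij: "i < k" "j < k"
  shows "R $$ (i, j) = adj_mat B $$ (i, j) / det B"
proof -
  note adj = adj_mat[OF B]
  have "adj_mat B = adj_mat B * (B * R)" using adj(1) R(2) by simp
  also have "\<dots> = (adj_mat B * B) * R" using assoc_mult_mat[OF adj(1) B R(1)] by simp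
  also have "\<dots> = det B \<cdot>\<^sub>m R" unfolding adj(3) using R(1)
    by (simp add: mult_smult_assoc_mat[of _ k k _ k])
  finally have e: "adj_mat B $$ (i, j) = det B * R $$ (i, j)" using R(1) ij by simp
  have "det B * det R = det (B * R)" by (rule det_mult[OF B R(1), symmetric])
  then have "det B \<noteq> 0" using R(2) by auto
  then show ?thesis using e by simp
qed

context ridge
begin

context
  fixes N :: "'w measure" and X :: "nat \<Rightarrow> 'w \<Rightarrow> real \<Rightarrow> real"
  assumes X: "\<And>i j. i < n \<Longrightarrow> j < p \<Longrightarrow> (\<lambda>\<omega>. X i \<omega> (knot p j)) \<in> borel_measurable N"
begin

lemma centred_row_measurable:
  assumes "i < n" "j < p"
  shows "(\<lambda>\<omega>. centred_row n p (\<lambda>i. X i \<omega>) i $ j) \<in> borel_measurable N"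
  unfolding centred_row_index[OF assms] avg_def
  by (intro borel_measurable_diff borel_measurable_divide borel_measurable_sum borel_measurable_const X) (use assms in auto)

lemma gram_measurable:
  assumes "i < p" "j < p"
  shows "(\<lambda>\<omega>. gram n p (\<lambda>i. X i \<omega>) $$ (i, j)) \<in> borel_measurable N"
  unfolding gram_entry[OF assms]
  by (intro borel_measurable_divide borel_measurable_sum borel_measurable_times borel_measurable_const centred_row_measurable)
    (use assms in auto)

lemma ridge_inv_measurable:
  assumes ij: "i < p" "j < p"
  shows "(\<lambda>\<omega>. ridge_inv m n p \<rho> (\<lambda>i. X i \<omega>) $$ (i, j)) \<in> borel_measurable N"
proof -
  have Ac: "A_mat m p \<in> carrier_mat p p" using A by (simp add: pos_def_def)
  have c: "ridge_mat (\<lambda>i. X i \<omega>) \<in> carrier_mat p p" for \<omega> using ridge_mat_pos_def by (simp add: pos_def_def)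
  have e: "(\<lambda>\<omega>. ridge_mat (\<lambda>i. X i \<omega>) $$ (a, b)) \<in> borel_measurable N" if "a < p" "b < p" for a b
    using that Ac gram_measurable[OF that] by simp
  have "(\<lambda>\<omega>. adj_mat (ridge_mat (\<lambda>i. X i \<omega>)) $$ (i, j) / det (ridge_mat (\<lambda>i. X i \<omega>))) \<in> borel_measurable N"
    by (intro borel_measurable_divide adj_mat_measurable[OF c e ij] det_measurable[OF c e])
  then show ?thesis using inverse_entry[OF c ridge_inv(1,2) ij] by simp
qed

lemma influence_measurable:
  assumes ij: "i < n" "j < p"
  shows "(\<lambda>\<omega>. influence m n p \<rho> (\<lambda>i. X i \<omega>) i $ j) \<in> borel_measurable N"
proof -
  have "influence m n p \<rho> x i $ j = (1 / real n) * (\<Sum>l<p. ridge_inv m n p \<rho> x $$ (j, l) * centred_row n p x i $ l)" for x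
    using carrier_matD[OF ridge_inv(1)[of x]] ij by (simp add: influence_def scalar_prod_def atLeast0LessThan)
  then show ?thesis using ij
    by (auto intro!: borel_measurable_times borel_measurable_sum borel_measurable_divide ridge_inv_measurable centred_row_measurable)
qed

lemma form_measurable:
  assumes U: "\<And>j. j < p \<Longrightarrow> (\<lambda>\<omega>. U \<omega> $ j) \<in> borel_measurable N" "\<And>\<omega>. U \<omega> \<in> carrier_vec p"
    and V: "\<And>j. j < p \<Longrightarrow> (\<lambda>\<omega>. V \<omega> $ j) \<in> borel_measurable N" "\<And>\<omega>. V \<omega> \<in> carrier_vec p"
  shows "(\<lambda>\<omega>. U \<omega> \<bullet> (gram n p (\<lambda>i. X i \<omega>) *\<^sub>v V \<omega>)) \<in> borel_measurable N"
proof -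
  have "(\<lambda>\<omega>. centred_row n p (\<lambda>i. X i \<omega>) i \<bullet> U \<omega>) \<in> borel_measurable N"
    if i: "i < n" and U: "\<And>j. j < p \<Longrightarrow> (\<lambda>\<omega>. U \<omega> $ j) \<in> borel_measurable N" "\<And>\<omega>. U \<omega> \<in> carrier_vec p" for i U
    using i U(1) carrier_vecD[OF U(2)] unfolding scalar_prod_def
    by (auto intro!: borel_measurable_sum borel_measurable_times centred_row_measurable)
  then show ?thesis
    unfolding gram_form[OF U(2) V(2)] using U V
    by (intro borel_measurable_divide borel_measurable_sum borel_measurable_times borel_measurable_const) auto
qed

lemma influence_form_measurable:
  assumes "i < n" "j < n"
  shows "(\<lambda>\<omega>. influence_form m n p \<rho> (\<lambda>i. X i \<omega>) i j) \<in> borel_measurable N"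
  unfolding influence_form_def
  by (intro borel_measurable_times borel_measurable_const form_measurable influence_measurable influence_carrier assms)

lemma Gamma_sq_measurable:
  assumes "\<And>j. j < p \<Longrightarrow> (\<lambda>\<omega>. U \<omega> $ j) \<in> borel_measurable N" "\<And>\<omega>. U \<omega> \<in> carrier_vec p"
  shows "(\<lambda>\<omega>. Gamma_sq n p (\<lambda>i. X i \<omega>) (U \<omega>)) \<in> borel_measurable N"
  unfolding Gamma_sq_def by (intro borel_measurable_times borel_measurable_const form_measurable assms)

end

end

section \<open>Moments of the model\<close>

context functional_linear_model
begin

lemma X_point_measurable:
  assumes "i < n" "t \<in> {0..1}" shows "(\<lambda>\<omega>. X i \<omega> t) \<in> borel_measurable M"
proof -
  have "(\<lambda>\<omega>. (\<omega>, t)) \<in> measurable M (M \<Otimes>\<^sub>M restrict_space borel {0..1})"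
    using assms(2) by (intro measurable_Pair) (auto simp: space_restrict_space)
  from measurable_compose[OF this X_measurable[OF assms(1)]] show ?thesis by simp
qed

lemma curves_measurable: "curves n X \<in> measurable M (Pi\<^sub>M ({..<n} \<times> {0..1}) (\<lambda>_. borel))"
  unfolding curves_def[abs_def] by (rule measurable_restrict) (auto intro: X_point_measurable)

lemma curves_subalgebra: "subalgebra M (curves_algebra M n X)"
  unfolding subalgebra_def curves_algebra_def
  using sets_image_in_sets[OF refl curves_measurable] by simp

lemma X_curves_measurable:
  assumes "i < n" "t \<in> {0..1}" shows "(\<lambda>\<omega>. X i \<omega> t) \<in> borel_measurable (curves_algebra M n X)"
proof -
  have "curves n X \<in> measurable (curves_algebra M n X) (Pi\<^sub>M ({..<n} \<times> {0..1}) (\<lambda>_. borel))"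
    unfolding curves_algebra_def
    by (rule measurable_vimage_algebra1) (use measurable_space[OF curves_measurable] in auto)
  then have "(\<lambda>\<omega>. curves n X \<omega> (i, t)) \<in> borel_measurable (curves_algebra M n X)"
    using assms by (intro measurable_compose[OF _ measurable_component_singleton[of "(i, t)"]]) auto
  then show ?thesis using assms by (simp add: curves_def)
qed

definition errors_algebra :: "'w measure" where
  "errors_algebra = vimage_algebra (space M) (\<lambda>\<omega>. \<lambda>i\<in>{..<n}. \<epsilon> i \<omega>) (Pi\<^sub>M {..<n} (\<lambda>_. borel))"

lemma eps_measurable: "i < n \<Longrightarrow> \<epsilon> i \<in> borel_measurable M"
  using \<epsilon>_independent by (auto simp: indep_vars_def)

lemma errors_subalgebra: "subalgebra M errors_algebra"
proof -
  have "(\<lambda>\<omega>. \<lambda>i\<in>{..<n}. \<epsilon> i \<omega>) \<in> measurable M (Pi\<^sub>M {..<n} (\<lambda>_. borel))"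
    by (rule measurable_restrict) (auto intro: eps_measurable)
  from sets_image_in_sets[OF refl this] show ?thesis
    by (simp add: subalgebra_def errors_algebra_def)
qed

lemma eps_errors_measurable:
  assumes i: "i < n" shows "\<epsilon> i \<in> borel_measurable errors_algebra"
proof -
  have "(\<lambda>\<omega>. \<lambda>i\<in>{..<n}. \<epsilon> i \<omega>) \<in> measurable errors_algebra (Pi\<^sub>M {..<n} (\<lambda>_. borel))"
    unfolding errors_algebra_def by (rule measurable_vimage_algebra1) (auto simp: space_PiM)
  from measurable_compose[OF this measurable_component_singleton[of i "{..<n}" "\<lambda>_. borel"]]
  show ?thesis using i by simp
qed

lemma eps_integrable: "i < n \<Longrightarrow> integrable M (\<epsilon> i)"
  by (rule square_integrable_imp_integrable[OF eps_measurable \<epsilon>_square_integrable])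

lemma eps_product_integrable:
  assumes "i < n" "j < n" shows "integrable M (\<lambda>\<omega>. \<epsilon> i \<omega> * \<epsilon> j \<omega>)"
proof (rule Bochner_Integration.integrable_bound)
  show "integrable M (\<lambda>\<omega>. (\<epsilon> i \<omega>)\<^sup>2 + (\<epsilon> j \<omega>)\<^sup>2)"
    using assms by (intro Bochner_Integration.integrable_add \<epsilon>_square_integrable)
  show "(\<lambda>\<omega>. \<epsilon> i \<omega> * \<epsilon> j \<omega>) \<in> borel_measurable M"
    using assms by (intro borel_measurable_times eps_measurable)
  have "\<bar>a * b\<bar> \<le> a\<^sup>2 + b\<^sup>2" for a b :: real
  proof -
    have "2 * (\<bar>a\<bar> * \<bar>b\<bar>) \<le> \<bar>a\<bar>\<^sup>2 + \<bar>b\<bar>\<^sup>2" using sum_squares_bound[of "\<bar>a\<bar>" "\<bar>b\<bar>"] by simp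
    moreover have "0 \<le> \<bar>a\<bar> * \<bar>b\<bar>" by simp
    ultimately show ?thesis unfolding abs_mult power2_abs by linarith
  qed
  then show "AE \<omega> in M. norm (\<epsilon> i \<omega> * \<epsilon> j \<omega>) \<le> norm ((\<epsilon> i \<omega>)\<^sup>2 + (\<epsilon> j \<omega>)\<^sup>2)" by auto
qed

lemma eps_product_expectation:
  assumes ij: "i < n" "j < n"
  shows "expectation (\<lambda>\<omega>. \<epsilon> i \<omega> * \<epsilon> j \<omega>) = (if i = j then \<sigma>\<^sup>2 else 0)"
proof (cases "i = j")
  case True
  then show ?thesis using \<epsilon>_variance[OF ij(1)] by (simp add: power2_eq_square)
next
  case False
  have "indep_vars (\<lambda>_. borel) \<epsilon> {i, j}" by (rule indep_vars_subset[OF \<epsilon>_independent]) (use ij in auto)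
  then have "expectation (\<lambda>\<omega>. \<Prod>k\<in>{i, j}. \<epsilon> k \<omega>) = (\<Prod>k\<in>{i, j}. expectation (\<epsilon> k))"
    by (intro indep_vars_lebesgue_integral) (use ij eps_integrable in auto)
  then show ?thesis using False \<epsilon>_mean[OF ij(1)] by simp
qed

lemma indep_errors_curves: "indep_set (sets errors_algebra) (sets (curves_algebra M n X))"
  using \<epsilon>_independent_of_X by (simp add: errors_algebra_def)

lemma cond_exp_eps:
  assumes "i < n" shows "AE \<omega> in M. real_cond_exp M (curves_algebra M n X) (\<epsilon> i) \<omega> = 0"
  using real_cond_exp_indep[OF indep_errors_curves curves_subalgebra errors_subalgebra
      eps_errors_measurable[OF assms] eps_integrable[OF assms]] \<epsilon>_mean[OF assms] by simp

lemma cond_exp_eps_product: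
  assumes "i < n" "j < n"
  shows "AE \<omega> in M. real_cond_exp M (curves_algebra M n X) (\<lambda>\<omega>. \<epsilon> i \<omega> * \<epsilon> j \<omega>) \<omega> = (if i = j then \<sigma>\<^sup>2 else 0)"
  using real_cond_exp_indep[OF indep_errors_curves curves_subalgebra errors_subalgebra
      borel_measurable_times[OF eps_errors_measurable[OF assms(1)] eps_errors_measurable[OF assms(2)]]
      eps_product_integrable[OF assms]] eps_product_expectation[OF assms] by simp

text \<open>The regression signal is a parametric integral of the curve, and the curve at a single time is
  measurable for the algebra that is generated by all curves.\<close>

lemma signal_cond_exp:
  assumes i: "i < n" and \<alpha>: "continuous_on {0..1} \<alpha>"
  shows "integrable M (\<lambda>\<omega>. LBINT t:{0..1}. \<alpha> t * X i \<omega> t)"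
    "AE \<omega> in M. real_cond_exp M (curves_algebra M n X) (\<lambda>\<omega>. LBINT t:{0..1}. \<alpha> t * X i \<omega> t) \<omega>
       = (LBINT t:{0..1}. \<alpha> t * X i \<omega> t)"
proof -
  define L where "L = restrict_space lborel {0..1::real}"
  have L_space: "space L = {0..1}" by (simp add: L_def space_restrict_space)
  have fin: "emeasure L (space L) = 1"
    by (simp add: L_def space_restrict_space emeasure_restrict_space)
  interpret L: finite_measure L by (rule finite_measureI) (simp add: fin)
  interpret PL: pair_sigma_finite M L ..
  interpret P: finite_measure "M \<Otimes>\<^sub>M L"
    by (rule finite_measure_pair_measure) unfold_locales
  interpret F: finite_measure_subalgebra M "curves_algebra M n X" by unfold_locales (rule curves_subalgebra)
  have setsL: "sets L = sets (restrict_space borel {0..1})"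
    unfolding L_def by (intro sets_restrict_space_cong) simp
  have Xm: "(\<lambda>(\<omega>, t). X i \<omega> t) \<in> borel_measurable (M \<Otimes>\<^sub>M L)"
    using X_measurable[OF i] measurable_cong_sets[OF sets_pair_measure_cong[OF refl setsL] refl] by blast
  have X2: "integrable (M \<Otimes>\<^sub>M L) (\<lambda>z. ((\<lambda>(\<omega>, t). X i \<omega> t) z)\<^sup>2)"
  proof (rule integrableI_nonneg)
    have "(\<integral>\<^sup>+z. ennreal (((\<lambda>(\<omega>, t). X i \<omega> t) z)\<^sup>2) \<partial>(M \<Otimes>\<^sub>M L)) = (\<integral>\<^sup>+\<omega>. \<integral>\<^sup>+t. ennreal ((X i \<omega> t)\<^sup>2) \<partial>L \<partial>M)"
      using Xm by (subst L.nn_integral_fst[symmetric]) (auto intro!: borel_measurable_power measurable_compose[OF _ measurable_ennreal])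
    also have "\<dots> = (\<integral>\<^sup>+\<omega>. (\<integral>\<^sup>+t\<in>{0..1}. ennreal ((X i \<omega> t)\<^sup>2) \<partial>lborel) \<partial>M)"
      unfolding L_def by (simp add: nn_integral_restrict_space)
    also have "\<dots> < \<infinity>" by (rule X_second_moment[OF i])
    finally show "(\<integral>\<^sup>+z. ennreal (((\<lambda>(\<omega>, t). X i \<omega> t) z)\<^sup>2) \<partial>(M \<Otimes>\<^sub>M L)) < \<infinity>" .
  qed (use Xm in auto)
  have Xint: "integrable (M \<Otimes>\<^sub>M L) (\<lambda>(\<omega>, t). X i \<omega> t)"
    by (rule P.square_integrable_imp_integrable[OF Xm X2])
  have \<alpha>m: "\<alpha> \<in> borel_measurable L"
    using borel_measurable_continuous_on_restrict[OF \<alpha>] measurable_cong_sets[OF setsL refl] by blast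
  have "\<exists>K. \<forall>t\<in>{0..1}. \<bar>\<alpha> t\<bar> \<le> K"
    using compact_imp_bounded[OF compact_continuous_image[OF \<alpha> compact_Icc]] by (auto simp: bounded_iff)
  then obtain K where K: "\<And>t. t \<in> {0..1} \<Longrightarrow> \<bar>\<alpha> t\<bar> \<le> K" by blast
  define f where "f = (\<lambda>z :: 'w \<times> real. \<alpha> (snd z) * X i (fst z) (snd z))"
  have fint: "integrable (M \<Otimes>\<^sub>M L) f"
  proof (rule Bochner_Integration.integrable_bound)
    show "integrable (M \<Otimes>\<^sub>M L) (\<lambda>z. K * (\<lambda>(\<omega>, t). X i \<omega> t) z)" using Xint by simp
    have "(\<lambda>z. \<alpha> (snd z)) \<in> borel_measurable (M \<Otimes>\<^sub>M L)" by (rule measurable_compose[OF measurable_snd \<alpha>m])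
    then show "f \<in> borel_measurable (M \<Otimes>\<^sub>M L)" using Xm by (simp add: f_def case_prod_beta')
    have "norm (f z) \<le> norm (K * (\<lambda>(\<omega>, t). X i \<omega> t) z)" if z: "z \<in> space (M \<Otimes>\<^sub>M L)" for z
    proof -
      have "snd z \<in> {0..1}" using z by (auto simp: space_pair_measure L_space)
      then have "\<bar>\<alpha> (snd z)\<bar> \<le> \<bar>K\<bar>" using K by fastforce
      then show ?thesis by (simp add: f_def abs_mult case_prod_beta' mult_right_mono)
    qed
    then show "AE z in M \<Otimes>\<^sub>M L. norm (f z) \<le> norm (K * (\<lambda>(\<omega>, t). X i \<omega> t) z)" by auto
  qed
  have Fm: "(\<lambda>\<omega>. f (\<omega>, t)) \<in> borel_measurable (curves_algebra M n X)" if "t \<in> space L" for t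
    using X_curves_measurable[OF i, of t] that by (simp add: f_def L_space)
  have eq: "(LBINT t:{0..1}. \<alpha> t * X i \<omega> t) = (\<integral>t. f (\<omega>, t) \<partial>L)" for \<omega>
    unfolding L_def f_def by (simp add: integral_restrict_space set_lebesgue_integral_def)
  have sf: "sigma_finite_measure L" by unfold_locales
  show "integrable M (\<lambda>\<omega>. LBINT t:{0..1}. \<alpha> t * X i \<omega> t)"
    unfolding eq by (rule F.real_cond_exp_parametric_integral(1)[OF sf fint Fm])
  show "AE \<omega> in M. real_cond_exp M (curves_algebra M n X) (\<lambda>\<omega>. LBINT t:{0..1}. \<alpha> t * X i \<omega> t) \<omega>
       = (LBINT t:{0..1}. \<alpha> t * X i \<omega> t)"
    unfolding eq by (rule F.real_cond_exp_parametric_integral(2)[OF sf fint Fm])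
qed

end

section \<open>Mean and variance of the estimator\<close>

locale ridge_model = functional_linear_model M n X \<epsilon> \<sigma> + ridge m n p \<rho>
  for M :: "'w measure" and n X \<epsilon> \<sigma> m p \<rho> +
  fixes \<alpha> :: "real \<Rightarrow> real" and \<alpha>\<^sub>0 :: real
  assumes alpha_continuous: "continuous_on {0..1} \<alpha>"
begin

definition signal :: "(nat \<Rightarrow> real \<Rightarrow> real) \<Rightarrow> nat \<Rightarrow> real" where
  "signal x i = \<alpha>\<^sub>0 + (LBINT t:{0..1}. \<alpha> t * x i t)"

lemma estimator_decomposition:
  assumes "j < p"
  shows "alpha_hat m n p \<rho> x (\<lambda>i. signal x i + e i) $ j
    = alpha_hat m n p \<rho> x (signal x) $ j + (\<Sum>i<n. influence m n p \<rho> x i $ j * e i)"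
  unfolding alpha_hat_linear[OF assms] by (simp add: distrib_left sum.distrib)

lemma estimator_deviation:
  "alpha_hat m n p \<rho> x (\<lambda>i. signal x i + e i) - alpha_hat m n p \<rho> x (signal x)
    = vec p (\<lambda>j. \<Sum>i<n. influence m n p \<rho> x i $ j * e i)"
proof (rule eq_vecI)
  fix j assume "j < dim_vec (vec p (\<lambda>j. \<Sum>i<n. influence m n p \<rho> x i $ j * e i))"
  then have j: "j < p" by simp
  show "(alpha_hat m n p \<rho> x (\<lambda>i. signal x i + e i) - alpha_hat m n p \<rho> x (signal x)) $ j
    = vec p (\<lambda>j. \<Sum>i<n. influence m n p \<rho> x i $ j * e i) $ j"
    using j carrier_vecD[OF alpha_hat_carrier[of x "signal x"]] by (simp add: estimator_decomposition)
qed (simp add: carrier_vecD[OF alpha_hat_carrier])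

lemma response_fixed: "response \<alpha>\<^sub>0 \<alpha> (\<lambda>i _. x i) \<epsilon> \<omega> = (\<lambda>i. signal x i + \<epsilon> i \<omega>)"
  by (auto simp: response_def signal_def)

lemma response_random: "response \<alpha>\<^sub>0 \<alpha> X \<epsilon> \<omega> = (\<lambda>i. signal (\<lambda>i. X i \<omega>) i + \<epsilon> i \<omega>)"
  by (auto simp: response_def signal_def)

lemma mean_estimator:
  "mean_vec M p (\<lambda>\<omega>. alpha_hat m n p \<rho> x (response \<alpha>\<^sub>0 \<alpha> (\<lambda>i _. x i) \<epsilon> \<omega>)) = alpha_hat m n p \<rho> x (signal x)"
proof (rule eq_vecI)
  fix j assume "j < dim_vec (alpha_hat m n p \<rho> x (signal x))"
  then have j: "j < p" using carrier_vecD[OF alpha_hat_carrier[of x "signal x"]] by simp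
  have "(\<integral>\<omega>. (alpha_hat m n p \<rho> x (signal x) $ j + (\<Sum>i<n. influence m n p \<rho> x i $ j * \<epsilon> i \<omega>)) \<partial>M)
    = alpha_hat m n p \<rho> x (signal x) $ j + (\<Sum>i<n. influence m n p \<rho> x i $ j * expectation (\<epsilon> i))"
    by (subst Bochner_Integration.integral_add)
      (auto simp: prob_space eps_integrable intro!: Bochner_Integration.integral_sum Bochner_Integration.integrable_sum)
  then show "mean_vec M p (\<lambda>\<omega>. alpha_hat m n p \<rho> x (response \<alpha>\<^sub>0 \<alpha> (\<lambda>i _. x i) \<epsilon> \<omega>)) $ j
      = alpha_hat m n p \<rho> x (signal x) $ j"
    using j by (simp add: mean_vec_def response_fixed estimator_decomposition \<epsilon>_mean)
qed (simp add: mean_vec_def carrier_vecD[OF alpha_hat_carrier])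

lemma sum_influence_form_variance:
  "(\<Sum>i<n. \<Sum>i'<n. influence_form m n p \<rho> x i i' * (if i = i' then \<sigma>\<^sup>2 else 0)) = \<sigma>\<^sup>2 * (\<Sum>i<n. influence_form m n p \<rho> x i i)"
proof -
  have "(\<Sum>i'<n. influence_form m n p \<rho> x i i' * (if i = i' then \<sigma>\<^sup>2 else 0)) = \<sigma>\<^sup>2 * influence_form m n p \<rho> x i i" if "i < n" for i
  proof -
    have "(\<Sum>i'<n. influence_form m n p \<rho> x i i' * (if i = i' then \<sigma>\<^sup>2 else 0)) = (\<Sum>i'<n. if i' = i then \<sigma>\<^sup>2 * influence_form m n p \<rho> x i i else 0)"
      by (intro sum.cong) auto
    then show ?thesis using that by simp
  qed
  then show ?thesis by (simp add: sum_distrib_left)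
qed

lemma mean_square_deviation:
  "(\<integral>\<omega>. Gamma_sq n p x (alpha_hat m n p \<rho> x (response \<alpha>\<^sub>0 \<alpha> (\<lambda>i _. x i) \<epsilon> \<omega>)
      - mean_vec M p (\<lambda>\<omega>. alpha_hat m n p \<rho> x (response \<alpha>\<^sub>0 \<alpha> (\<lambda>i _. x i) \<epsilon> \<omega>))) \<partial>M)
    = \<sigma>\<^sup>2 * (\<Sum>i<n. influence_form m n p \<rho> x i i)"
proof -
  have "(\<integral>\<omega>. (\<Sum>i<n. \<Sum>i'<n. influence_form m n p \<rho> x i i' * (\<epsilon> i \<omega> * \<epsilon> i' \<omega>)) \<partial>M)
    = (\<Sum>i<n. \<Sum>i'<n. influence_form m n p \<rho> x i i' * expectation (\<lambda>\<omega>. \<epsilon> i \<omega> * \<epsilon> i' \<omega>))"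
    by (subst Bochner_Integration.integral_sum, force intro: Bochner_Integration.integrable_sum eps_product_integrable,
        intro sum.cong refl, subst Bochner_Integration.integral_sum) (auto intro: eps_product_integrable)
  also have "\<dots> = (\<Sum>i<n. \<Sum>i'<n. influence_form m n p \<rho> x i i' * (if i = i' then \<sigma>\<^sup>2 else 0))"
    by (intro sum.cong refl) (simp add: eps_product_expectation)
  also have "\<dots> = \<sigma>\<^sup>2 * (\<Sum>i<n. influence_form m n p \<rho> x i i)" by (rule sum_influence_form_variance)
  finally show ?thesis
    unfolding mean_estimator unfolding response_fixed estimator_deviation Gamma_sq_influence .
qed

abbreviation "\<F> \<equiv> curves_algebra M n X"

abbreviation "estimator \<omega> \<equiv> alpha_hat m n p \<rho> (\<lambda>i. X i \<omega>) (response \<alpha>\<^sub>0 \<alpha> X \<epsilon> \<omega>)"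

lemma cond_finite_measure_subalgebra: "finite_measure_subalgebra M \<F>"
  by unfold_locales (rule curves_subalgebra)

lemma knots_curves_measurable:
  assumes "i < n" "j < p" shows "(\<lambda>\<omega>. X i \<omega> (knot p j)) \<in> borel_measurable \<F>"
  by (rule X_curves_measurable) (use assms knot_bounds[of j p] in auto)

lemma knots_measurable:
  assumes "i < n" "j < p" shows "(\<lambda>\<omega>. X i \<omega> (knot p j)) \<in> borel_measurable M"
  by (rule measurable_from_subalg[OF curves_subalgebra knots_curves_measurable[OF assms]])

lemma bounded_times_integrable:
  assumes K: "K \<in> borel_measurable \<F>" and b: "\<And>\<omega>. \<bar>K \<omega>\<bar> \<le> (c :: real)" and g: "integrable M g"
  shows "integrable M (\<lambda>\<omega>. K \<omega> * g \<omega>)"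
proof (rule Bochner_Integration.integrable_bound)
  show "integrable M (\<lambda>\<omega>. c * g \<omega>)" using g by simp
  show "(\<lambda>\<omega>. K \<omega> * g \<omega>) \<in> borel_measurable M"
    using measurable_from_subalg[OF curves_subalgebra K] g by simp
  have "\<bar>K \<omega>\<bar> * \<bar>g \<omega>\<bar> \<le> \<bar>c\<bar> * \<bar>g \<omega>\<bar>" for \<omega> using b[of \<omega>] by (intro mult_right_mono) auto
  then show "AE \<omega> in M. norm (K \<omega> * g \<omega>) \<le> norm (c * g \<omega>)" by (simp add: abs_mult)
qed

lemma response_integrable:
  assumes "i < n" shows "integrable M (\<lambda>\<omega>. response \<alpha>\<^sub>0 \<alpha> X \<epsilon> \<omega> i)"
  unfolding response_def using signal_cond_exp(1)[OF assms alpha_continuous] eps_integrable[OF assms] by simp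

lemma response_cond_exp:
  assumes i: "i < n"
  shows "AE \<omega> in M. real_cond_exp M \<F> (\<lambda>\<omega>. response \<alpha>\<^sub>0 \<alpha> X \<epsilon> \<omega> i) \<omega> = signal (\<lambda>i. X i \<omega>) i"
proof -
  interpret F: finite_measure_subalgebra M \<F> by (rule cond_finite_measure_subalgebra)
  let ?Z = "\<lambda>\<omega>. LBINT t:{0..1}. \<alpha> t * X i \<omega> t"
  have Z: "integrable M ?Z" by (rule signal_cond_exp(1)[OF i alpha_continuous])
  have e: "integrable M (\<epsilon> i)" by (rule eps_integrable[OF i])
  have c: "integrable M (\<lambda>_. \<alpha>\<^sub>0)" by simp
  have "AE \<omega> in M. real_cond_exp M \<F> (\<lambda>_. \<alpha>\<^sub>0) \<omega> = \<alpha>\<^sub>0" by (rule F.real_cond_exp_F_meas[OF c]) simp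
  moreover have "AE \<omega> in M. real_cond_exp M \<F> (\<lambda>\<omega>. \<alpha>\<^sub>0 + ?Z \<omega>) \<omega> = real_cond_exp M \<F> (\<lambda>_. \<alpha>\<^sub>0) \<omega> + real_cond_exp M \<F> ?Z \<omega>"
    by (rule F.real_cond_exp_add[OF c Z])
  moreover have "AE \<omega> in M. real_cond_exp M \<F> (\<lambda>\<omega>. (\<alpha>\<^sub>0 + ?Z \<omega>) + \<epsilon> i \<omega>) \<omega>
      = real_cond_exp M \<F> (\<lambda>\<omega>. \<alpha>\<^sub>0 + ?Z \<omega>) \<omega> + real_cond_exp M \<F> (\<epsilon> i) \<omega>"
    using c Z e by (intro F.real_cond_exp_add) auto
  moreover note signal_cond_exp(2)[OF i alpha_continuous] cond_exp_eps[OF i]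
  ultimately show ?thesis
    unfolding response_def signal_def by eventually_elim simp
qed

lemma estimator_measurable:
  assumes "j < p" shows "(\<lambda>\<omega>. estimator \<omega> $ j) \<in> borel_measurable M"
  unfolding alpha_hat_linear[OF assms]
  by (intro borel_measurable_sum borel_measurable_times influence_measurable knots_measurable
      borel_measurable_integrable[OF response_integrable]) (use assms in auto)

lemma estimator_cond_exp:
  assumes j: "j < p"
  shows "AE \<omega> in M. real_cond_exp M \<F> (\<lambda>\<omega>. estimator \<omega> $ j) \<omega>
    = alpha_hat m n p \<rho> (\<lambda>i. X i \<omega>) (signal (\<lambda>i. X i \<omega>)) $ j"
proof -
  interpret F: finite_measure_subalgebra M \<F> by (rule cond_finite_measure_subalgebra)
  let ?K = "\<lambda>i \<omega>. influence m n p \<rho> (\<lambda>i. X i \<omega>) i $ j"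
  let ?y = "\<lambda>i \<omega>. response \<alpha>\<^sub>0 \<alpha> X \<epsilon> \<omega> i"
  obtain K where K: "\<And>x i j. i < n \<Longrightarrow> j < p \<Longrightarrow> \<bar>influence m n p \<rho> x i $ j\<bar> \<le> K" using influence_bounded by blast
  have Km: "?K i \<in> borel_measurable \<F>" if "i < n" for i
    by (rule influence_measurable[where X = X and N = "\<F>", OF knots_curves_measurable that j])
  have int: "integrable M (\<lambda>\<omega>. ?K i \<omega> * ?y i \<omega>)" if "i < n" for i
    by (rule bounded_times_integrable[OF Km[OF that] K[OF that j] response_integrable[OF that]])
  have "AE \<omega> in M. real_cond_exp M \<F> (\<lambda>\<omega>. \<Sum>i<n. ?K i \<omega> * ?y i \<omega>) \<omega> = (\<Sum>i<n. ?K i \<omega> * signal (\<lambda>i. X i \<omega>) i)"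
  proof (rule F.real_cond_exp_sum_eq)
    fix i assume "i \<in> {..<n}"
    then have i: "i < n" by simp
    show "integrable M (\<lambda>\<omega>. ?K i \<omega> * ?y i \<omega>)" by (rule int[OF i])
    have "AE \<omega> in M. real_cond_exp M \<F> (\<lambda>\<omega>. ?K i \<omega> * ?y i \<omega>) \<omega> = ?K i \<omega> * real_cond_exp M \<F> (?y i) \<omega>"
      by (rule F.real_cond_exp_mult[OF Km[OF i] borel_measurable_integrable[OF response_integrable[OF i]] int[OF i]])
    then show "AE \<omega> in M. real_cond_exp M \<F> (\<lambda>\<omega>. ?K i \<omega> * ?y i \<omega>) \<omega> = ?K i \<omega> * signal (\<lambda>i. X i \<omega>) i"
      using response_cond_exp[OF i] by eventually_elim simp
  qed simp
  then show ?thesis unfolding alpha_hat_linear[OF j] .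
qed

lemma cond_mean_estimator:
  "AE \<omega> in M. cond_mean_vec M n X p estimator \<omega> = alpha_hat m n p \<rho> (\<lambda>i. X i \<omega>) (signal (\<lambda>i. X i \<omega>))"
proof -
  have "AE \<omega> in M. \<forall>j\<in>{..<p}. real_cond_exp M \<F> (\<lambda>\<omega>. estimator \<omega> $ j) \<omega>
    = alpha_hat m n p \<rho> (\<lambda>i. X i \<omega>) (signal (\<lambda>i. X i \<omega>)) $ j"
    by (rule AE_finite_allI) (auto intro: estimator_cond_exp)
  then show ?thesis
  proof eventually_elim
    case (elim \<omega>)
    show ?case
      by (rule eq_vecI) (use elim carrier_vecD[OF alpha_hat_carrier[of "\<lambda>i. X i \<omega>" "signal (\<lambda>i. X i \<omega>)"]] in
        \<open>auto simp: cond_mean_vec_def cond_mean_def\<close>)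
  qed
qed

text \<open>The conditional version of \<open>mean_square_deviation\<close>: the coefficients of the products of errors
  are bounded functions of the curves, so they can be taken out of the conditional expectation.\<close>

lemma cond_mean_square_deviation:
  "AE \<omega> in M. cond_mean M n X (\<lambda>\<omega>. Gamma_sq n p (\<lambda>i. X i \<omega>) (estimator \<omega> - cond_mean_vec M n X p estimator \<omega>)) \<omega>
    = \<sigma>\<^sup>2 * (\<Sum>i<n. influence_form m n p \<rho> (\<lambda>i. X i \<omega>) i i)"
proof -
  interpret F: finite_measure_subalgebra M \<F> by (rule cond_finite_measure_subalgebra)
  let ?x = "\<lambda>\<omega> i. X i \<omega>"
  let ?E = "cond_mean_vec M n X p estimator"
  let ?Q = "\<lambda>z \<omega>. influence_form m n p \<rho> (?x \<omega>) (fst z) (snd z)"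
  let ?e = "\<lambda>z \<omega>. \<epsilon> (fst z) \<omega> * \<epsilon> (snd z) \<omega>"
  let ?I = "{..<n} \<times> {..<n}"
  have Qm: "?Q z \<in> borel_measurable \<F>" if "z \<in> ?I" for z
    using that by (intro influence_form_measurable knots_curves_measurable) auto
  have em: "integrable M (?e z)" if "z \<in> ?I" for z using that by (intro eps_product_integrable) auto
  have int: "integrable M (\<lambda>\<omega>. ?Q z \<omega> * ?e z \<omega>)" if "z \<in> ?I" for z
    using that by (intro bounded_times_integrable[OF Qm[OF that] _ em[OF that], of 1] influence_form_bounded) auto
  have ce: "AE \<omega> in M. real_cond_exp M \<F> (\<lambda>\<omega>. \<Sum>z\<in>?I. ?Q z \<omega> * ?e z \<omega>) \<omega>
      = (\<Sum>z\<in>?I. ?Q z \<omega> * (if fst z = snd z then \<sigma>\<^sup>2 else 0))"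
  proof (rule F.real_cond_exp_sum_eq)
    fix z assume z: "z \<in> ?I"
    show "integrable M (\<lambda>\<omega>. ?Q z \<omega> * ?e z \<omega>)" by (rule int[OF z])
    have "AE \<omega> in M. real_cond_exp M \<F> (\<lambda>\<omega>. ?Q z \<omega> * ?e z \<omega>) \<omega> = ?Q z \<omega> * real_cond_exp M \<F> (?e z) \<omega>"
      by (rule F.real_cond_exp_mult[OF Qm[OF z] borel_measurable_integrable[OF em[OF z]] int[OF z]])
    moreover have "AE \<omega> in M. real_cond_exp M \<F> (?e z) \<omega> = (if fst z = snd z then \<sigma>\<^sup>2 else 0)"
      using z by (intro cond_exp_eps_product) auto
    ultimately show "AE \<omega> in M. real_cond_exp M \<F> (\<lambda>\<omega>. ?Q z \<omega> * ?e z \<omega>) \<omega> = ?Q z \<omega> * (if fst z = snd z then \<sigma>\<^sup>2 else 0)"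
      by eventually_elim simp
  qed simp
  have pairs: "(\<Sum>z\<in>?I. g (fst z) (snd z)) = (\<Sum>i<n. \<Sum>i'<n. g i i')" for g :: "nat \<Rightarrow> nat \<Rightarrow> real"
    by (simp add: sum.cartesian_product case_prod_beta')
  have G_eq: "AE \<omega> in M. Gamma_sq n p (?x \<omega>) (estimator \<omega> - ?E \<omega>) = (\<Sum>z\<in>?I. ?Q z \<omega> * ?e z \<omega>)"
    using cond_mean_estimator
  proof eventually_elim
    case (elim \<omega>)
    show ?case
      unfolding elim unfolding response_random estimator_deviation Gamma_sq_influence
        pairs[of "\<lambda>i i'. influence_form m n p \<rho> (?x \<omega>) i i' * (\<epsilon> i \<omega> * \<epsilon> i' \<omega>)"] ..
  qed
  have Em: "(\<lambda>\<omega>. ?E \<omega> $ j) \<in> borel_measurable M" if "j < p" for j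
    using that by (simp add: cond_mean_vec_def cond_mean_def)
  have Gm: "(\<lambda>\<omega>. Gamma_sq n p (?x \<omega>) (estimator \<omega> - ?E \<omega>)) \<in> borel_measurable M"
  proof (rule Gamma_sq_measurable[where X = X and N = M, OF knots_measurable])
    show "estimator \<omega> - ?E \<omega> \<in> carrier_vec p" for \<omega>
      by (rule carrier_vecI) (simp add: cond_mean_vec_def)
    fix j assume j: "j < p"
    have "(\<lambda>\<omega>. estimator \<omega> $ j - ?E \<omega> $ j) \<in> borel_measurable M"
      by (intro borel_measurable_diff estimator_measurable Em j)
    then show "(\<lambda>\<omega>. (estimator \<omega> - ?E \<omega>) $ j) \<in> borel_measurable M"
      using j by (simp add: cond_mean_vec_def)
  qed
  have Sm: "(\<lambda>\<omega>. \<Sum>z\<in>?I. ?Q z \<omega> * ?e z \<omega>) \<in> borel_measurable M"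
    by (intro borel_measurable_sum borel_measurable_integrable[OF int])
  have "AE \<omega> in M. real_cond_exp M \<F> (\<lambda>\<omega>. Gamma_sq n p (?x \<omega>) (estimator \<omega> - ?E \<omega>)) \<omega>
     = real_cond_exp M \<F> (\<lambda>\<omega>. \<Sum>z\<in>?I. ?Q z \<omega> * ?e z \<omega>) \<omega>"
    by (rule F.real_cond_exp_cong[OF G_eq Gm Sm])
  then show ?thesis
    using ce unfolding cond_mean_def
  proof eventually_elim
    case (elim \<omega>)
    show ?case
      unfolding elim pairs[of "\<lambda>i i'. influence_form m n p \<rho> (?x \<omega>) i i' * (if i = i' then \<sigma>\<^sup>2 else 0)"]
      by (rule sum_influence_form_variance)
  qed
qed

end

section \<open>Bias and variance bounds\<close>

theorem theorem1:
  fixes m n p p\<^sub>0 p\<^sub>1 :: nat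
    and \<alpha> :: "real \<Rightarrow> real"
    and \<alpha>\<^sub>0 \<rho> \<sigma> C\<^sub>0 C\<^sub>1 C\<^sub>2 :: real
    and M :: "'w measure"
    and X :: "nat \<Rightarrow> 'w \<Rightarrow> real \<Rightarrow> real"
    and \<epsilon> :: "nat \<Rightarrow> 'w \<Rightarrow> real"
  assumes m: "1 \<le> m"
    and alpha_diff: "times_differentiable m \<alpha>"
    and alpha_L2: "square_integrable (nderiv m \<alpha>)"
    and C0_pos: "0 < C\<^sub>0"
    and p0: "m < p\<^sub>0"
    and C0: "\<forall>p'\<ge>p\<^sub>0. \<forall>k\<le>p' - m - 1.
      real k ^ (2 * m) / eigenvalue_asc (real p' \<cdot>\<^sub>m A_star m p') (k + m + 1) \<le> C\<^sub>0"
    and C1: "C\<^sub>1 = (LBINT t:{0..1}. (nderiv m \<alpha> t)\<^sup>2)"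
    and C2: "(LBINT t:{0..1}. (\<alpha> t)\<^sup>2) < C\<^sub>2"
    and p1_ge: "p\<^sub>0 \<le> p\<^sub>1"
    and p1: "\<forall>p'\<ge>p\<^sub>1.
      (1 / real p') * (sample p' \<alpha> \<bullet> (P_mat m p' *\<^sub>v sample p' \<alpha>)) \<le> C\<^sub>2"
    and n: "1 \<le> n"
    and p: "p\<^sub>1 \<le> p"
    and rho: "1 / real n ^ (2 * m) < \<rho>"
    and model: "functional_linear_model M n X \<epsilon> \<sigma>"
  shows
    "\<comment> \<open>conditional expectations given the random curves\<close>
     (let a = sample p \<alpha>;
         ahat = (\<lambda>\<omega>. alpha_hat m n p \<rho> (\<lambda>i. X i \<omega>) (response \<alpha>\<^sub>0 \<alpha> X \<epsilon> \<omega>));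
         Eahat = cond_mean_vec M n X p ahat;
         V = cond_mean M n X (\<lambda>\<omega>. Gamma_sq n p (\<lambda>i. X i \<omega>) (ahat \<omega> - Eahat \<omega>))
     in AE \<omega> in M. let x = (\<lambda>i. X i \<omega>) in
       Gamma_sq n p x (Eahat \<omega> - a)
         \<le> 2 * \<rho> * ((1 / real p) * (a \<bullet> (P_mat m p *\<^sub>v a)) + C\<^sub>1)
             + (4 / real n) * disc_variation n p \<alpha> x \<and>
       2 * \<rho> * ((1 / real p) * (a \<bullet> (P_mat m p *\<^sub>v a)) + C\<^sub>1)
             + (4 / real n) * disc_variation n p \<alpha> x
         \<le> 2 * \<rho> * (C\<^sub>2 + C\<^sub>1) + (4 / real n) * disc_variation n p \<alpha> x \<and>
       (\<forall>C>0. \<forall>q\<ge>0. let k = next_int (\<rho> powr (- 1 / (2 * real m + 2 * q + 1))) in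
          (\<Sum>j=k+1..p. eigenvalue_desc (gram n p x) j) \<le> C * real k powr (- 2 * q) \<longrightarrow>
          V \<omega> \<le> \<sigma>\<^sup>2 / real n * (real m + real k * (2 + C * C\<^sub>0)))) \<and>
     \<comment> \<open>every fixed realisation \<open>x\<close> of the curves, with expectations over the errors\<close>
     (\<forall>x. (\<forall>i<n. square_integrable (x i)) \<longrightarrow>
     (let a = sample p \<alpha>;
          ahat = (\<lambda>\<omega>. alpha_hat m n p \<rho> x (response \<alpha>\<^sub>0 \<alpha> (\<lambda>i _. x i) \<epsilon> \<omega>));
          Eahat = mean_vec M p ahat;
          V = (\<integral>\<omega>. Gamma_sq n p x (ahat \<omega> - Eahat) \<partial>M)
      in
       Gamma_sq n p x (Eahat - a)
         \<le> 2 * \<rho> * ((1 / real p) * (a \<bullet> (P_mat m p *\<^sub>v a)) + C\<^sub>1)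
             + (4 / real n) * disc_variation n p \<alpha> x \<and>
       2 * \<rho> * ((1 / real p) * (a \<bullet> (P_mat m p *\<^sub>v a)) + C\<^sub>1)
             + (4 / real n) * disc_variation n p \<alpha> x
         \<le> 2 * \<rho> * (C\<^sub>2 + C\<^sub>1) + (4 / real n) * disc_variation n p \<alpha> x \<and>
       (\<forall>C>0. \<forall>q\<ge>0. let k = next_int (\<rho> powr (- 1 / (2 * real m + 2 * q + 1))) in
          (\<Sum>j=k+1..p. eigenvalue_desc (gram n p x) j) \<le> C * real k powr (- 2 * q) \<longrightarrow>
          V \<le> \<sigma>\<^sup>2 / real n * (real m + real k * (2 + C * C\<^sub>0)))))"
proof -
  (* The interpretation below hides this fact behind an assumption of the same name. *)
  note p_ge = p
  have mp: "m < p" using p0 p1_ge p_ge by simp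
  have n0: "0 < n" and p0': "0 < p" using n mp by auto
  have "0 < 1 / real n ^ (2 * m)" using n0 by simp
  then have rho0: "0 < \<rho>" using rho by (rule less_trans)
  have \<alpha>_cont: "continuous_on {0..1} \<alpha>"
  proof -
    have "nderiv 0 \<alpha> differentiable_on {0..1}" using alpha_diff m by (auto simp: times_differentiable_def)
    then show ?thesis unfolding nderiv_0 by (rule differentiable_imp_continuous_on)
  qed
  interpret fm: functional_linear_model M n X \<epsilon> \<sigma> by (rule model)
  interpret ridge_model M n X \<epsilon> \<sigma> m p \<rho> \<alpha> \<alpha>\<^sub>0
    by unfold_locales (use n0 p0' rho0 A_mat_pos_def[OF m mp] \<alpha>_cont in auto)
  let ?a = "sample p \<alpha>"
  define B where "B = (1 / real p) * (?a \<bullet> (P_mat m p *\<^sub>v ?a))"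
  have a: "?a \<in> carrier_vec p" by (simp add: sample_def)
  have pen: "?a \<bullet> (A_star m p *\<^sub>v ?a) \<le> C\<^sub>1"
    unfolding C1 by (rule sample_penalty_le[OF m _ alpha_diff alpha_L2]) (use mp in simp)
  define S where "S = (1 / real p) * (?a \<bullet> (A_mat m p *\<^sub>v ?a))"
  have S_nonneg: "0 \<le> S"
    unfolding S_def by (rule mult_nonneg_nonneg[OF _ pos_def_nonneg[OF A a]]) simp
  have "S = B + ?a \<bullet> (A_star m p *\<^sub>v ?a)"
  proof -
    have "(1 / real p) * (u + real p * v) = (1 / real p) * u + v" for u v :: real
      using p0' by (simp add: field_simps)
    then show ?thesis unfolding S_def A_mat_form[OF m mp a] B_def .
  qed
  then have S_le: "S \<le> B + C\<^sub>1" by (rule ord_eq_le_trans) (rule add_left_mono[OF pen])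
  have B_le: "B \<le> C\<^sub>2" unfolding B_def by (rule p1[rule_format, OF p_ge])
  have bias: "Gamma_sq n p x (alpha_hat m n p \<rho> x (signal x) - ?a)
      \<le> 2 * \<rho> * (B + C\<^sub>1) + (4 / real n) * disc_variation n p \<alpha> x" for x
  proof -
    have d: "0 \<le> disc_variation n p \<alpha> x" unfolding disc_variation_def by (intro sum_nonneg) simp
    have "Gamma_sq n p x (alpha_hat m n p \<rho> x (signal x) - ?a) \<le> \<rho> * S + disc_variation n p \<alpha> x / real n"
      unfolding S_def signal_def[abs_def] by (rule bias_bound)
    also have "\<dots> \<le> 2 * \<rho> * (B + C\<^sub>1) + (4 / real n) * disc_variation n p \<alpha> x"
    proof (rule add_mono)
      have "\<rho> * S \<le> \<rho> * (B + C\<^sub>1)" using S_le rho0 by (intro mult_left_mono) auto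
      also have "\<dots> \<le> 2 * \<rho> * (B + C\<^sub>1)"
        using mult_nonneg_nonneg[OF less_imp_le[OF rho0] order.trans[OF S_nonneg S_le]] by simp
      finally show "\<rho> * S \<le> 2 * \<rho> * (B + C\<^sub>1)" .
      show "disc_variation n p \<alpha> x / real n \<le> (4 / real n) * disc_variation n p \<alpha> x"
        using d n0 by (simp add: divide_right_mono)
    qed
    finally show ?thesis .
  qed
  have mid: "2 * \<rho> * (B + C\<^sub>1) + (4 / real n) * disc_variation n p \<alpha> x
      \<le> 2 * \<rho> * (C\<^sub>2 + C\<^sub>1) + (4 / real n) * disc_variation n p \<alpha> x" for x
    using B_le rho0 by simp
  have var: "\<sigma>\<^sup>2 * (\<Sum>i<n. influence_form m n p \<rho> x i i) \<le> \<sigma>\<^sup>2 / real n * (real m + real k * (2 + C * C\<^sub>0))"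
    if "0 < C" "0 \<le> q" "k = next_int (\<rho> powr (- 1 / (2 * real m + 2 * q + 1)))"
      "(\<Sum>j=k+1..p. eigenvalue_desc (gram n p x) j) \<le> C * real k powr (- 2 * q)" for x C q k
  proof -
    have "mat_trace (ridge_inv m n p \<rho> x * gram n p x) \<le> real m + real k * (2 + C * C\<^sub>0)"
      by (rule ridge_trace_le[OF m mp n0 rho0 C0_pos _ that]) (use C0 p_ge p1_ge in auto)
    then have "(\<Sum>i<n. influence_form m n p \<rho> x i i) \<le> (real m + real k * (2 + C * C\<^sub>0)) / real n"
      by (intro order.trans[OF sum_influence_form_le_trace] divide_right_mono) auto
    from mult_left_mono[OF this, of "\<sigma>\<^sup>2"] show ?thesis by simp
  qed
  show ?thesis
    unfolding Let_def B_def[symmetric]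
  proof (rule conjI)
    show "AE \<omega> in M. Gamma_sq n p (\<lambda>i. X i \<omega>) (cond_mean_vec M n X p (\<lambda>\<omega>. estimator \<omega>) \<omega> - ?a)
          \<le> 2 * \<rho> * (B + C\<^sub>1) + (4 / real n) * disc_variation n p \<alpha> (\<lambda>i. X i \<omega>) \<and>
        2 * \<rho> * (B + C\<^sub>1) + (4 / real n) * disc_variation n p \<alpha> (\<lambda>i. X i \<omega>)
          \<le> 2 * \<rho> * (C\<^sub>2 + C\<^sub>1) + (4 / real n) * disc_variation n p \<alpha> (\<lambda>i. X i \<omega>) \<and>
        (\<forall>C>0. \<forall>q\<ge>0.
          (\<Sum>j=next_int (\<rho> powr (- 1 / (2 * real m + 2 * q + 1)))+1..p. eigenvalue_desc (gram n p (\<lambda>i. X i \<omega>)) j)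
            \<le> C * real (next_int (\<rho> powr (- 1 / (2 * real m + 2 * q + 1)))) powr (- 2 * q) \<longrightarrow>
          cond_mean M n X (\<lambda>\<omega>. Gamma_sq n p (\<lambda>i. X i \<omega>) (estimator \<omega> - cond_mean_vec M n X p (\<lambda>\<omega>. estimator \<omega>) \<omega>)) \<omega>
            \<le> \<sigma>\<^sup>2 / real n * (real m + real (next_int (\<rho> powr (- 1 / (2 * real m + 2 * q + 1)))) * (2 + C * C\<^sub>0)))"
      using cond_mean_estimator cond_mean_square_deviation
    proof eventually_elim
      case (elim \<omega>)
      show ?case
        unfolding elim by (intro conjI allI impI bias mid) (rule var[OF _ _ refl])
    qed
  next
    show "\<forall>x. (\<forall>i<n. square_integrable (x i)) \<longrightarrow>
        Gamma_sq n p x (mean_vec M p (\<lambda>\<omega>. alpha_hat m n p \<rho> x (response \<alpha>\<^sub>0 \<alpha> (\<lambda>i _. x i) \<epsilon> \<omega>)) - ?a)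
          \<le> 2 * \<rho> * (B + C\<^sub>1) + (4 / real n) * disc_variation n p \<alpha> x \<and>
        2 * \<rho> * (B + C\<^sub>1) + (4 / real n) * disc_variation n p \<alpha> x
          \<le> 2 * \<rho> * (C\<^sub>2 + C\<^sub>1) + (4 / real n) * disc_variation n p \<alpha> x \<and>
        (\<forall>C>0. \<forall>q\<ge>0.
          (\<Sum>j=next_int (\<rho> powr (- 1 / (2 * real m + 2 * q + 1)))+1..p. eigenvalue_desc (gram n p x) j)
            \<le> C * real (next_int (\<rho> powr (- 1 / (2 * real m + 2 * q + 1)))) powr (- 2 * q) \<longrightarrow>
          (\<integral>\<omega>. Gamma_sq n p x (alpha_hat m n p \<rho> x (response \<alpha>\<^sub>0 \<alpha> (\<lambda>i _. x i) \<epsilon> \<omega>)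
             - mean_vec M p (\<lambda>\<omega>. alpha_hat m n p \<rho> x (response \<alpha>\<^sub>0 \<alpha> (\<lambda>i _. x i) \<epsilon> \<omega>))) \<partial>M)
            \<le> \<sigma>\<^sup>2 / real n * (real m + real (next_int (\<rho> powr (- 1 / (2 * real m + 2 * q + 1)))) * (2 + C * C\<^sub>0)))"
      unfolding mean_square_deviation unfolding mean_estimator
      by (intro allI impI conjI bias mid) (rule var[OF _ _ refl])
  qed
qed

end
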